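(* Let $d\ge1$ be the space dimension, $b_0>\frac12$, $\gamma\in[0,1]$, $\eta,\eta_1,\eta_2,\eta_3\in(0,1]$, $0<b_1,c_1<b_0$, and $k\in\mathbb{R}$. Assume $$(1-\gamma)\big[(\eta+\eta_2+\eta_3)b_1+\eta_1c_1\big]=2b_0$$ and $$\begin{cases}2k\ge d-(1-\gamma)\big[(1-\eta_1)c_1+(1-\eta_2)b_1\big]/b_0\ge0,\\ 2k\ge d-(1-\gamma)\big[(1-\eta)b_1+(1-\eta_1)c_1\big]/b_0\ge0,\\ 2k\ge d-(1-\gamma)\big[(1-\eta_1)c_1+(1-\eta_3)b_1\big]/b_0\ge0.\end{cases}$$ Let $T_0<\infty$ and $C_0>0$. Then there is a constant $C$ such that for all $0<T\le T_0$ and all $v,v_1,v_2,v_3\in L^2(\mathbb{R}\times\mathbb{R}^d)$ for which the functions $$\mathcal F^{-1}\big(\langle\tau+|\xi|^2\rangle^{-b_1}\hat v\big),\quad \mathcal F^{-1}\big(\langle\tau+|\xi|^2\rangle^{-a_i}\hat v_i\big),\ i=1,2,3,\qquad (a_1,a_2,a_3)=(c_1,b_1,b_1),$$ are supported in $\{|t|\le C_0T\}$, one has $$|\mathcal Q|\le C\,T^{\gamma(3b_1+c_1)}\|v\|_{L^2}\|v_1\|_{L^2}\|v_2\|_{L^2}\|v_3\|_{L^2},$$ where $$\mathcal Q=\int\frac{\langle\xi_1\rangle^k\,\hat v\,\hat v_1\,\hat v_2\,\hat v_3}{\langle\sigma\rangle^{b_1}\langle\sigma_1\rangle^{c_1}\langle\widetilde{\sigma_2}\rangle^{b_1}\langle\sigma_3\rangle^{b_1}\langle\xi\rangle^k\langle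 z_2\rangle^k\langle\xi_3\rangle^k}\,d\xi_1\,d\xi_2\,d\xi_3\,d\tau_1\,d\tau_2\,d\tau_3.$$
   Context: Notation: $\langle\cdot\rangle=(1+|\cdot|^2)^{1/2}$; $\mathcal F$ (or $\hat{\ }$) is the space-time Fourier transform on $\mathbb{R}_t\times\mathbb{R}^d_x$ with dual variables $(\tau,\xi)$. In $\mathcal Q$ the integration is over $\xi_1,\xi_2,\xi_3\in\mathbb{R}^d$ and $\tau_1,\tau_2,\tau_3\in\mathbb{R}$, with $$\xi=\xi_1-\xi_2,\quad z_2=\xi_2-\xi_3,\quad \tau=\tau_1-\tau_2,\quad s_2=\tau_2-\tau_3,$$ $$\sigma=\tau+|\xi|^2,\quad \sigma_1=\tau_1+|\xi_1|^2,\quad \widetilde{\sigma_2}=s_2+|z_2|^2,\quad \sigma_3=\tau_3+|\xi_3|^2,$$ and the functions are evaluated as $\hat v=\hat v(\tau,\xi)$, $\hat v_1=\hat v_1(\tau_1,\xi_1)$, $\hat v_2=\hat v_2(s_2,z_2)$, $\hat v_3=\hat v_3(\tau_3,\xi_3)$. *)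

theory Defs
  imports "HOL-Analysis.Analysis"
begin

definition japanese :: "'a::real_normed_vector \<Rightarrow> real"  ("\<langle>_\<rangle>") where
  "\<langle>x\<rangle> = sqrt (1 + (norm x)\<^sup>2)"

(* Elements of L^2 are represented by Borel functions; identities between them are meant a.e. *)
definition L2 :: "('a::euclidean_space \<Rightarrow> complex) set" where
  "L2 = {f. f \<in> borel_measurable lborel \<and> integrable lborel (\<lambda>x. (norm (f x))\<^sup>2)}"

definition L2_norm :: "('a::euclidean_space \<Rightarrow> complex) \<Rightarrow> real" where
  "L2_norm f = sqrt (\<integral>x. (norm (f x))\<^sup>2 \<partial>lborel)"

definition fourier_integral :: "('a::euclidean_space \<Rightarrow> complex) \<Rightarrow> 'a \<Rightarrow> complex" where
  "fourier_integral f \<zeta> = (\<integral>y. cis (- (y \<bullet> \<zeta>)) * f y \<partial>lborel)"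

(* "g is the Fourier transform of f" for f in L^2 (Plancherel): g is the L^2 limit of the
   Fourier integrals of the truncations of f to balls, which are absolutely convergent.
   A relation rather than an operator, since g is determined only a.e.  The squared distance is
   an ennreal-valued integral because the Bochner integral of a non-integrable function is 0. *)
definition is_fourier_transform ::
    "('a::euclidean_space \<Rightarrow> complex) \<Rightarrow> ('a \<Rightarrow> complex) \<Rightarrow> bool" where
  "is_fourier_transform f g \<longleftrightarrow> f \<in> L2 \<and> g \<in> L2 \<and>
     (\<lambda>n::nat. \<integral>\<^sup>+\<zeta>. ennreal ((norm (g \<zeta> -
          fourier_integral (\<lambda>y. if y \<in> ball 0 (real n) then f y else 0) \<zeta>))\<^sup>2) \<partial>lborel)
       \<longlonglongrightarrow> 0"

(* The inverse Fourier transform w of g, i.e. the w with Fourier transform g, vanishes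
   a.e. outside |t| <= R. *)
definition inverse_fourier_supported ::
    "real \<Rightarrow> (real \<times> 'b::euclidean_space \<Rightarrow> complex) \<Rightarrow> bool" where
  "inverse_fourier_supported R g \<longleftrightarrow>
     (\<exists>w. is_fourier_transform w g \<and>
        (AE p in lborel. \<bar>fst p\<bar> > R \<longrightarrow> w p = 0))"

definition modulation_weight ::
    "real \<Rightarrow> (real \<times> 'b::euclidean_space \<Rightarrow> complex) \<Rightarrow> real \<times> 'b \<Rightarrow> complex" where
  "modulation_weight a g = (\<lambda>(\<tau>, \<xi>). complex_of_real (\<langle>\<tau> + (norm \<xi>)\<^sup>2\<rangle> powr (- a)) * g (\<tau>, \<xi>))"

definition Q_integrand ::
    "real \<Rightarrow> real \<Rightarrow> real \<Rightarrow>
     (real \<times> 'b::euclidean_space \<Rightarrow> complex) \<Rightarrow> (real \<times> 'b \<Rightarrow> complex) \<Rightarrow>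
     (real \<times> 'b \<Rightarrow> complex) \<Rightarrow> (real \<times> 'b \<Rightarrow> complex) \<Rightarrow>
     'b \<times> 'b \<times> 'b \<times> real \<times> real \<times> real \<Rightarrow> complex" where
  "Q_integrand b1 c1 k g g1 g2 g3 = (\<lambda>(\<xi>1, \<xi>2, \<xi>3, \<tau>1, \<tau>2, \<tau>3).
     let \<xi> = \<xi>1 - \<xi>2; z2 = \<xi>2 - \<xi>3; \<tau> = \<tau>1 - \<tau>2; s2 = \<tau>2 - \<tau>3;
         \<sigma> = \<tau> + (norm \<xi>)\<^sup>2; \<sigma>1 = \<tau>1 + (norm \<xi>1)\<^sup>2;
         \<sigma>2 = s2 + (norm z2)\<^sup>2; \<sigma>3 = \<tau>3 + (norm \<xi>3)\<^sup>2
     in complex_of_real (\<langle>\<xi>1\<rangle> powr k) * g (\<tau>, \<xi>) * g1 (\<tau>1, \<xi>1) * g2 (s2, z2) * g3 (\<tau>3, \<xi>3) /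
        complex_of_real
          (\<langle>\<sigma>\<rangle> powr b1 * \<langle>\<sigma>1\<rangle> powr c1 * \<langle>\<sigma>2\<rangle> powr b1 * \<langle>\<sigma>3\<rangle> powr b1 *
           \<langle>\<xi>\<rangle> powr k * \<langle>z2\<rangle> powr k * \<langle>\<xi>3\<rangle> powr k))"

definition Q_form ::
    "real \<Rightarrow> real \<Rightarrow> real \<Rightarrow>
     (real \<times> 'b::euclidean_space \<Rightarrow> complex) \<Rightarrow> (real \<times> 'b \<Rightarrow> complex) \<Rightarrow>
     (real \<times> 'b \<Rightarrow> complex) \<Rightarrow> (real \<times> 'b \<Rightarrow> complex) \<Rightarrow> complex" where
  "Q_form b1 c1 k g g1 g2 g3 = (\<integral>p. Q_integrand b1 c1 k g g1 g2 g3 p \<partial>lborel)"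

end

theory Submission
  imports Defs
begin

text \<open>
  Time gain: if \<open>g = \<langle>\<sigma>\<rangle>\<^bsup>-a\<^esup> vh\<close> is the Fourier transform of a function supported in
  \<open>\<bar>t\<bar> \<le> R\<close>, then \<open>g\<close> is reproduced by convolution in \<open>\<tau>\<close> with a kernel of squared \<open>L\<^sup>2\<close> norm
  \<open>O(R)\<close>. By Cauchy-Schwarz at most half of the squared norm of \<open>g\<close> lives in \<open>\<bar>\<sigma>\<bar> < M\<close> for some
  \<open>M\<close> comparable to \<open>1 / R\<close>, whence \<open>\<parallel>g\<parallel> \<le> C R\<^bsup>a\<^esup> \<parallel>vh\<parallel>\<close>. Interpolating with the
  trivial bound reduces the claim to \<open>\<gamma> = 0\<close>, with exponents \<open>(1 - \<gamma>) b1\<close> and \<open>(1 - \<gamma>) c1\<close> and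
  without support conditions.

  After \<open>\<langle>\<xi>1\<rangle>\<^bsup>k\<^esup>\<close> has been distributed over the three other frequencies, no Strichartz
  inequality is needed. Pointwise, the weight lies below a sum of extremal weights (a convex
  combination of the exponents). For most of these, the form splits into two pairs
  of functions, and Cauchy-Schwarz leaves the supremum over the output frequency of one integral in
  the variables of each pair; in the exceptional one, three functions are paired with the
  fourth. All these integrals are finite because a paraboloid shell of thickness \<open>1\<close> over
  a plane has bounded measure. The assumption on the exponents leaves room since \<open>b0 > 1 / 2\<close>.
\<close>

section \<open>The Japanese bracket along quadratic polynomials\<close>

text \<open>The bookkeeping parameter is a real number \<open>E\<close> in [0, min 2 d]: how many of
  the d frequency directions are made integrable by modulation decay. In a pair, one modulation of
  exponent \<beta> > 1 / 2 is integrated out; the other, of exponent \<open>E * \<beta> / 2\<close>,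
  becomes a paraboloid shell and controls E directions, so that the frequency weight has to control
  only d - E. The cap 2 is there because shells have uniformly bounded measure in at most two
  dimensions. Two pairs consume the exponent (2 + E) \<beta>. The supply is (1 - \<gamma>) (3 b1 +
  c1), which is 2 b0 plus the terms with 1 - \<eta>, ..., 1 - \<eta>3; the conditions on k compare d
  - 2 k with this surplus divided by b0. Taking \<beta> < b0 makes the comparison strict, which pays
  for the \<epsilon> of the frequency integrals. The exceptional case exists because c1 may be tiny:
  then v1 cannot afford \<open>E * \<beta> / 2\<close>, whereas the triple weight asks nothing of
  its modulation. Constants are immaterial, so the Plancherel inequality is proved only up to a
  constant, from a nonnegative summability kernel and Schur's test.\<close>

abbreviation (input) nn_integral_lborel :: "('a::euclidean_space \<Rightarrow> ennreal) \<Rightarrow> ennreal"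
    (binder "NINT " 10) where
  "nn_integral_lborel f \<equiv> integral\<^sup>N lborel f"

abbreviation (input) borel_fun :: "('a::topological_space \<Rightarrow> 'b::topological_space) \<Rightarrow> bool" where
  "borel_fun f \<equiv> f \<in> borel_measurable borel"

lemma japanese_ge_1: "1 \<le> \<langle>x\<rangle>"
  by (simp add: japanese_def)

lemma japanese_pos [simp]: "0 < \<langle>x\<rangle>"
  using japanese_ge_1[of x] by linarith

lemma japanese_nonneg [simp]: "0 \<le> \<langle>x\<rangle>"
  using japanese_pos[of x] by (rule less_imp_le)

lemma japanese_nonzero [simp]: "\<langle>x\<rangle> \<noteq> 0"
  using japanese_pos[of x] by linarith

lemma japanese_measurable [measurable]: "borel_fun (japanese :: 'a::euclidean_space \<Rightarrow> real)"
  unfolding japanese_def[abs_def] by measurable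

lemma measurable_fst_borel [measurable]:
  "borel_fun (fst :: 'a::second_countable_topology \<times> 'b::second_countable_topology \<Rightarrow> 'a)"
  by (intro borel_measurable_continuous_onI continuous_intros)

lemma measurable_snd_borel [measurable]:
  "borel_fun (snd :: 'a::second_countable_topology \<times> 'b::second_countable_topology \<Rightarrow> 'b)"
  by (intro borel_measurable_continuous_onI continuous_intros)

lemma japanese_mono: "norm x \<le> norm y \<Longrightarrow> \<langle>x\<rangle> \<le> \<langle>y\<rangle>"
  by (simp add: japanese_def power_mono)

lemma japanese_triangle: "\<langle>x + y\<rangle> \<le> \<langle>x\<rangle> + \<langle>y\<rangle>"
proof -
  have "1 + (norm (x + y))\<^sup>2 \<le> 1 + (norm x + norm y)\<^sup>2"
    by (simp add: norm_triangle_ineq power_mono)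
  also have "\<dots> \<le> (\<langle>x\<rangle> + \<langle>y\<rangle>)\<^sup>2"
  proof -
    have "norm x * norm y \<le> \<langle>x\<rangle> * \<langle>y\<rangle>"
      by (intro mult_mono) (auto simp: japanese_def intro!: real_le_rsqrt)
    then show ?thesis by (auto simp: power2_sum japanese_def)
  qed
  finally have "\<langle>x + y\<rangle> \<le> sqrt ((\<langle>x\<rangle> + \<langle>y\<rangle>)\<^sup>2)"
    unfolding japanese_def[of "x + y"] by (rule real_sqrt_le_mono)
  then show ?thesis by (simp add: add_pos_pos less_imp_le)
qed

lemma japanese_ge_abs: "norm x \<le> \<langle>x\<rangle>"
  by (simp add: japanese_def real_le_rsqrt)

text \<open>Lets a power of the bracket be replaced by its average over a unit interval, up to a
  constant factor.\<close>

lemma japanese_near: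
  fixes u v :: real
  assumes "\<bar>u - v\<bar> \<le> 1 / 2"
  shows "\<langle>u\<rangle> \<le> 2 * \<langle>v\<rangle>"
proof -
  have "\<bar>u\<bar> \<le> \<bar>v\<bar> + 1/2" using assms by linarith
  then have "u\<^sup>2 \<le> (\<bar>v\<bar> + 1/2)\<^sup>2" using abs_le_square_iff[of u "\<bar>v\<bar> + 1/2"] by simp
  also have "\<dots> \<le> 1/2 + 2 * v\<^sup>2"
    using zero_le_power2[of "\<bar>v\<bar> - 1/2"] by (simp add: power2_eq_square algebra_simps)
  also have "\<dots> \<le> 3 + 4 * v\<^sup>2" by (intro add_mono mult_right_mono) auto
  finally have "1 + u\<^sup>2 \<le> 4 * (1 + v\<^sup>2)" by simp
  then show ?thesis unfolding japanese_def
    by (intro real_le_lsqrt) (auto simp: power_mult_distrib)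
qed

lemma japanese_inner_le: "b \<in> Basis \<Longrightarrow> \<langle>x \<bullet> b\<rangle> \<le> \<langle>x\<rangle>"
  for x :: "'a::euclidean_space"
  by (rule japanese_mono) (simp add: Basis_le_norm)

lemma powr_japanese_antimono: "a \<le> b \<Longrightarrow> \<langle>x\<rangle> powr (- b) \<le> \<langle>x\<rangle> powr (- a)"
  using japanese_ge_1[of x] by (simp add: powr_mono)

section \<open>Translation, reflection and Fubini for the Lebesgue integral\<close>

lemma NINT_shift:
  fixes f :: "'a::euclidean_space \<Rightarrow> ennreal"
  assumes [measurable]: "borel_fun f"
  shows "(NINT x. f (a + x)) = (NINT x. f x)"
proof -
  have "(NINT x. f x) = (\<integral>\<^sup>+x. f x \<partial>distr lborel borel ((+) a))"
    by (simp add: lborel_distr_plus)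
  also have "\<dots> = (NINT x. f (a + x))" by (subst nn_integral_distr) auto
  finally show ?thesis by simp
qed

lemma NINT_reflect:
  fixes f :: "'a::euclidean_space \<Rightarrow> ennreal"
  assumes [measurable]: "borel_fun f"
  shows "(NINT x. f (a - x)) = (NINT x. f x)"
proof -
  have "lborel = density (distr lborel borel (\<lambda>x. a + (-1) *\<^sub>R x)) (\<lambda>_. ennreal (\<bar>-1\<bar> ^ DIM('a)))"
    by (rule lborel_affine) simp
  also have "\<dots> = distr lborel borel (\<lambda>x. a - x)" by (simp add: density_1)
  finally have "(NINT x. f x) = (\<integral>\<^sup>+x. f x \<partial>distr lborel borel (\<lambda>x. a - x))"
    by (rule arg_cong[where f="\<lambda>M. integral\<^sup>N M f"])
  also have "\<dots> = (NINT x. f (a - x))" by (subst nn_integral_distr) auto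
  finally show ?thesis by simp
qed

lemma NINT_swap:
  fixes f :: "'a::euclidean_space \<Rightarrow> 'b::euclidean_space \<Rightarrow> ennreal"
  assumes "borel_fun (\<lambda>(x, y). f x y)"
  shows "(NINT x. NINT y. f x y) = (NINT y. NINT x. f x y)"
  by (rule lborel_pair.Fubini'[symmetric]) (use assms in \<open>simp add: lborel_prod\<close>)

lemma NINT_pair:
  fixes f :: "'a::euclidean_space \<times> 'b::euclidean_space \<Rightarrow> ennreal"
  assumes "borel_fun f"
  shows "(NINT z. f z) = (NINT x. NINT y. f (x, y))"
  using lborel.nn_integral_fst[of f lborel] assms by (simp add: lborel_prod)

section \<open>Uniform bounds in one and two real variables\<close>

lemma japanese_powr_integrable:
  assumes "1 < s"
  shows "(NINT x. ennreal (\<langle>x::real\<rangle> powr (- s))) < \<infinity>"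
proof -
  have tail: "(NINT x. ennreal ((x::real) powr (-s)) * indicator {1..} x) < \<infinity>"
  proof -
    have "((\<lambda>x::real. x powr (1 - s) / (1 - s)) \<longlongrightarrow> 0 / (1 - s)) at_top"
      using assms by (intro tendsto_divide tendsto_neg_powr filterlim_ident tendsto_const) auto
    moreover have "((\<lambda>x. x powr (1 - s) / (1 - s)) has_real_derivative x powr (- s)) (at x)" if "1 \<le> x" for x
    proof -
      have "((\<lambda>x. x powr (1 - s)) has_real_derivative (1 - s) * x powr (1 - s - 1)) (at x)"
        using that by (intro has_real_derivative_powr) auto
      from DERIV_cdivide[OF this, of "1 - s"] assms show ?thesis by simp
    qed
    ultimately have "(NINT x. ennreal ((x::real) powr (-s)) * indicator {1..} x)
        = ennreal (0 / (1 - s) - 1 powr (1 - s) / (1 - s))"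
      by (intro nn_integral_FTC_atLeast[where F="\<lambda>x. x powr (1 - s) / (1 - s)"]) auto
    then show ?thesis by (simp only: infinity_ennreal_def ennreal_less_top)
  qed
  have tail': "(NINT x. ennreal ((- x :: real) powr (-s)) * indicator {1..} (- x)) < \<infinity>"
    using tail NINT_reflect[of "\<lambda>x::real. ennreal (x powr (-s)) * indicator {1..} x" 0] by simp
  have "(NINT x. ennreal (\<langle>x::real\<rangle> powr (- s)))
     \<le> (NINT x. indicator {-1..1::real} x + (ennreal (x powr (-s)) * indicator {1..} x
           + ennreal ((- x) powr (-s)) * indicator {1..} (- x)))"
  proof (rule nn_integral_mono)
    fix x :: real
    consider "\<bar>x\<bar> < 1" | "x \<ge> 1" | "-x \<ge> 1" by linarith
    then show "ennreal (\<langle>x\<rangle> powr (- s)) \<le> indicator {-1..1} x + (ennreal (x powr (-s)) * indicator {1..} x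
           + ennreal ((- x) powr (-s)) * indicator {1..} (- x))"
    proof cases
      case 1
      have "\<langle>x\<rangle> powr (- s) \<le> 1" using assms japanese_ge_1[of x] powr_japanese_antimono[of 0 s x] by simp
      then show ?thesis using 1 by (auto simp: abs_le_iff indicator_def intro!: add_increasing2)
    next
      case 2
      have "\<langle>x\<rangle> powr (- s) \<le> x powr (-s)" using 2 assms japanese_ge_abs[of x] by (intro powr_mono2') auto
      then have "ennreal (\<langle>x\<rangle> powr (- s)) \<le> ennreal (x powr (-s)) * indicator {1..} x" using 2 by (auto intro: ennreal_leI)
      then show ?thesis by (rule add_increasing[OF _ add_increasing2, rotated 2]) auto
    next
      case 3
      have "\<langle>x\<rangle> powr (- s) \<le> (-x) powr (-s)" using 3 assms japanese_ge_abs[of x] by (intro powr_mono2') auto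
      then have "ennreal (\<langle>x\<rangle> powr (- s)) \<le> ennreal ((-x) powr (-s)) * indicator {1..} (-x)" using 3 by (auto intro: ennreal_leI)
      then show ?thesis by (rule add_increasing[OF _ add_increasing, rotated 2]) auto
    qed
  qed
  also have "\<dots> < \<infinity>"
    using tail tail' by (subst nn_integral_add; simp)+
  finally show ?thesis .
qed

text \<open>If the polynomial has roots -R and R (after centring), then |y^2 - R^2| = |y - R| |y +
  R| is at least the smaller of |y - R|^2 and |y + R|^2. The integrand is therefore at most the sum
  of two translates of the one with T = 0, whose decay of order 2 s > 1 is integrable. This is why
  the bound is uniform in T.\<close>

lemma japanese_quadratic_integral_bound_1:
  fixes p s :: real
  assumes "0 < p" "1 / 2 < s"
  obtains C where "C < \<infinity>"
    "\<And>T a. (NINT x. ennreal (\<langle>T + p * (x - a)\<^sup>2\<rangle> powr (- s))) \<le> C"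
proof -
  define h where "h x = ennreal (\<langle>p * x\<^sup>2\<rangle> powr (- s))" for x :: real
  have [measurable]: "borel_fun h" unfolding h_def[abs_def] by measurable
  have mono: "ennreal (\<langle>u\<rangle> powr (- s)) \<le> ennreal (\<langle>v\<rangle> powr (- s))" if "\<bar>v\<bar> \<le> \<bar>u\<bar>" for u v :: real
    using that assms by (intro ennreal_leI powr_mono2') (auto intro: japanese_mono)
  have h_fin: "(NINT x. h x) < \<infinity>"
  proof -
    \<comment> \<open>With u = x^2, \<open>c * (1 + u) \<le> \<langle>p * u\<rangle>\<close> follows
      from (1 + u)^2 <= 2 (1 + u^2) together with 4 c^2 <= 1 and 4 c^2 <= p^2.\<close>
    define c where "c = min 1 p / 2"
    have c: "0 < c" using assms by (auto simp: c_def)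
    have "h x \<le> ennreal (c powr (- s)) * ennreal (\<langle>x\<rangle> powr (- (2 * s)))" for x
    proof -
      have "c * (1 + x\<^sup>2) \<le> \<langle>p * x\<^sup>2\<rangle>"
      proof -
        have "c\<^sup>2 * (1 + x\<^sup>2)\<^sup>2 \<le> c\<^sup>2 * (2 * (1 + (x\<^sup>2)\<^sup>2))"
          using sum_squares_bound[of 1 "x\<^sup>2"] by (intro mult_left_mono) (auto simp: power2_sum)
        also have "\<dots> \<le> 1 + (p * x\<^sup>2)\<^sup>2"
        proof -
          have "2 * c\<^sup>2 \<le> 1" "2 * c\<^sup>2 \<le> p\<^sup>2"
          proof -
            have "c \<le> 1/2" "c \<le> p / 2" by (auto simp: c_def)
            then have "c\<^sup>2 \<le> (1/2)\<^sup>2" "c\<^sup>2 \<le> (p/2)\<^sup>2" using c by (auto intro!: power_mono simp del: power_divide)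
            then have "4 * c\<^sup>2 \<le> 1" "4 * c\<^sup>2 \<le> p\<^sup>2" by (auto simp: power_divide)
            moreover have "2 * c\<^sup>2 \<le> 4 * c\<^sup>2" by (intro mult_right_mono) auto
            ultimately show "2 * c\<^sup>2 \<le> 1" "2 * c\<^sup>2 \<le> p\<^sup>2" by (blast intro: order_trans)+
          qed
          then have "2 * c\<^sup>2 * 1 + (2 * c\<^sup>2) * (x\<^sup>2)\<^sup>2 \<le> 1 + p\<^sup>2 * (x\<^sup>2)\<^sup>2"
            by (intro add_mono mult_right_mono) auto
          then show ?thesis by (simp add: power_mult_distrib algebra_simps)
        qed
        finally have "(c * (1 + x\<^sup>2))\<^sup>2 \<le> 1 + (p * x\<^sup>2)\<^sup>2" by (simp add: power_mult_distrib)
        then show ?thesis unfolding japanese_def by (intro real_le_rsqrt) simp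
      qed
      moreover have "1 + x\<^sup>2 = \<langle>x\<rangle> powr 2" by (simp add: japanese_def)
      ultimately have "\<langle>p * x\<^sup>2\<rangle> powr (- s) \<le> (c * \<langle>x\<rangle> powr 2) powr (- s)"
        using assms c by (intro powr_mono2') auto
      also have "\<dots> = c powr (- s) * (\<langle>x\<rangle> powr 2) powr (- s)"
        by (rule powr_mult)
      also have "(\<langle>x\<rangle> powr 2) powr (- s) = \<langle>x\<rangle> powr (- (2 * s))"
        by (subst powr_powr) simp
      finally show ?thesis unfolding h_def by (simp add: ennreal_mult[symmetric] ennreal_leI)
    qed
    then have "(NINT x. h x) \<le> (NINT x. ennreal (c powr (- s)) * ennreal (\<langle>x::real\<rangle> powr (- (2 * s))))"
      by (intro nn_integral_mono)
    also have "\<dots> < \<infinity>"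
      using japanese_powr_integrable[of "2 * s"] assms by (subst nn_integral_cmult) (auto simp: ennreal_mult_less_top)
    finally show ?thesis .
  qed
  show ?thesis
  proof
    show "2 * (NINT x. h x) < \<infinity>" using h_fin by (simp add: ennreal_mult_less_top)
    fix T a :: real
    \<comment> \<open>For T < 0 the positive zero of T + p y^2. For T >= 0 the choice R = 0 serves
      because |T + p y^2| >= p y^2.\<close>
    define R where "R = (if T \<ge> 0 then 0 else sqrt (- T / p))"
    have R: "R \<ge> 0" "T \<ge> - p * R\<^sup>2" "T < 0 \<Longrightarrow> T = - p * R\<^sup>2" using assms by (auto simp: R_def field_simps)
    have "ennreal (\<langle>T + p * (x - a)\<^sup>2\<rangle> powr (- s)) \<le> h ((- a - R) + x) + h ((- a + R) + x)" for x
    proof -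
      define y where "y = x - a"
      have "\<bar>p * (y - R)\<^sup>2\<bar> \<le> \<bar>T + p * y\<^sup>2\<bar> \<or> \<bar>p * (y + R)\<^sup>2\<bar> \<le> \<bar>T + p * y\<^sup>2\<bar>"
      proof (cases "T \<ge> 0")
        case True
        then have "R = 0" by (simp add: R_def)
        then show ?thesis using True assms by auto
      next
        case False
        then have "T + p * y\<^sup>2 = p * ((y - R) * (y + R))" using R by (simp add: algebra_simps power2_eq_square)
        then have eq: "\<bar>T + p * y\<^sup>2\<bar> = p * (\<bar>y - R\<bar> * \<bar>y + R\<bar>)" using assms by (simp add: abs_mult)
        show ?thesis
        proof (cases "y \<ge> 0")
          case True
          then have "\<bar>y - R\<bar> * \<bar>y - R\<bar> \<le> \<bar>y - R\<bar> * \<bar>y + R\<bar>" using R by (intro mult_left_mono) auto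
          then show ?thesis unfolding eq using assms by (auto simp: power2_eq_square abs_mult)
        next
          case False
          then have "\<bar>y + R\<bar> * \<bar>y + R\<bar> \<le> \<bar>y - R\<bar> * \<bar>y + R\<bar>" using R by (intro mult_right_mono) auto
          then show ?thesis unfolding eq using assms by (auto simp: power2_eq_square abs_mult)
        qed
      qed
      then show ?thesis
      proof
        assume "\<bar>p * (y - R)\<^sup>2\<bar> \<le> \<bar>T + p * y\<^sup>2\<bar>"
        from mono[OF this] show ?thesis by (auto simp: h_def y_def algebra_simps intro: add_increasing2)
      next
        assume "\<bar>p * (y + R)\<^sup>2\<bar> \<le> \<bar>T + p * y\<^sup>2\<bar>"
        from mono[OF this] show ?thesis by (auto simp: h_def y_def algebra_simps intro: add_increasing)
      qed
    qed
    then have "(NINT x. ennreal (\<langle>T + p * (x - a)\<^sup>2\<rangle> powr (- s)))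
       \<le> (NINT x. h ((- a - R) + x) + h ((- a + R) + x))" by (intro nn_integral_mono)
    also have "\<dots> = 2 * (NINT x. h x)"
      by (subst nn_integral_add) (auto simp: NINT_shift mult_2)
    finally show "(NINT x. ennreal (\<langle>T + p * (x - a)\<^sup>2\<rangle> powr (- s))) \<le> 2 * (NINT x. h x)" .
  qed
qed

text \<open>In the plane, the area of an annulus is proportional to the difference of the squared
  radii, hence unaffected by where the unit interval of values of |z|^2 lies. From dimension three
  on this fails, which limits the gain from a paraboloid to two directions.\<close>

lemma emeasure_annulus_le:
  fixes c :: real
  shows "emeasure lborel {z :: real \<times> real. \<bar>c - (norm z)\<^sup>2\<bar> \<le> 1 / 2} \<le> ennreal pi"
proof (cases "c + 1 / 2 \<ge> 0")
  case False
  have "\<not> \<bar>c - (norm z)\<^sup>2\<bar> \<le> 1 / 2" for z :: "real \<times> real"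
    using False zero_le_power2[of "norm z"] by linarith
  then show ?thesis by simp
next
  case True
  define r where "r = sqrt (max 0 (c - 1 / 2))"
  define R where "R = sqrt (c + 1 / 2)"
  have rR: "0 \<le> r" "r \<le> R" "R\<^sup>2 - r\<^sup>2 \<le> 1" using True by (auto simp: r_def R_def)
  have "{z :: real \<times> real. \<bar>c - (norm z)\<^sup>2\<bar> \<le> 1 / 2} \<subseteq> cball 0 R - ball 0 r"
  proof safe
    fix a b :: real assume z: "\<bar>c - (norm (a, b))\<^sup>2\<bar> \<le> 1 / 2"
    have "norm (a, b) \<le> R" unfolding R_def using z unfolding abs_le_iff by (intro real_le_rsqrt) linarith
    then show "(a, b) \<in> cball 0 R" by simp
    have "r \<le> norm (a, b)" unfolding r_def using z zero_le_power2[of "norm (a, b)"] unfolding abs_le_iff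
      by (intro real_le_lsqrt) (auto simp del: zero_le_power2 intro: max.boundedI)
    then show "(a, b) \<in> ball 0 r \<Longrightarrow> False" by simp
  qed
  then have "emeasure lborel {z :: real \<times> real. \<bar>c - (norm z)\<^sup>2\<bar> \<le> 1 / 2} \<le> emeasure lborel (cball 0 R - ball (0 :: real \<times> real) r)"
    by (intro emeasure_mono) auto
  also have "\<dots> = emeasure lborel (cball (0 :: real \<times> real) R) - emeasure lborel (ball (0 :: real \<times> real) r)"
    using rR by (intro emeasure_Diff) (use emeasure_lborel_ball_finite[of "0 :: real \<times> real" r] in \<open>auto simp: ball_subset_cball_iff\<close>)
  also have "\<dots> = ennreal (pi * R\<^sup>2) - ennreal (pi * r\<^sup>2)"
    using rR by (simp add: emeasure_cball emeasure_ball unit_ball_vol_2 power2_eq_square)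
  also have "\<dots> = ennreal (pi * (R\<^sup>2 - r\<^sup>2))"
    by (subst ennreal_minus) (auto simp: algebra_simps)
  also have "\<dots> \<le> ennreal pi" using rR by (intro ennreal_leI) (simp add: mult_left_le)
  finally show ?thesis .
qed

text \<open>Smearing: \<open>\<langle>v\<rangle> powr (- s)\<close> is at most
  \<open>2 powr s\<close> times the average of the same power over the unit interval around v. After
  Fubini, the plane integral for a fixed value u is the area of an annulus, and only the
  one-dimensional integral over u remains.\<close>

lemma japanese_norm_sq_integral_bound_2:
  fixes s T :: real
  assumes "0 \<le> s"
  shows "(NINT y. NINT x. ennreal (\<langle>T + x\<^sup>2 + y\<^sup>2\<rangle> powr (- s)))
    \<le> ennreal (2 powr s * pi) * (NINT u. ennreal (\<langle>u::real\<rangle> powr (- s)))"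
proof -
  let ?f = "\<lambda>u::real. ennreal (\<langle>u\<rangle> powr (- s))"
  let ?I = "\<lambda>v u::real. indicator {v - 1 / 2..v + 1 / 2} u :: ennreal"
  have pt: "?f v \<le> ennreal (2 powr s) * (NINT u. ?f u * ?I v u)" for v
  proof -
    have "?f v = (NINT u. ?f v * ?I v u)"
      by (subst nn_integral_cmult) auto
    also have "\<dots> \<le> (NINT u. ennreal (2 powr s) * (?f u * ?I v u))"
    proof (rule nn_integral_mono)
      fix u :: real
      have A: "\<langle>v\<rangle> powr (- s) \<le> 2 powr s * \<langle>u\<rangle> powr (- s)" if "\<bar>u - v\<bar> \<le> 1 / 2"
      proof -
        have "\<langle>v\<rangle> powr (- s) = 2 powr s * (2 * \<langle>v\<rangle>) powr (- s)"
          by (simp add: powr_mult powr_minus)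
        also have "\<dots> \<le> 2 powr s * \<langle>u\<rangle> powr (- s)"
          using japanese_near[OF that] assms by (intro mult_left_mono powr_mono2') auto
        finally show ?thesis .
      qed
      then show "?f v * ?I v u \<le> ennreal (2 powr s) * (?f u * ?I v u)"
      proof (cases "u \<in> {v - 1 / 2..v + 1 / 2}")
        case True
        then have "\<bar>u - v\<bar> \<le> 1 / 2" unfolding atLeastAtMost_iff by linarith
        from A[OF this] True show ?thesis by (simp add: ennreal_mult[symmetric] ennreal_leI)
      qed simp
    qed
    also have "\<dots> = ennreal (2 powr s) * (NINT u. ?f u * ?I v u)"
      by (subst nn_integral_cmult) auto
    finally show ?thesis .
  qed
  have mem: "u \<in> {v - 1 / 2..v + 1 / 2} \<longleftrightarrow> \<bar>u - v\<bar> \<le> 1 / 2" for u v :: real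
    unfolding atLeastAtMost_iff by linarith
  have I_eq: "?I v u = indicator {(v, u). \<bar>u - v\<bar> \<le> 1/2} (v, u)" for v u
    unfolding indicator_def mem by simp
  have [measurable]: "{(v, u :: real). \<bar>u - v\<bar> \<le> 1/2} \<in> sets borel"
    unfolding case_prod_unfold by (intro closed_Collect_le borel_closed continuous_intros)
  have "(NINT y. NINT x. ?f (T + x\<^sup>2 + y\<^sup>2)) = (NINT z. ?f (T + (snd z)\<^sup>2 + (fst z)\<^sup>2))"
    by (subst NINT_pair) auto
  also have "\<dots> \<le> (NINT z. ennreal (2 powr s) * (NINT u. ?f u * ?I (T + (snd z)\<^sup>2 + (fst z)\<^sup>2) u))"
    by (intro nn_integral_mono pt)
  also have "\<dots> = ennreal (2 powr s) * (NINT z. (NINT u. ?f u * ?I (T + (snd z)\<^sup>2 + (fst z)\<^sup>2) u))"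
    unfolding I_eq by (subst nn_integral_cmult) auto
  also have "(NINT z. (NINT u. ?f u * ?I (T + (snd z)\<^sup>2 + (fst z)\<^sup>2) u))
     = (NINT u. (\<integral>\<^sup>+z. ?f u * ?I (T + (snd z)\<^sup>2 + (fst z)\<^sup>2) u \<partial>(lborel :: (real \<times> real) measure)))"
    unfolding I_eq by (rule NINT_swap) measurable
  also have "\<dots> \<le> (NINT u. ?f u * ennreal pi)"
  proof (rule nn_integral_mono)
    fix u :: real
    have "?I (T + (snd z)\<^sup>2 + (fst z)\<^sup>2) u = indicator {z. \<bar>(u - T) - (norm z)\<^sup>2\<bar> \<le> 1 / 2} z" for z :: "real \<times> real"
      unfolding indicator_def mem by (simp add: norm_prod_def algebra_simps)
    then have "(NINT z. ?f u * ?I (T + (snd z)\<^sup>2 + (fst z)\<^sup>2) u)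
        = ?f u * emeasure lborel {z :: real \<times> real. \<bar>(u - T) - (norm z)\<^sup>2\<bar> \<le> 1 / 2}"
      by (simp add: nn_integral_cmult)
    also have "\<dots> \<le> ?f u * ennreal pi" by (intro mult_left_mono emeasure_annulus_le) auto
    finally show "(\<integral>\<^sup>+z. ?f u * ?I (T + (snd z)\<^sup>2 + (fst z)\<^sup>2) u \<partial>(lborel :: (real \<times> real) measure)) \<le> ?f u * ennreal pi" .
  qed
  also have "\<dots> = ennreal pi * (NINT u. ?f u)" by (subst nn_integral_multc) (auto simp: mult.commute)
  finally show ?thesis by (simp add: ennreal_mult mult.assoc mult_left_mono)
qed

lemma nn_integral_quadratic_rescale:
  fixes f :: "real \<Rightarrow> ennreal"
  assumes [measurable]: "borel_fun f" and "0 < p"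
  shows "(NINT x. f (p * (x - a)\<^sup>2)) = ennreal (1 / sqrt p) * (NINT x. f (x\<^sup>2))"
proof -
  have "p * (1 / sqrt p * x)\<^sup>2 = x\<^sup>2" for x using assms by (simp add: power_mult_distrib power_divide)
  then show ?thesis using assms
    by (subst nn_integral_real_affine[where t=a and c="1 / sqrt p"]) auto
qed

text \<open>The centre \<open>a\<close> may depend on y, because the inner integral is invariant
  under translation. This admits quadratic forms in two variables that are diagonalized by
  completing squares successively.\<close>

lemma japanese_quadratic_integral_bound_2:
  fixes p q s :: real
  assumes "0 < p" "0 < q" "1 < s"
  obtains C where "C < \<infinity>"
    "\<And>T a b. (NINT y. NINT x. ennreal (\<langle>T + p * (x - a y)\<^sup>2 + q * (y - b)\<^sup>2\<rangle> powr (- s))) \<le> C"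
proof
  let ?C = "ennreal (1 / sqrt p) * (ennreal (1 / sqrt q) * (ennreal (2 powr s * pi) * (NINT u. ennreal (\<langle>u::real\<rangle> powr (- s)))))"
  show "?C < \<infinity>"
    using japanese_powr_integrable[OF assms(3)] by (simp add: ennreal_mult_less_top)
  fix T b :: real and a :: "real \<Rightarrow> real"
  have "(NINT x. ennreal (\<langle>T + p * (x - a y)\<^sup>2 + q * (y - b)\<^sup>2\<rangle> powr (- s)))
      = ennreal (1 / sqrt p) * (NINT x. ennreal (\<langle>T + x\<^sup>2 + q * (y - b)\<^sup>2\<rangle> powr (- s)))" for y
    using nn_integral_quadratic_rescale[of "\<lambda>u. ennreal (\<langle>T + u + q * (y - b)\<^sup>2\<rangle> powr (- s))" p "a y"] assms by simp
  then have "(NINT y. NINT x. ennreal (\<langle>T + p * (x - a y)\<^sup>2 + q * (y - b)\<^sup>2\<rangle> powr (- s)))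
    = ennreal (1 / sqrt p) * (NINT y. NINT x. ennreal (\<langle>T + x\<^sup>2 + q * (y - b)\<^sup>2\<rangle> powr (- s)))"
    by (simp add: nn_integral_cmult)
  also have "(NINT y. NINT x. ennreal (\<langle>T + x\<^sup>2 + q * (y - b)\<^sup>2\<rangle> powr (- s)))
    = ennreal (1 / sqrt q) * (NINT y. NINT x. ennreal (\<langle>T + x\<^sup>2 + y\<^sup>2\<rangle> powr (- s)))"
    using nn_integral_quadratic_rescale[of "\<lambda>u. \<integral>\<^sup>+x. ennreal (\<langle>T + x\<^sup>2 + u\<rangle> powr (- s)) \<partial>lborel" q b] assms by simp
  also have "ennreal (1 / sqrt p) * \<dots> \<le> ?C"
    using assms by (intro mult_left_mono japanese_norm_sq_integral_bound_2) auto
  finally show "(NINT y. NINT x. ennreal (\<langle>T + p * (x - a y)\<^sup>2 + q * (y - b)\<^sup>2\<rangle> powr (- s))) \<le> ?C" .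
qed

section \<open>Integrals over the whole space by slicing\<close>

lemma powr_mult_powr_le_add:
  fixes a b :: real
  assumes "0 < a" "0 < b" "0 \<le> l" "l \<le> 1"
  shows "a powr (1 - l) * b powr l \<le> a + b"
proof -
  have "a powr (1 - l) * b powr l \<le> max a b powr (1 - l) * max a b powr l"
    using assms by (intro mult_mono powr_mono2) auto
  also have "\<dots> = max a b" using assms by (simp add: powr_add[symmetric])
  also have "\<dots> \<le> a + b" using assms by simp
  finally show ?thesis .
qed

text \<open>Fubini along the coordinates: those in \<open>J\<close> are integrated first, uniformly
  in the base point, and each remaining one contributes a factor \<open>NINT t. h t\<close>. Bounds
  on lines and planes thereby become bounds on the whole space.\<close>

lemma NINT_slice:
  fixes F :: "'a::euclidean_space \<Rightarrow> ennreal" and h :: "real \<Rightarrow> ennreal"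
  assumes [measurable]: "borel_fun F" "borel_fun h"
    and J: "J \<subseteq> Basis"
    and bound: "\<And>x. (\<integral>\<^sup>+\<sigma>. F (x + (\<Sum>b\<in>J. \<sigma> b *\<^sub>R b)) \<partial>(\<Pi>\<^sub>M b\<in>J. lborel)) \<le> C"
  shows "(NINT x. F x * (\<Prod>b\<in>Basis - J. h (x \<bullet> b))) \<le> C * (NINT t. h t) ^ card (Basis - J)"
proof -
  interpret product_sigma_finite "\<lambda>_::'a. lborel :: real measure" ..
  have fin: "finite J" "finite (Basis - J)" using J by (auto intro: finite_subset)
  define G where "G x = F x * (\<Prod>b\<in>Basis - J. h (x \<bullet> b))" for x
  have [measurable]: "borel_fun G" unfolding G_def[abs_def] by measurable
  have B: "Basis - J \<union> J = Basis" using J by auto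
  have "(NINT x. G x) = (\<integral>\<^sup>+x. G x \<partial>distr (\<Pi>\<^sub>M b\<in>Basis. lborel) borel (\<lambda>f. \<Sum>b\<in>Basis. f b *\<^sub>R b))"
    by (subst lborel_eq) (rule refl)
  also have "\<dots> = (\<integral>\<^sup>+f. G (\<Sum>b\<in>Basis. f b *\<^sub>R b) \<partial>(\<Pi>\<^sub>M b\<in>(Basis - J) \<union> J. lborel))"
    unfolding B by (subst nn_integral_distr) auto
  also have "\<dots> = (\<integral>\<^sup>+f. (\<integral>\<^sup>+\<sigma>. G (\<Sum>b\<in>Basis. merge (Basis - J) J (f, \<sigma>) b *\<^sub>R b) \<partial>(\<Pi>\<^sub>M b\<in>J. lborel)) \<partial>(\<Pi>\<^sub>M b\<in>Basis - J. lborel))"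
    using fin by (intro product_nn_integral_fold) (auto simp: B)
  also have "\<dots> \<le> (\<integral>\<^sup>+f. C * (\<Prod>b\<in>Basis - J. h (f b)) \<partial>(\<Pi>\<^sub>M b\<in>Basis - J. lborel))"
  proof (rule nn_integral_mono)
    fix f :: "'a \<Rightarrow> real"
    define X where "X = (\<Sum>b\<in>Basis - J. f b *\<^sub>R b)"
    have m: "(\<Sum>b\<in>Basis. merge (Basis - J) J (f, \<sigma>) b *\<^sub>R b) = X + (\<Sum>b\<in>J. \<sigma> b *\<^sub>R b)" for \<sigma>
    proof -
      have "(\<Sum>b\<in>Basis. merge (Basis - J) J (f, \<sigma>) b *\<^sub>R b)
         = (\<Sum>b\<in>(Basis - J) \<union> J. merge (Basis - J) J (f, \<sigma>) b *\<^sub>R b)" by (simp only: B)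
      also have "\<dots> = (\<Sum>b\<in>Basis - J. merge (Basis - J) J (f, \<sigma>) b *\<^sub>R b) + (\<Sum>b\<in>J. merge (Basis - J) J (f, \<sigma>) b *\<^sub>R b)"
        using fin by (intro sum.union_disjoint) auto
      also have "(\<Sum>b\<in>Basis - J. merge (Basis - J) J (f, \<sigma>) b *\<^sub>R b) = X"
        unfolding X_def by (intro sum.cong) (auto simp: merge_def)
      also have "(\<Sum>b\<in>J. merge (Basis - J) J (f, \<sigma>) b *\<^sub>R b) = (\<Sum>b\<in>J. \<sigma> b *\<^sub>R b)"
        by (intro sum.cong) (auto simp: merge_def)
      finally show ?thesis .
    qed
    have h: "h ((\<Sum>b'\<in>Basis. merge (Basis - J) J (f, \<sigma>) b' *\<^sub>R b') \<bullet> b) = h (f b)" if "b \<in> Basis - J" for b \<sigma>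
      using that by (simp add: inner_sum_left_Basis merge_def)
    have "(\<integral>\<^sup>+\<sigma>. G (\<Sum>b\<in>Basis. merge (Basis - J) J (f, \<sigma>) b *\<^sub>R b) \<partial>(\<Pi>\<^sub>M b\<in>J. lborel))
       = (\<integral>\<^sup>+\<sigma>. F (X + (\<Sum>b\<in>J. \<sigma> b *\<^sub>R b)) * (\<Prod>b\<in>Basis - J. h (f b)) \<partial>(\<Pi>\<^sub>M b\<in>J. lborel))"
      unfolding G_def by (simp add: h m[symmetric])
    also have "\<dots> = (\<integral>\<^sup>+\<sigma>. F (X + (\<Sum>b\<in>J. \<sigma> b *\<^sub>R b)) \<partial>(\<Pi>\<^sub>M b\<in>J. lborel)) * (\<Prod>b\<in>Basis - J. h (f b))"
      by (rule nn_integral_multc) measurable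
    also have "\<dots> \<le> C * (\<Prod>b\<in>Basis - J. h (f b))" by (intro mult_right_mono bound) auto
    finally show "(\<integral>\<^sup>+\<sigma>. G (\<Sum>b\<in>Basis. merge (Basis - J) J (f, \<sigma>) b *\<^sub>R b) \<partial>(\<Pi>\<^sub>M b\<in>J. lborel))
       \<le> C * (\<Prod>b\<in>Basis - J. h (f b))" .
  qed
  also have "\<dots> = C * (\<integral>\<^sup>+f. (\<Prod>b\<in>Basis - J. h (f b)) \<partial>(\<Pi>\<^sub>M b\<in>Basis - J. lborel))"
    by (rule nn_integral_cmult) measurable
  also have "\<dots> = C * (NINT t. h t) ^ card (Basis - J)"
    using fin by (subst product_nn_integral_prod) auto
  finally show ?thesis by (simp add: G_def)
qed

lemma NINT_slice_1:
  fixes F :: "'a::euclidean_space \<Rightarrow> ennreal" and h :: "real \<Rightarrow> ennreal"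
  assumes [measurable]: "borel_fun F" "borel_fun h"
    and i: "i \<in> Basis"
    and bound: "\<And>x. (NINT t. F (x + t *\<^sub>R i)) \<le> C"
  shows "(NINT x. F x * (\<Prod>b\<in>Basis - {i}. h (x \<bullet> b))) \<le> C * (NINT t. h t) ^ (DIM('a) - 1)"
proof -
  interpret product_sigma_finite "\<lambda>_::'a. lborel :: real measure" ..
  have "(\<integral>\<^sup>+\<sigma>. F (x + (\<Sum>b\<in>{i}. \<sigma> b *\<^sub>R b)) \<partial>(\<Pi>\<^sub>M b\<in>{i}. lborel)) \<le> C" for x
    using bound[of x] product_nn_integral_singleton[of "\<lambda>t. F (x + t *\<^sub>R i)" i] by simp
  from NINT_slice[OF assms(1,2) _ this] i show ?thesis
    by (simp add: card_Diff_singleton)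
qed

lemma NINT_slice_2:
  fixes F :: "'a::euclidean_space \<Rightarrow> ennreal" and h :: "real \<Rightarrow> ennreal"
  assumes [measurable]: "borel_fun F" "borel_fun h"
    and ij: "i \<in> Basis" "j \<in> Basis" "i \<noteq> j"
    and bound: "\<And>x. (NINT t. NINT u. F (x + t *\<^sub>R i + u *\<^sub>R j)) \<le> C"
  shows "(NINT x. F x * (\<Prod>b\<in>Basis - {i, j}. h (x \<bullet> b))) \<le> C * (NINT t. h t) ^ (DIM('a) - 2)"
proof -
  interpret product_sigma_finite "\<lambda>_::'a. lborel :: real measure" ..
  have "(\<integral>\<^sup>+\<sigma>. F (x + (\<Sum>b\<in>{i, j}. \<sigma> b *\<^sub>R b)) \<partial>(\<Pi>\<^sub>M b\<in>{i, j}. lborel)) \<le> C" for x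
  proof -
    have "(\<integral>\<^sup>+\<sigma>. F (x + (\<Sum>b\<in>{i, j}. \<sigma> b *\<^sub>R b)) \<partial>(\<Pi>\<^sub>M b\<in>{i, j}. lborel))
      = (\<integral>\<^sup>+\<sigma>. F (x + \<sigma> i *\<^sub>R i + \<sigma> j *\<^sub>R j) \<partial>(\<Pi>\<^sub>M b\<in>{i, j}. lborel))"
      using ij by (simp add: add.assoc)
    also have "\<dots> = (\<integral>\<^sup>+z. F (x + fst z *\<^sub>R i + snd z *\<^sub>R j) \<partial>(lborel \<Otimes>\<^sub>M lborel))"
      using ij by (intro product_nn_integral_pair[where f="\<lambda>t u. F (x + t *\<^sub>R i + u *\<^sub>R j)"]) auto
    also have "\<dots> = (NINT t. NINT u. F (x + t *\<^sub>R i + u *\<^sub>R j))"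
      unfolding lborel_prod by (subst NINT_pair) auto
    finally show ?thesis using bound by simp
  qed
  from NINT_slice[OF assms(1,2) _ this] ij show ?thesis
    by (simp add: card_Diff_subset numeral_2_eq_2)
qed

text \<open>Since \<open>\<langle>x \<bullet> b\<rangle> \<le> \<langle>x\<rangle>\<close>,
  isotropic decay can be dealt out to the coordinates in \<open>B\<close>, in the shape that
  \<open>NINT_slice\<close> expects.\<close>

lemma japanese_powr_le_prod:
  fixes x :: "'a::euclidean_space"
  assumes "B \<subseteq> Basis" "0 \<le> s"
  shows "ennreal (\<langle>x\<rangle> powr (- (real (card B) * s))) \<le> (\<Prod>b\<in>B. ennreal (\<langle>x \<bullet> b\<rangle> powr (- s)))"
proof -
  have "\<langle>x\<rangle> powr (- (real (card B) * s)) = (\<Prod>b\<in>B. \<langle>x\<rangle> powr (- s))"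
    by (simp add: powr_power mult.commute)
  also have "\<dots> \<le> (\<Prod>b\<in>B. \<langle>x \<bullet> b\<rangle> powr (- s))"
    using assms by (intro prod_mono conjI powr_mono2') (auto intro: japanese_inner_le)
  finally show ?thesis by (subst prod_ennreal) (auto intro: ennreal_leI)
qed

lemma japanese_powr_integrable_DIM:
  assumes "1 < s"
  shows "(NINT x. ennreal (\<langle>x::'a::euclidean_space\<rangle> powr (- (real DIM('a) * s)))) < \<infinity>"
proof -
  let ?h = "\<lambda>t::real. ennreal (\<langle>t\<rangle> powr (- s))"
  have "(NINT x. ennreal (\<langle>x::'a\<rangle> powr (- (real DIM('a) * s))))
     \<le> (NINT x. 1 * (\<Prod>b\<in>Basis - {}. ?h ((x::'a) \<bullet> b)))"
    using assms by (intro nn_integral_mono) (simp add: japanese_powr_le_prod)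
  also have "\<dots> \<le> 1 * (NINT t. ?h t) ^ card (Basis - {} :: 'a set)"
    by (intro NINT_slice) (auto simp: space_PiM)
  also have "\<dots> < \<infinity>" using japanese_powr_integrable[OF assms] by (simp add: power_less_top_ennreal)
  finally show ?thesis .
qed

lemma norm_add_basis_sq:
  fixes w :: "'a::euclidean_space"
  assumes "i \<in> Basis"
  shows "(norm (w + t *\<^sub>R i))\<^sup>2 = (norm w)\<^sup>2 - (w \<bullet> i)\<^sup>2 + (t + w \<bullet> i)\<^sup>2"
  unfolding power2_norm_eq_inner
  using assms by (simp add: inner_add_left inner_add_right inner_commute power2_eq_square algebra_simps)

text \<open>The extreme cases are E = 0 and E = m = min 2 d: \<open>A\<close> leaves all directions
  to the frequency weight, \<open>B\<close> takes m of them from the paraboloid (exponent \<beta> on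
  a line, 2 \<beta> on a plane). Both integrals are bounded, and the weight for an intermediate E is
  their geometric mean with exponent l = E / m, hence below A + B.\<close>

lemma paraboloid_weight_bound:
  fixes E \<beta> \<epsilon> :: real
  assumes E: "0 \<le> E" "E \<le> 2" "E \<le> DIM('a::euclidean_space)" and "0 < \<epsilon>" "1 / 2 < \<beta>"
  obtains C where "C < \<infinity>"
    "\<And>T a. (NINT x. ennreal (\<langle>T + 2 * (norm (x - a :: 'a))\<^sup>2\<rangle> powr (- (E * \<beta>))
        * \<langle>x\<rangle> powr (- ((DIM('a) - E) * (1 + \<epsilon>))))) \<le> C"
proof -
  let ?h = "\<lambda>t::real. ennreal (\<langle>t\<rangle> powr (- (1 + \<epsilon>)))"
  let ?d = "real DIM('a)"
  define m where "m = min 2 DIM('a)"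
  have m: "0 < real m" "E \<le> real m" "real m \<le> ?d" using E by (auto simp: m_def)
  define A where "A x = \<langle>x\<rangle> powr (- (?d * (1 + \<epsilon>)))" for x :: 'a
  define B where "B T a x = \<langle>T + 2 * (norm (x - a))\<^sup>2\<rangle> powr (- (real m * \<beta>)) * \<langle>x\<rangle> powr (- ((?d - real m) * (1 + \<epsilon>)))" for T and a x :: 'a
  have [measurable]: "borel_fun A" unfolding A_def[abs_def] by measurable
  have [measurable]: "borel_fun (B T a)" for T a unfolding B_def[abs_def] by measurable
  have pt: "\<langle>T + 2 * (norm (x - a))\<^sup>2\<rangle> powr (- (E * \<beta>)) * \<langle>x\<rangle> powr (- ((?d - E) * (1 + \<epsilon>))) \<le> A x + B T a x" for T and x a :: 'a
  proof -
    define l where "l = E / real m"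
    have l: "0 \<le> l" "l \<le> 1" "l * real m = E" using E m by (auto simp: l_def)
    have e: "?d * (1 + \<epsilon>) * (1 - l) + (?d - real m) * (1 + \<epsilon>) * l = (?d - E) * (1 + \<epsilon>)"
      unfolding l(3)[symmetric] by (simp add: algebra_simps)
    have "A x powr (1 - l) * B T a x powr l = \<langle>T + 2 * (norm (x - a))\<^sup>2\<rangle> powr (- (E * \<beta>)) * \<langle>x\<rangle> powr (- ((?d - E) * (1 + \<epsilon>)))"
      unfolding e[symmetric] l(3)[symmetric]
      by (simp add: A_def B_def powr_mult powr_powr powr_add[symmetric] algebra_simps)
    moreover have "A x powr (1 - l) * B T a x powr l \<le> A x + B T a x"
      by (intro powr_mult_powr_le_add l) (auto simp: A_def B_def)
    ultimately show ?thesis by simp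
  qed
  have A_fin: "(NINT x. ennreal (A x)) < \<infinity>"
    unfolding A_def using assms by (intro japanese_powr_integrable_DIM) auto
  obtain CB where CB: "CB < \<infinity>" "\<And>T a. (NINT x. ennreal (B T a x)) \<le> CB"
  proof (cases "DIM('a) \<ge> 2")
    case True
    then have m2: "m = 2" by (simp add: m_def)
    obtain i j :: 'a where ij: "i \<in> Basis" "j \<in> Basis" "i \<noteq> j"
      using True by (metis card_le_Suc0_iff_eq finite_Basis not_less_eq_eq numeral_2_eq_2)
    obtain C where C: "C < \<infinity>"
      "\<And>(T :: real) a b. (NINT y. NINT x. ennreal (\<langle>T + 2 * (x - a y)\<^sup>2 + 2 * (y - b)\<^sup>2\<rangle> powr (- (2 * \<beta>)))) \<le> C"
      by (rule japanese_quadratic_integral_bound_2[of 2 2 "2 * \<beta>"]) (use assms in auto)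
    show ?thesis
    proof
      show "C * (NINT t. ?h t) ^ (DIM('a) - 2) < \<infinity>"
        using C(1) japanese_powr_integrable[of "1 + \<epsilon>"] assms by (auto simp: ennreal_mult_less_top power_less_top_ennreal)
      fix T and a :: 'a
      define F where "F x = ennreal (\<langle>T + 2 * (norm (x - a))\<^sup>2\<rangle> powr (- (2 * \<beta>)))" for x
      have [measurable]: "borel_fun F" unfolding F_def[abs_def] by measurable
      have "(NINT x. ennreal (B T a x)) \<le> (NINT x. F x * (\<Prod>b\<in>Basis - {j, i}. ?h (x \<bullet> b)))"
      proof (rule nn_integral_mono)
        fix x :: 'a
        have "card (Basis - {j, i} :: 'a set) = DIM('a) - 2" using ij by (simp add: card_Diff_subset)
        then have "real (card (Basis - {j, i} :: 'a set)) = ?d - 2" using True by simp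
        then show "ennreal (B T a x) \<le> F x * (\<Prod>b\<in>Basis - {j, i}. ?h (x \<bullet> b))"
          using japanese_powr_le_prod[of "Basis - {j, i}" "1 + \<epsilon>" x] assms
          by (simp add: B_def F_def m2 ennreal_mult mult_left_mono)
      qed
      also have "\<dots> \<le> C * (NINT t. ?h t) ^ (DIM('a) - 2)"
      proof (rule NINT_slice_2)
        fix x :: 'a
        define w where "w = x - a"
        have n: "(norm (x + t *\<^sub>R j + u *\<^sub>R i - a))\<^sup>2 = ((norm w)\<^sup>2 - (w \<bullet> j)\<^sup>2 - (w \<bullet> i)\<^sup>2) + (u - (- (w \<bullet> i)))\<^sup>2 + (t - (- (w \<bullet> j)))\<^sup>2" for t u
        proof -
          have *: "x + t *\<^sub>R j + u *\<^sub>R i - a = (w + t *\<^sub>R j) + u *\<^sub>R i" by (simp add: w_def)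
          show ?thesis unfolding * using ij
            by (simp add: norm_add_basis_sq inner_add_left inner_not_same_Basis)
        qed
        have e: "T + 2 * (norm (x + t *\<^sub>R j + u *\<^sub>R i - a))\<^sup>2 = (T + 2 * ((norm w)\<^sup>2 - (w \<bullet> j)\<^sup>2 - (w \<bullet> i)\<^sup>2)) + 2 * (u - (- (w \<bullet> i)))\<^sup>2 + 2 * (t - (- (w \<bullet> j)))\<^sup>2" for t u
          unfolding n by (simp add: algebra_simps)
        show "(NINT t. NINT u. F (x + t *\<^sub>R j + u *\<^sub>R i)) \<le> C"
          unfolding F_def e by (rule C(2)[of "T + 2 * ((norm w)\<^sup>2 - (w \<bullet> j)\<^sup>2 - (w \<bullet> i)\<^sup>2)" "\<lambda>_. - (w \<bullet> i)" "- (w \<bullet> j)"])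
      qed (use ij in auto)
      finally show "(NINT x. ennreal (B T a x)) \<le> C * (NINT t. ?h t) ^ (DIM('a) - 2)" .
    qed
  next
    case False
    then have d1: "DIM('a) = 1" using DIM_positive[where 'a='a] by linarith
    then have m1: "m = 1" by (simp add: m_def)
    obtain i :: 'a where i: "i \<in> Basis" using nonempty_Basis by blast
    obtain C where C: "C < \<infinity>"
      "\<And>(T :: real) a. (NINT x. ennreal (\<langle>T + 2 * (x - a)\<^sup>2\<rangle> powr (- \<beta>))) \<le> C"
      by (rule japanese_quadratic_integral_bound_1[of 2 "\<beta>"]) (use assms in auto)
    show ?thesis
    proof
      show "C < \<infinity>" by fact
      fix T and a :: 'a
      define F where "F x = ennreal (\<langle>T + 2 * (norm (x - a))\<^sup>2\<rangle> powr (- \<beta>))" for x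
      have [measurable]: "borel_fun F" unfolding F_def[abs_def] by measurable
      have Bi: "Basis - {i} = {}" using d1 i by (metis card_1_singletonE singletonD Diff_cancel)
      have "(NINT x. F x * (\<Prod>b\<in>Basis - {i}. ?h (x \<bullet> b))) \<le> C * (NINT t. ?h t) ^ (DIM('a) - 1)"
      proof (rule NINT_slice_1)
        fix x :: 'a
        define w where "w = x - a"
        have n: "(norm (x + t *\<^sub>R i - a))\<^sup>2 = ((norm w)\<^sup>2 - (w \<bullet> i)\<^sup>2) + (t - (- (w \<bullet> i)))\<^sup>2" for t
        proof -
          have *: "x + t *\<^sub>R i - a = w + t *\<^sub>R i" by (simp add: w_def)
          show ?thesis unfolding * using i by (simp add: norm_add_basis_sq)
        qed
        have e: "T + 2 * (norm (x + t *\<^sub>R i - a))\<^sup>2 = (T + 2 * ((norm w)\<^sup>2 - (w \<bullet> i)\<^sup>2)) + 2 * (t - (- (w \<bullet> i)))\<^sup>2" for t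
          unfolding n by (simp add: algebra_simps)
        show "(NINT t. F (x + t *\<^sub>R i)) \<le> C"
          unfolding F_def e by (rule C(2))
      qed (use i in auto)
      then show "(NINT x. ennreal (B T a x)) \<le> C"
        by (simp add: Bi d1 B_def F_def m1)
    qed
  qed
  show ?thesis
  proof
    show "(NINT x. ennreal (A x)) + CB < \<infinity>" using A_fin CB by simp
    fix T and a :: 'a
    have "(NINT x. ennreal (\<langle>T + 2 * (norm (x - a))\<^sup>2\<rangle> powr (- (E * \<beta>)) * \<langle>x\<rangle> powr (- ((?d - E) * (1 + \<epsilon>)))))
       \<le> (NINT x. ennreal (A x) + ennreal (B T a x))"
      using pt by (intro nn_integral_mono) (simp add: ennreal_plus[symmetric] A_def B_def ennreal_leI del: ennreal_plus)
    also have "\<dots> \<le> (NINT x. ennreal (A x)) + CB"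
      using CB by (subst nn_integral_add) (auto intro: add_left_mono)
    finally show "(NINT x. ennreal (\<langle>T + 2 * (norm (x - a))\<^sup>2\<rangle> powr (- (E * \<beta>)) * \<langle>x\<rangle> powr (- ((?d - E) * (1 + \<epsilon>)))))
       \<le> (NINT x. ennreal (A x)) + CB" .
  qed
qed

text \<open>The exponent 2 \<beta> > 1 pays for a plane. Here the plane is spanned by one direction
  \<open>i\<close> of x and the same direction of y; the frequency weights pay for the d - 1 other
  directions of each.\<close>

lemma three_paraboloids_weight_bound:
  fixes \<beta> \<epsilon> :: real
  assumes "0 < \<epsilon>" "1 / 2 < \<beta>"
  obtains C where "C < \<infinity>"
    "\<And>T c. (NINT x. NINT y. ennreal (\<langle>T + (norm x)\<^sup>2 + (norm y)\<^sup>2 + (norm (c - x - y :: 'a::euclidean_space))\<^sup>2\<rangle> powr (- (2 * \<beta>))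
        * (\<langle>x\<rangle> powr (- ((DIM('a) - 1) * (1 + \<epsilon>))) * \<langle>y\<rangle> powr (- ((DIM('a) - 1) * (1 + \<epsilon>)))))) \<le> C"
proof -
  let ?h = "\<lambda>t::real. ennreal (\<langle>t\<rangle> powr (- (1 + \<epsilon>)))"
  obtain i :: 'a where i: "i \<in> Basis" using nonempty_Basis by blast
  define I1 I2 where "I1 = (i, 0 :: 'a)" and "I2 = (0 :: 'a, i)"
  have I: "I1 \<in> Basis" "I2 \<in> Basis" "I1 \<noteq> I2"
    using i by (auto simp: I1_def I2_def Basis_prod_def nonzero_Basis)
  \<comment> \<open>The coefficients come from the form on that plane: U^2 + V^2 + (r - U - V)^2 = 2
    (U - (r - V) / 2)^2 + 3 / 2 (V - r / 3)^2 + r^2 / 3. The last term goes into the constant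
    \<open>T'\<close> below.\<close>
  obtain C where C: "C < \<infinity>"
    "\<And>(T :: real) a b. (NINT y. NINT x. ennreal (\<langle>T + 2 * (x - a y)\<^sup>2 + 3 / 2 * (y - b)\<^sup>2\<rangle> powr (- (2 * \<beta>)))) \<le> C"
    by (rule japanese_quadratic_integral_bound_2[of 2 "3/2" "2 * \<beta>"]) (use assms in auto)
  show ?thesis
  proof
    show "C * (NINT t. ?h t) ^ (DIM('a \<times> 'a) - 2) < \<infinity>"
      using C(1) japanese_powr_integrable[of "1 + \<epsilon>"] assms by (auto simp: ennreal_mult_less_top power_less_top_ennreal)
    fix T and c :: 'a
    define F where "F z = ennreal (\<langle>T + (norm (fst z))\<^sup>2 + (norm (snd z))\<^sup>2 + (norm (c - fst z - snd z))\<^sup>2\<rangle> powr (- (2 * \<beta>)))" for z :: "'a \<times> 'a"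
    have [measurable]: "borel_fun F" unfolding F_def[abs_def] by measurable
    define w where "w x = ennreal (\<langle>x\<rangle> powr (- ((DIM('a) - 1) * (1 + \<epsilon>))))" for x :: 'a
    have [measurable]: "borel_fun w" unfolding w_def[abs_def] by measurable
    have w: "w x \<le> (\<Prod>b\<in>Basis - {i}. ?h (x \<bullet> b))" for x
    proof -
      have "real (card (Basis - {i})) = DIM('a) - 1" using i DIM_positive[where 'a='a] by (simp add: card_Diff_singleton)
      then show ?thesis using japanese_powr_le_prod[of "Basis - {i}" "1 + \<epsilon>" x] assms by (simp add: w_def)
    qed
    have B: "(Basis :: ('a \<times> 'a) set) - {I2, I1} = (\<lambda>u. (u, 0)) ` (Basis - {i}) \<union> (\<lambda>u. (0, u)) ` (Basis - {i})"
      by (auto simp: Basis_prod_def I1_def I2_def)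
    have disj: "(\<lambda>u. (u, 0 :: 'a)) ` (Basis - {i}) \<inter> (\<lambda>u. (0 :: 'a, u)) ` (Basis - {i}) = {}"
      by (auto simp: nonzero_Basis)
    have w2: "w (fst z) * w (snd z) \<le> (\<Prod>b\<in>Basis - {I2, I1}. ?h (z \<bullet> b))" for z :: "'a \<times> 'a"
    proof -
      have "w (fst z) * w (snd z) \<le> (\<Prod>b\<in>Basis - {i}. ?h (fst z \<bullet> b)) * (\<Prod>b\<in>Basis - {i}. ?h (snd z \<bullet> b))"
        by (intro mult_mono w) auto
      also have "\<dots> = (\<Prod>b\<in>(\<lambda>u. (u, 0)) ` (Basis - {i}). ?h (z \<bullet> b)) * (\<Prod>b\<in>(\<lambda>u. (0, u)) ` (Basis - {i}). ?h (z \<bullet> b))"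
        by (subst (1 2) prod.reindex) (auto simp: inj_on_def inner_prod_def)
      also have "\<dots> = (\<Prod>b\<in>Basis - {I2, I1}. ?h (z \<bullet> b))"
        unfolding B by (rule prod.union_disjoint[symmetric]) (use disj in auto)
      finally show ?thesis .
    qed
    let ?X = "(NINT x. NINT y. ennreal (\<langle>T + (norm x)\<^sup>2 + (norm y)\<^sup>2 + (norm (c - x - y))\<^sup>2\<rangle> powr (- (2 * \<beta>))
        * (\<langle>x\<rangle> powr (- ((DIM('a) - 1) * (1 + \<epsilon>))) * \<langle>y\<rangle> powr (- ((DIM('a) - 1) * (1 + \<epsilon>))))))"
    have "?X
      = (NINT z. F z * (w (fst z) * w (snd z)))"
      by (subst NINT_pair) (auto simp: F_def w_def ennreal_mult)
    also have "\<dots> \<le> (NINT z. F z * (\<Prod>b\<in>Basis - {I2, I1}. ?h (z \<bullet> b)))"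
      by (intro nn_integral_mono mult_left_mono w2) auto
    also have "\<dots> \<le> C * (NINT t. ?h t) ^ (DIM('a \<times> 'a) - 2)"
    proof (rule NINT_slice_2)
      fix z :: "'a \<times> 'a"
      define x y v where "x = fst z" and "y = snd z" and "v = c - fst z - snd z"
      define p q r where "p = x \<bullet> i" and "q = y \<bullet> i" and "r = c \<bullet> i"
      define T' where "T' = T + (norm x)\<^sup>2 - p\<^sup>2 + ((norm y)\<^sup>2 - q\<^sup>2) + ((norm v)\<^sup>2 - (v \<bullet> i)\<^sup>2) + r\<^sup>2 / 3"
      have "F (z + t *\<^sub>R I2 + u *\<^sub>R I1) = ennreal (\<langle>T' + 2 * (u - ((r - t - q) / 2 - p))\<^sup>2 + 3 / 2 * (t - (r / 3 - q))\<^sup>2\<rangle> powr (- (2 * \<beta>)))" for t u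
      proof -
        have fs: "fst (z + t *\<^sub>R I2 + u *\<^sub>R I1) = x + u *\<^sub>R i" "snd (z + t *\<^sub>R I2 + u *\<^sub>R I1) = y + t *\<^sub>R i"
          by (auto simp: x_def y_def I1_def I2_def)
        have n1: "(norm (x + u *\<^sub>R i))\<^sup>2 = (norm x)\<^sup>2 - p\<^sup>2 + (u + p)\<^sup>2" using i by (simp add: norm_add_basis_sq p_def)
        have n2: "(norm (y + t *\<^sub>R i))\<^sup>2 = (norm y)\<^sup>2 - q\<^sup>2 + (t + q)\<^sup>2" using i by (simp add: norm_add_basis_sq q_def)
        have ve: "c - (x + u *\<^sub>R i) - (y + t *\<^sub>R i) = v + (- t - u) *\<^sub>R i"
          by (simp add: v_def x_def y_def algebra_simps)
        have vi: "v \<bullet> i = r - p - q" by (simp add: v_def x_def y_def p_def q_def r_def inner_diff_left)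
        have n3: "(norm (c - (x + u *\<^sub>R i) - (y + t *\<^sub>R i)))\<^sup>2 = (norm v)\<^sup>2 - (v \<bullet> i)\<^sup>2 + (- t - u + (r - p - q))\<^sup>2"
          unfolding ve using i by (simp add: norm_add_basis_sq vi)
        have "T + (norm (x + u *\<^sub>R i))\<^sup>2 + (norm (y + t *\<^sub>R i))\<^sup>2 + (norm (c - (x + u *\<^sub>R i) - (y + t *\<^sub>R i)))\<^sup>2
          = T' + 2 * (u - ((r - t - q) / 2 - p))\<^sup>2 + 3 / 2 * (t - (r / 3 - q))\<^sup>2"
          unfolding n1 n2 n3 T'_def by (simp add: power2_eq_square field_simps)
        then show ?thesis unfolding F_def fs by simp
      qed
      then show "(NINT t. NINT u. F (z + t *\<^sub>R I2 + u *\<^sub>R I1)) \<le> C"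
        using C(2)[of T' "\<lambda>t. (r - t - q) / 2 - p" "r / 3 - q"] by simp
    qed (use I in auto)
    finally show "?X
      \<le> C * (NINT t. ?h t) ^ (DIM('a \<times> 'a) - 2)" .
  qed
qed

section \<open>A quadrilinear form of convolution type\<close>

text \<open>Index 0 stands for v. The points a, b, c are those of v, v2 and v3, and their sum is
  that of v1, because \<xi>1 = \<xi> + z2 + \<xi>3 and likewise in \<tau>. In these variables the
  symmetry between 0, 2 and 3 is visible.\<close>

definition quad_form ::
  "('z::euclidean_space \<Rightarrow> ennreal) \<Rightarrow> ('z \<Rightarrow> ennreal) \<Rightarrow> ('z \<Rightarrow> ennreal) \<Rightarrow> ('z \<Rightarrow> ennreal) \<Rightarrow> ennreal" where
  "quad_form F0 F1 F2 F3 =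
    (NINT a. NINT b. NINT c. F0 a * F2 b * F3 c * F1 (a + b + c))"

abbreviation (input) weighted_form where
  "weighted_form f0 w0 f1 w1 f2 w2 f3 w3 \<equiv>
    quad_form (\<lambda>a. f0 a * w0 a) (\<lambda>a. f1 a * w1 a) (\<lambda>a. f2 a * w2 a) (\<lambda>a. f3 a * w3 a)"

abbreviation (input) energy :: "('a::euclidean_space \<Rightarrow> ennreal) \<Rightarrow> ennreal" where
  "energy f \<equiv> NINT a. (f a)\<^sup>2"

definition convol :: "('z::euclidean_space \<Rightarrow> ennreal) \<Rightarrow> ('z \<Rightarrow> ennreal) \<Rightarrow> 'z \<Rightarrow> ennreal" where
  "convol F G s = (NINT a. F a * G (s - a))"

lemma nn_integral_power2:
  fixes f :: "'z::euclidean_space \<Rightarrow> ennreal"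
  assumes [measurable]: "borel_fun f"
  shows "(NINT a. f a)\<^sup>2 = (NINT a. NINT a'. f a * f a')"
  by (simp add: nn_integral_cmult nn_integral_multc power2_eq_square)

lemma NINT_swap3:
  fixes f :: "'a::euclidean_space \<Rightarrow> 'b::euclidean_space \<Rightarrow> 'c::euclidean_space \<Rightarrow> ennreal"
  assumes [measurable]: "borel_fun (\<lambda>(x, y, z). f x y z)"
  shows "(NINT x. NINT y. NINT z. f x y z)
    = (NINT z. NINT x. NINT y. f x y z)"
proof -
  have m: "(\<lambda>p. f (g p) (h p) (k p)) \<in> borel_measurable M"
    if [measurable]: "g \<in> M \<rightarrow>\<^sub>M borel" "h \<in> M \<rightarrow>\<^sub>M borel" "k \<in> M \<rightarrow>\<^sub>M borel" for g h k and M :: "'m measure"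
  proof -
    have "(\<lambda>p. (\<lambda>(x, y, z). f x y z) (g p, h p, k p)) \<in> borel_measurable M" by measurable
    then show ?thesis by simp
  qed
  note [measurable] = m
  have "(NINT x. NINT y. NINT z. f x y z)
      = (NINT x. NINT z. NINT y. f x y z)"
    by (intro nn_integral_cong NINT_swap) measurable
  also have "\<dots> = (NINT z. NINT x. NINT y. f x y z)"
    by (intro NINT_swap) measurable
  finally show ?thesis .
qed

lemma quad_form_swap_02:
  assumes [measurable]: "borel_fun F0" "borel_fun F1"
    "borel_fun F2" "borel_fun F3"
  shows "quad_form F0 F1 F2 F3 = quad_form F2 F1 F0 F3"
  unfolding quad_form_def
  by (subst NINT_swap) (auto simp: ac_simps intro!: nn_integral_cong)

lemma quad_form_swap_23:
  assumes [measurable]: "borel_fun F0" "borel_fun F1"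
    "borel_fun F2" "borel_fun F3"
  shows "quad_form F0 F1 F2 F3 = quad_form F0 F1 F3 F2"
  unfolding quad_form_def
  by (rule nn_integral_cong, subst NINT_swap) (auto simp: ac_simps intro!: nn_integral_cong)

text \<open>Squaring out, the correlation of \<open>F\<close> and \<open>G\<close> has the same \<open>L\<^sup>2\<close> norm as their
  convolution: \<open>a' - a = b' - b\<close> if and only if \<open>a' + b = b' + a\<close>.\<close>

lemma nn_integral_correlation_power2:
  assumes [measurable]: "borel_fun F" "borel_fun G"
  shows "(NINT u. (NINT a. F a * G (a + u))\<^sup>2) = (NINT s. (convol F G s)\<^sup>2)"
proof -
  have "(NINT u. (NINT a. F a * G (a + u))\<^sup>2)
     = (NINT u. NINT a. NINT a'. F a * G (a + u) * (F a' * G (a' + u)))"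
    by (subst nn_integral_power2) auto
  also have "\<dots> = (NINT a. NINT a'. NINT u. F a * G (a + u) * (F a' * G (a' + u)))"
    by (subst NINT_swap3[symmetric]) measurable
  also have "\<dots> = (NINT a. NINT a'. NINT s. F a * G (s - a) * (F a' * G (s - a')))"
  proof (rule nn_integral_cong, rule nn_integral_cong)
    fix a a' :: 'a
    have "(NINT u. F a * G (a + u) * (F a' * G (a' + u)))
       = (NINT s. F a * G (a + (- a - a' + s)) * (F a' * G (a' + (- a - a' + s))))"
      by (rule NINT_shift[symmetric]) measurable
    also have "\<dots> = (NINT s. F a * G (s - a) * (F a' * G (s - a')))"
      by (simp add: algebra_simps)
    finally show "(NINT u. F a * G (a + u) * (F a' * G (a' + u)))
       = (NINT s. F a * G (s - a) * (F a' * G (s - a')))" .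
  qed
  also have "\<dots> = (NINT s. NINT a. NINT a'. F a * G (s - a) * (F a' * G (s - a')))"
    by (subst NINT_swap3[symmetric]) measurable
  also have "\<dots> = (NINT s. (convol F G s)\<^sup>2)"
    unfolding convol_def by (subst nn_integral_power2) auto
  finally show ?thesis .
qed

lemma convol_measurable [measurable]:
  assumes [measurable]: "borel_fun F" "borel_fun G"
  shows "borel_fun (convol F G)"
  unfolding convol_def[abs_def] by measurable

text \<open>With u = b + c in place of c, the form is the inner product over u of the correlation of
  \<open>F0\<close> and \<open>F1\<close> with the convolution of \<open>F2\<close> and
  \<open>F3\<close>. By \<open>nn_integral_correlation_power2\<close> the correlation may be traded
  for a convolution, so that both pairs get the same shape.\<close>

lemma quad_form_Cauchy_Schwarz:
  assumes [measurable]: "borel_fun F0" "borel_fun F1"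
    "borel_fun F2" "borel_fun F3"
  shows "(quad_form F0 F1 F2 F3)\<^sup>2
    \<le> (NINT s. (convol F0 F1 s)\<^sup>2) * (NINT s. (convol F2 F3 s)\<^sup>2)"
proof -
  have "quad_form F0 F1 F2 F3 = (NINT a. NINT b. NINT u. F0 a * F1 (a + u) * (F2 b * F3 (u - b)))"
    unfolding quad_form_def
  proof (rule nn_integral_cong, rule nn_integral_cong)
    fix a b :: 'a
    have "(NINT c. F0 a * F2 b * F3 c * F1 (a + b + c))
       = (NINT u. F0 a * F2 b * F3 (- b + u) * F1 (a + b + (- b + u)))"
      by (rule NINT_shift[symmetric]) measurable
    also have "\<dots> = (NINT u. F0 a * F1 (a + u) * (F2 b * F3 (u - b)))"
      by (simp add: ac_simps)
    finally show "(NINT c. F0 a * F2 b * F3 c * F1 (a + b + c))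
      = (NINT u. F0 a * F1 (a + u) * (F2 b * F3 (u - b)))" .
  qed
  also have "\<dots> = (NINT u. NINT a. NINT b. F0 a * F1 (a + u) * (F2 b * F3 (u - b)))"
    by (rule NINT_swap3) measurable
  also have "\<dots> = (NINT u. (NINT a. F0 a * F1 (a + u)) * convol F2 F3 u)"
    unfolding convol_def by (simp add: nn_integral_cmult nn_integral_multc)
  also have "\<dots>\<^sup>2 \<le> (NINT u. (NINT a. F0 a * F1 (a + u))\<^sup>2) * (NINT u. (convol F2 F3 u)\<^sup>2)"
    by (rule Cauchy_Schwarz_nn_integral) auto
  finally show ?thesis by (simp add: nn_integral_correlation_power2)
qed

text \<open>Cauchy-Schwarz at each output s separates the weights from the functions. The weights
  contribute the supremum \<open>C\<close>; the integral of f(a)^2 g(s - a)^2 over a and s is the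
  product of the energies.\<close>

lemma convol_weighted_bound:
  assumes [measurable]: "borel_fun f" "borel_fun g"
    "borel_fun w" "borel_fun w'"
    and bound: "\<And>s. (NINT a. (w a)\<^sup>2 * (w' (s - a))\<^sup>2) \<le> C"
  shows "(NINT s. (convol (\<lambda>a. f a * w a) (\<lambda>a. g a * w' a) s)\<^sup>2)
    \<le> C * energy f * energy g"
proof -
  have "(NINT s. (convol (\<lambda>a. f a * w a) (\<lambda>a. g a * w' a) s)\<^sup>2)
     \<le> (NINT s. C * (NINT a. (f a)\<^sup>2 * (g (s - a))\<^sup>2))"
  proof (rule nn_integral_mono)
    fix s :: 'a
    have "convol (\<lambda>a. f a * w a) (\<lambda>a. g a * w' a) s = (NINT a. (w a * w' (s - a)) * (f a * g (s - a)))"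
      by (simp add: convol_def ac_simps)
    also have "\<dots>\<^sup>2 \<le> (NINT a. (w a * w' (s - a))\<^sup>2) * (NINT a. (f a * g (s - a))\<^sup>2)"
      by (rule Cauchy_Schwarz_nn_integral) measurable
    also have "\<dots> \<le> C * (NINT a. (f a)\<^sup>2 * (g (s - a))\<^sup>2)"
      using bound[of s] by (simp add: power_mult_distrib mult_right_mono)
    finally show "(convol (\<lambda>a. f a * w a) (\<lambda>a. g a * w' a) s)\<^sup>2 \<le> C * (NINT a. (f a)\<^sup>2 * (g (s - a))\<^sup>2)" .
  qed
  also have "\<dots> = C * (NINT s. NINT a. (f a)\<^sup>2 * (g (s - a))\<^sup>2)"
    by (rule nn_integral_cmult) measurable
  also have "(NINT s. NINT a. (f a)\<^sup>2 * (g (s - a))\<^sup>2)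
      = (NINT a. NINT s. (f a)\<^sup>2 * (g (s - a))\<^sup>2)"
    by (subst NINT_swap) auto
  also have "\<dots> = (NINT a. (f a)\<^sup>2 * energy g)"
  proof (rule nn_integral_cong)
    fix a
    have "(NINT s. (g (s - a))\<^sup>2) = energy g"
      using NINT_shift[of "\<lambda>s. (g s)\<^sup>2" "- a"] by simp
    then show "(NINT s. (f a)\<^sup>2 * (g (s - a))\<^sup>2) = (f a)\<^sup>2 * energy g"
      by (simp add: nn_integral_cmult)
  qed
  also have "\<dots> = energy f * energy g"
    by (simp add: nn_integral_multc)
  finally show ?thesis by (simp add: mult.assoc)
qed

lemma quad_form_pair_bound:
  assumes [measurable]: "borel_fun f0" "borel_fun f1"
    "borel_fun f2" "borel_fun f3"
    "borel_fun w0" "borel_fun w1"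
    "borel_fun w2" "borel_fun w3"
    and "\<And>s. (NINT a. (w0 a)\<^sup>2 * (w1 (s - a))\<^sup>2) \<le> C"
    and "\<And>s. (NINT a. (w2 a)\<^sup>2 * (w3 (s - a))\<^sup>2) \<le> C"
  shows "(weighted_form f0 w0 f1 w1 f2 w2 f3 w3)\<^sup>2
    \<le> C\<^sup>2 * (energy f0 * energy f1 * energy f2 * energy f3)"
proof -
  have "(weighted_form f0 w0 f1 w1 f2 w2 f3 w3)\<^sup>2
    \<le> (C * energy f0 * energy f1) * (C * energy f2 * energy f3)"
    by (rule order_trans[OF quad_form_Cauchy_Schwarz mult_mono]) (auto intro!: convol_weighted_bound assms)
  then show ?thesis by (simp add: power2_eq_square ac_simps)
qed

text \<open>The unweighted \<open>f1\<close> is split off by Cauchy-Schwarz in the output s = a + b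
  + c; a second Cauchy-Schwarz in (a, b) at fixed s separates the weights from the other three
  functions. The constant thus enters once, not squared as for two pairs.\<close>

lemma quad_form_triple_bound:
  assumes [measurable]: "borel_fun f0" "borel_fun f1"
    "borel_fun f2" "borel_fun f3"
    "borel_fun w0"
    "borel_fun w2" "borel_fun w3"
    and bound: "\<And>s. (NINT a. NINT b. (w0 a)\<^sup>2 * (w2 b)\<^sup>2 * (w3 (s - a - b))\<^sup>2) \<le> C"
  shows "(quad_form (\<lambda>a. f0 a * w0 a) f1 (\<lambda>a. f2 a * w2 a) (\<lambda>a. f3 a * w3 a))\<^sup>2
    \<le> C * (energy f0 * energy f1 * energy f2 * energy f3)"
proof -
  define w f where "w z s = w0 (fst z) * w2 (snd z) * w3 (s - fst z - snd z)"
    and "f z s = f0 (fst z) * f2 (snd z) * f3 (s - fst z - snd z)" for z :: "'a \<times> 'a" and s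
  define H where "H s = (NINT z. w z s * f z s)" for s
  have [measurable]: "borel_fun (\<lambda>z. w z s)" "borel_fun (\<lambda>z. f z s)" for s
    unfolding w_def f_def by measurable
  have [measurable]: "borel_fun H"
    unfolding H_def[abs_def] w_def f_def by measurable
  let ?X = "\<lambda>a b s. f0 a * w0 a * (f2 b * w2 b) * (f3 (s - a - b) * w3 (s - a - b))"
  have H: "H s = (NINT a. NINT b. ?X a b s)" for s
    unfolding H_def by (subst NINT_pair) (auto simp: w_def f_def ac_simps)
  have "quad_form (\<lambda>a. f0 a * w0 a) f1 (\<lambda>a. f2 a * w2 a) (\<lambda>a. f3 a * w3 a)
    = (NINT a. NINT b. NINT s. ?X a b s * f1 s)"
    unfolding quad_form_def
  proof (rule nn_integral_cong, rule nn_integral_cong)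
    fix a b :: 'a
    have "(NINT c. f0 a * w0 a * (f2 b * w2 b) * (f3 c * w3 c) * f1 (a + b + c))
       = (NINT s. f0 a * w0 a * (f2 b * w2 b) * (f3 (- a - b + s) * w3 (- a - b + s)) * f1 (a + b + (- a - b + s)))"
      by (rule NINT_shift[symmetric]) measurable
    also have "\<dots> = (NINT s. ?X a b s * f1 s)"
      by (simp add: algebra_simps)
    finally show "(NINT c. f0 a * w0 a * (f2 b * w2 b) * (f3 c * w3 c) * f1 (a + b + c))
       = (NINT s. ?X a b s * f1 s)" .
  qed
  also have "\<dots> = (NINT s. NINT a. NINT b. ?X a b s * f1 s)"
    by (rule NINT_swap3) measurable
  also have "\<dots> = (NINT s. H s * f1 s)"
    by (simp add: H nn_integral_multc)
  finally have Q: "(quad_form (\<lambda>a. f0 a * w0 a) f1 (\<lambda>a. f2 a * w2 a) (\<lambda>a. f3 a * w3 a))\<^sup>2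
    \<le> (NINT s. (H s)\<^sup>2) * energy f1"
    by (simp add: Cauchy_Schwarz_nn_integral)
  have "(NINT s. (H s)\<^sup>2) \<le> (NINT s. C * (NINT z. (f z s)\<^sup>2))"
  proof (rule nn_integral_mono)
    fix s
    have "(H s)\<^sup>2 \<le> (NINT z. (w z s)\<^sup>2) * (NINT z. (f z s)\<^sup>2)"
      unfolding H_def by (rule Cauchy_Schwarz_nn_integral) auto
    also have "(NINT z. (w z s)\<^sup>2) \<le> C"
      using bound[of s] by (subst NINT_pair) (auto simp: w_def power_mult_distrib)
    finally show "(H s)\<^sup>2 \<le> C * (NINT z. (f z s)\<^sup>2)" by (simp add: mult_right_mono)
  qed
  also have "(NINT s. C * (NINT z. (f z s)\<^sup>2)) = C * (NINT s. NINT z. (f z s)\<^sup>2)"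
    unfolding f_def by (rule nn_integral_cmult) measurable
  also have "(NINT s. NINT z. (f z s)\<^sup>2) = (NINT z. NINT s. (f z s)\<^sup>2)"
    unfolding f_def by (rule NINT_swap) measurable
  also have "\<dots> = (NINT z. (f0 (fst z))\<^sup>2 * (f2 (snd z))\<^sup>2 * energy f3)"
  proof (rule nn_integral_cong)
    fix z :: "'a \<times> 'a"
    have "(NINT s. (f3 (- fst z - snd z + s))\<^sup>2) = energy f3"
      by (rule NINT_shift) measurable
    moreover have "- fst z - snd z + s = s - fst z - snd z" for s by simp
    ultimately show "(NINT s. (f z s)\<^sup>2) = (f0 (fst z))\<^sup>2 * (f2 (snd z))\<^sup>2 * energy f3"
      by (simp add: f_def power_mult_distrib nn_integral_cmult)
  qed
  also have "\<dots> = energy f0 * energy f2 * energy f3"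
    by (subst NINT_pair) (auto simp: nn_integral_cmult nn_integral_multc)
  finally have "(NINT s. (H s)\<^sup>2)
      \<le> C * (energy f0 * energy f2 * energy f3)" .
  from order_trans[OF Q mult_right_mono[OF this]] show ?thesis by (simp add: ac_simps)
qed

text \<open>The interleaved variables are regrouped into space-time points z1, z2, z3. The
  substitutions z1 = z2 + a and z2 = z3 + b are then translations, so no Jacobian appears.\<close>

lemma nn_integral_space_time_eq_quad_form:
  fixes F0 F1 F2 F3 :: "real \<times> 'b::euclidean_space \<Rightarrow> ennreal"
  assumes [measurable]: "borel_fun F0" "borel_fun F1"
    "borel_fun F2" "borel_fun F3"
  shows "(\<integral>\<^sup>+(\<xi>1, \<xi>2, \<xi>3, \<tau>1, \<tau>2, \<tau>3). F0 (\<tau>1 - \<tau>2, \<xi>1 - \<xi>2) * F1 (\<tau>1, \<xi>1) * F2 (\<tau>2 - \<tau>3, \<xi>2 - \<xi>3) * F3 (\<tau>3, \<xi>3) \<partial>lborel)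
    = quad_form F0 F1 F2 F3"
proof -
  define g where "g \<xi>1 \<xi>2 \<xi>3 \<tau>1 \<tau>2 \<tau>3 = F0 (\<tau>1 - \<tau>2, \<xi>1 - \<xi>2) * F1 (\<tau>1, \<xi>1) * F2 (\<tau>2 - \<tau>3, \<xi>2 - \<xi>3) * F3 (\<tau>3, \<xi>3)"
    for \<xi>1 \<xi>2 \<xi>3 :: 'b and \<tau>1 \<tau>2 \<tau>3 :: real
  define H where "H z1 z2 z3 = F0 (z1 - z2) * F1 z1 * F2 (z2 - z3) * F3 z3" for z1 z2 z3 :: "real \<times> 'b"
  have gH: "g \<xi>1 \<xi>2 \<xi>3 \<tau>1 \<tau>2 \<tau>3 = H (\<tau>1, \<xi>1) (\<tau>2, \<xi>2) (\<tau>3, \<xi>3)" for \<xi>1 \<xi>2 \<xi>3 \<tau>1 \<tau>2 \<tau>3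
    by (simp add: g_def H_def)
  have [measurable]: "(\<lambda>p. H (f1 p) (f2 p) (f3 p)) \<in> borel_measurable M"
    if [measurable]: "f1 \<in> M \<rightarrow>\<^sub>M borel" "f2 \<in> M \<rightarrow>\<^sub>M borel" "f3 \<in> M \<rightarrow>\<^sub>M borel" for f1 f2 f3 and M :: "'m measure"
    unfolding H_def by measurable
  have TX: "(NINT z. f z) = (NINT \<xi>. NINT \<tau>. f (\<tau>, \<xi>))"
    if [measurable]: "borel_fun f" for f :: "real \<times> 'b \<Rightarrow> ennreal"
    by (subst NINT_pair, simp, subst NINT_swap) auto
  have "(\<integral>\<^sup>+(\<xi>1, \<xi>2, \<xi>3, \<tau>1, \<tau>2, \<tau>3). g \<xi>1 \<xi>2 \<xi>3 \<tau>1 \<tau>2 \<tau>3 \<partial>lborel)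
    = (NINT \<xi>1. NINT \<xi>2. NINT \<xi>3. NINT \<tau>1. NINT \<tau>2. NINT \<tau>3. H (\<tau>1, \<xi>1) (\<tau>2, \<xi>2) (\<tau>3, \<xi>3))"
    unfolding gH case_prod_unfold by (simp add: NINT_pair)
  also have "\<dots> = (NINT \<xi>1. NINT \<tau>1. NINT \<xi>2. NINT \<xi>3. NINT \<tau>2. NINT \<tau>3. H (\<tau>1, \<xi>1) (\<tau>2, \<xi>2) (\<tau>3, \<xi>3))"
    by (rule nn_integral_cong, rule NINT_swap3) measurable
  also have "\<dots> = (NINT \<xi>1. NINT \<tau>1. NINT \<xi>2. NINT \<tau>2. NINT \<xi>3. NINT \<tau>3. H (\<tau>1, \<xi>1) (\<tau>2, \<xi>2) (\<tau>3, \<xi>3))"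
    by (rule nn_integral_cong, rule nn_integral_cong, rule nn_integral_cong, rule NINT_swap) measurable
  also have "\<dots> = (NINT z1. NINT z2. NINT z3. H z1 z2 z3)"
    by (simp add: TX)
  also have "\<dots> = (NINT z3. NINT z2. NINT z1. H z1 z2 z3)"
    by (subst NINT_swap3, measurable, rule nn_integral_cong, rule NINT_swap) measurable
  also have "\<dots> = (NINT z3. NINT z2. NINT a. H (z2 + a) z2 z3)"
    by (rule nn_integral_cong, rule nn_integral_cong, rule NINT_shift[symmetric]) measurable
  also have "\<dots> = (NINT z3. NINT b. NINT a. H (z3 + b + a) (z3 + b) z3)"
    by (rule nn_integral_cong, rule NINT_shift[symmetric]) measurable
  also have "\<dots> = (NINT a. NINT b. NINT c. H (c + b + a) (c + b) c)"
    by (subst NINT_swap3, measurable, rule nn_integral_cong, rule NINT_swap) measurable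
  also have "\<dots> = quad_form F0 F1 F2 F3"
    unfolding quad_form_def H_def by (simp add: ac_simps)
  finally show ?thesis by (simp add: g_def)
qed

section \<open>Weights in the modulations and frequencies\<close>

text \<open>A negative \<kappa> is allowed: it produces the growing factor of v1 in the
  numerator.\<close>

definition weight :: "real \<Rightarrow> real \<Rightarrow> real \<times> 'b::euclidean_space \<Rightarrow> ennreal" where
  "weight e \<kappa> z = ennreal (\<langle>fst z + (norm (snd z))\<^sup>2\<rangle> powr (- e) * \<langle>snd z\<rangle> powr (- \<kappa>))"

lemma weight_measurable [measurable]: "borel_fun (weight e \<kappa>)"
  unfolding weight_def[abs_def] by measurable

lemma weight_power2: "(weight e \<kappa> z)\<^sup>2 = weight (2 * e) (2 * \<kappa>) z"
  by (simp add: weight_def ennreal_power power_mult_distrib powr_power mult.commute)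

text \<open>The integration variables of the two factors are the modulation \<open>\<sigma>\<close> of the first one
  and the frequency; the modulation of the second factor is then a paraboloid in the frequency.\<close>

lemma weight_pair_integral:
  fixes \<xi> :: "'b::euclidean_space"
  shows "(NINT a. weight e \<kappa> a * weight e' \<kappa>' ((\<tau>, \<xi>) - a))
    = (NINT \<sigma>. ennreal (\<langle>\<sigma>\<rangle> powr (- e)) * (NINT x. ennreal (\<langle>\<tau> - \<sigma> + (norm \<xi>)\<^sup>2 / 2 + 2 * (norm (x - \<xi> /\<^sub>R 2))\<^sup>2\<rangle> powr (- e')
        * (\<langle>x\<rangle> powr (- \<kappa>) * \<langle>\<xi> - x\<rangle> powr (- \<kappa>')))))"
proof -
  let ?Q = "\<lambda>\<sigma> x. \<tau> - \<sigma> + (norm \<xi>)\<^sup>2 / 2 + 2 * (norm (x - \<xi> /\<^sub>R 2))\<^sup>2"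
  \<comment> \<open>Parallelogram law: the paraboloids |x|^2 and |\<xi> - x|^2 add up to one centred
    at \<xi> / 2, whence the coefficient 2.\<close>
  have sq: "(norm x)\<^sup>2 + (norm (\<xi> - x))\<^sup>2 = (norm \<xi>)\<^sup>2 / 2 + 2 * (norm (x - \<xi> /\<^sub>R 2))\<^sup>2" for x
    unfolding power2_norm_eq_inner
    by (simp add: inner_diff_left inner_diff_right inner_commute algebra_simps)
  have "(NINT a. weight e \<kappa> a * weight e' \<kappa>' ((\<tau>, \<xi>) - a))
    = (NINT t. NINT x. weight e \<kappa> (t, x) * weight e' \<kappa>' (\<tau> - t, \<xi> - x))"
    by (subst NINT_pair) auto
  also have "\<dots> = (NINT x. NINT t. weight e \<kappa> (t, x) * weight e' \<kappa>' (\<tau> - t, \<xi> - x))"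
    by (rule NINT_swap) measurable
  also have "\<dots> = (NINT x. NINT \<sigma>. weight e \<kappa> (- (norm x)\<^sup>2 + \<sigma>, x) * weight e' \<kappa>' (\<tau> - (- (norm x)\<^sup>2 + \<sigma>), \<xi> - x))"
    by (rule nn_integral_cong, rule NINT_shift[symmetric]) measurable
  also have "\<dots> = (NINT \<sigma>. NINT x. weight e \<kappa> (- (norm x)\<^sup>2 + \<sigma>, x) * weight e' \<kappa>' (\<tau> - (- (norm x)\<^sup>2 + \<sigma>), \<xi> - x))"
    by (rule NINT_swap) measurable
  also have "\<dots> = (NINT \<sigma>. NINT x. ennreal (\<langle>\<sigma>\<rangle> powr (- e)) * ennreal (\<langle>?Q \<sigma> x\<rangle> powr (- e')
        * (\<langle>x\<rangle> powr (- \<kappa>) * \<langle>\<xi> - x\<rangle> powr (- \<kappa>'))))"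
  proof (rule nn_integral_cong, rule nn_integral_cong)
    fix \<sigma> :: real and x
    have e: "\<tau> - (- (norm x)\<^sup>2 + \<sigma>) + (norm (\<xi> - x))\<^sup>2 = ?Q \<sigma> x"
      using sq[of x] by linarith
    show "weight e \<kappa> (- (norm x)\<^sup>2 + \<sigma>, x) * weight e' \<kappa>' (\<tau> - (- (norm x)\<^sup>2 + \<sigma>), \<xi> - x)
      = ennreal (\<langle>\<sigma>\<rangle> powr (- e)) * ennreal (\<langle>?Q \<sigma> x\<rangle> powr (- e')
        * (\<langle>x\<rangle> powr (- \<kappa>) * \<langle>\<xi> - x\<rangle> powr (- \<kappa>')))"
      unfolding weight_def fst_conv snd_conv e by (simp add: ennreal_mult[symmetric] ac_simps)
  qed
  finally show ?thesis by (simp add: nn_integral_cmult)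
qed

text \<open>The factor of exponent \<beta> is integrated over its modulation, where 2 \<beta> > 1
  suffices; the factor of exponent \<open>E * \<beta> / 2\<close> is then handled by
  \<open>paraboloid_weight_bound\<close>. The two bounds differ in which of the factors carries the
  frequency weight.\<close>

lemma weight_pair_bound:
  fixes E \<beta> \<epsilon> :: real
  assumes E: "0 \<le> E" "E \<le> 2" "E \<le> DIM('b::euclidean_space)" and "0 < \<epsilon>" "1 / 2 < \<beta>"
    and \<kappa>: "\<kappa> = (DIM('b) - E) * (1 + \<epsilon>) / 2"
  obtains C where "C < \<infinity>"
    "\<And>s :: real \<times> 'b. (NINT a. (weight \<beta> \<kappa> a)\<^sup>2 * (weight (E * \<beta> / 2) 0 (s - a))\<^sup>2) \<le> C"
    "\<And>s :: real \<times> 'b. (NINT a. (weight (E * \<beta> / 2) \<kappa> a)\<^sup>2 * (weight \<beta> 0 (s - a))\<^sup>2) \<le> C"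
proof -
  obtain C where C: "C < \<infinity>"
    "\<And>T a. (NINT x. ennreal (\<langle>T + 2 * (norm (x - a :: 'b))\<^sup>2\<rangle> powr (- (E * \<beta>))
        * \<langle>x\<rangle> powr (- ((DIM('b) - E) * (1 + \<epsilon>))))) \<le> C"
    using paraboloid_weight_bound[OF assms(1-5)] by blast
  let ?A = "NINT \<sigma>. ennreal (\<langle>\<sigma>::real\<rangle> powr (- (2 * \<beta>)))"
  have 2: "2 * \<kappa> = (DIM('b) - E) * (1 + \<epsilon>)" using \<kappa> by simp
  have r: "(NINT \<sigma>. ennreal (\<langle>\<sigma>::real\<rangle> powr (- (2 * \<beta>))) * g \<sigma>) \<le> C * ?A" if "\<And>\<sigma>. g \<sigma> \<le> C" for g
  proof -
    have "(NINT \<sigma>. ennreal (\<langle>\<sigma>::real\<rangle> powr (- (2 * \<beta>))) * g \<sigma>) \<le> (NINT \<sigma>. ennreal (\<langle>\<sigma>::real\<rangle> powr (- (2 * \<beta>))) * C)"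
      by (intro nn_integral_mono mult_left_mono that) auto
    also have "\<dots> = C * ?A" by (subst nn_integral_multc) (auto simp: mult.commute)
    finally show ?thesis .
  qed
  show ?thesis
  proof
    show "C * ?A < \<infinity>" using C japanese_powr_integrable[of "2 * \<beta>"] assms by (auto simp: ennreal_mult_less_top)
    fix s :: "real \<times> 'b"
    obtain \<tau> \<xi> where s: "s = (\<tau>, \<xi>)" by (cases s)
    let ?Q = "\<lambda>\<sigma> x. \<tau> - \<sigma> + (norm \<xi>)\<^sup>2 / 2 + 2 * (norm (x - \<xi> /\<^sub>R 2))\<^sup>2"
    show "(NINT a. (weight \<beta> \<kappa> a)\<^sup>2 * (weight (E * \<beta> / 2) 0 (s - a))\<^sup>2) \<le> C * ?A"
      unfolding weight_power2 s weight_pair_integral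
    proof (rule r)
      fix \<sigma> :: real
      show "(NINT x. ennreal (\<langle>?Q \<sigma> x\<rangle> powr (- (2 * (E * \<beta> / 2)))
        * (\<langle>x\<rangle> powr (- (2 * \<kappa>)) * \<langle>\<xi> - x\<rangle> powr (- (2 * 0))))) \<le> C"
        using C(2)[of "\<tau> - \<sigma> + (norm \<xi>)\<^sup>2 / 2" "\<xi> /\<^sub>R 2"] by (simp add: 2)
    qed
    \<comment> \<open>Reflecting a to s - a puts the factor of exponent \<beta> first, so that its
      modulation becomes the integration variable. Reflecting x to \<xi> - x later restores the
      argument of the frequency weight and fixes the centre \<xi> / 2 of the paraboloid.\<close>
    have "(NINT a. (weight (E * \<beta> / 2) \<kappa> a)\<^sup>2 * (weight \<beta> 0 (s - a))\<^sup>2)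
       = (NINT a. (weight (E * \<beta> / 2) \<kappa> (s - a))\<^sup>2 * (weight \<beta> 0 (s - (s - a)))\<^sup>2)"
      by (rule NINT_reflect[symmetric]) measurable
    also have "\<dots> = (NINT a. weight (2 * \<beta>) (2 * 0) a * weight (2 * (E * \<beta> / 2)) (2 * \<kappa>) ((\<tau>, \<xi>) - a))"
      unfolding weight_power2 s by (simp add: mult.commute)
    also have "\<dots> \<le> C * ?A"
      unfolding weight_pair_integral
    proof (rule r)
      fix \<sigma> :: real
      let ?f = "\<lambda>x. ennreal (\<langle>?Q \<sigma> x\<rangle> powr (- (E * \<beta>)) * \<langle>x\<rangle> powr (- ((DIM('b) - E) * (1 + \<epsilon>))))"
      have h: "norm (\<xi> - x - \<xi> /\<^sub>R 2) = norm (x - \<xi> /\<^sub>R 2)" for x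
      proof -
        have "\<xi> - x - \<eta> = - (x - \<eta>)" if "\<eta> + \<eta> = \<xi>" for \<eta>
          unfolding that[symmetric] by simp
        from this[of "\<xi> /\<^sub>R 2"] have "\<xi> - x - \<xi> /\<^sub>R 2 = - (x - \<xi> /\<^sub>R 2)"
          by (simp flip: scaleR_add_left)
        then show ?thesis by (simp only: norm_minus_cancel)
      qed
      have "(NINT x. ennreal (\<langle>?Q \<sigma> x\<rangle> powr (- (2 * (E * \<beta> / 2)))
        * (\<langle>x\<rangle> powr (- (2 * 0)) * \<langle>\<xi> - x\<rangle> powr (- (2 * \<kappa>))))) = (NINT x. ?f (\<xi> - x))"
        unfolding h by (simp add: 2)
      also have "\<dots> = (NINT x. ?f x)" by (rule NINT_reflect[of ?f]) measurable
      also have "\<dots> \<le> C" by (rule C(2))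
      finally show "(NINT x. ennreal (\<langle>?Q \<sigma> x\<rangle> powr (- (2 * (E * \<beta> / 2)))
        * (\<langle>x\<rangle> powr (- (2 * 0)) * \<langle>\<xi> - x\<rangle> powr (- (2 * \<kappa>))))) \<le> C" .
    qed
    finally show "(NINT a. (weight (E * \<beta> / 2) \<kappa> a)\<^sup>2 * (weight \<beta> 0 (s - a))\<^sup>2) \<le> C * ?A" .
  qed
qed

text \<open>Two of the three modulations become independent variables with integrable powers. In
  terms of them the third is a sum of three paraboloids plus a constant, and the bound for that is
  uniform in the constant.\<close>

lemma weight_triple_bound:
  fixes \<beta> \<epsilon> :: real
  assumes "0 < \<epsilon>" "1 / 2 < \<beta>"
    and \<kappa>: "\<kappa> = (DIM('b::euclidean_space) - 1) * (1 + \<epsilon>) / 2"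
  obtains C where "C < \<infinity>"
    "\<And>s :: real \<times> 'b. (NINT a. NINT b. (weight \<beta> \<kappa> a)\<^sup>2 * (weight \<beta> \<kappa> b)\<^sup>2 * (weight \<beta> 0 (s - a - b))\<^sup>2) \<le> C"
proof -
  obtain C where C: "C < \<infinity>"
    "\<And>T c. (NINT x. NINT y. ennreal (\<langle>T + (norm x)\<^sup>2 + (norm y)\<^sup>2 + (norm (c - x - y :: 'b))\<^sup>2\<rangle> powr (- (2 * \<beta>))
        * (\<langle>x\<rangle> powr (- ((DIM('b) - 1) * (1 + \<epsilon>))) * \<langle>y\<rangle> powr (- ((DIM('b) - 1) * (1 + \<epsilon>)))))) \<le> C"
    using three_paraboloids_weight_bound[OF assms(1-2)] by blast
  let ?j = "\<lambda>\<sigma>::real. ennreal (\<langle>\<sigma>\<rangle> powr (- (2 * \<beta>)))"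
  let ?A = "NINT \<sigma>. ?j \<sigma>"
  have 2: "2 * \<kappa> = (DIM('b) - 1) * (1 + \<epsilon>)" using \<kappa> by simp
  show ?thesis
  proof
    show "?A * ?A * C < \<infinity>" using C japanese_powr_integrable[of "2 * \<beta>"] assms by (auto simp: ennreal_mult_less_top)
    fix s :: "real \<times> 'b"
    obtain \<tau> \<xi> where s: "s = (\<tau>, \<xi>)" by (cases s)
    let ?G = "\<lambda>t x u y. weight (2 * \<beta>) (2 * \<kappa>) (t, x) * weight (2 * \<beta>) (2 * \<kappa>) (u, y) * weight (2 * \<beta>) 0 (\<tau> - t - u, \<xi> - x - y)"
    have "(NINT a. NINT b. (weight \<beta> \<kappa> a)\<^sup>2 * (weight \<beta> \<kappa> b)\<^sup>2 * (weight \<beta> 0 (s - a - b))\<^sup>2)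
      = (NINT t. NINT x. NINT u. NINT y. ?G t x u y)"
      unfolding weight_power2 s by (simp add: NINT_pair)
    also have "\<dots> = (NINT x. NINT t. NINT u. NINT y. ?G t x u y)"
      by (rule NINT_swap) measurable
    also have "\<dots> = (NINT x. NINT y. NINT t. NINT u. ?G t x u y)"
      by (rule nn_integral_cong, rule NINT_swap3) measurable
    also have "\<dots> = (NINT x. NINT y. NINT t. NINT u. ?G t x (- (norm y)\<^sup>2 + u) y)"
      by (rule nn_integral_cong, rule nn_integral_cong, rule nn_integral_cong, rule NINT_shift[symmetric]) measurable
    also have "\<dots> = (NINT x. NINT y. NINT t. NINT u. ?G (- (norm x)\<^sup>2 + t) x (- (norm y)\<^sup>2 + u) y)"
      by (rule nn_integral_cong, rule nn_integral_cong, rule NINT_shift[symmetric]) measurable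
    also have "\<dots> = (NINT t. NINT x. NINT y. NINT u. ?G (- (norm x)\<^sup>2 + t) x (- (norm y)\<^sup>2 + u) y)"
      by (rule NINT_swap3) measurable
    also have "\<dots> = (NINT t. NINT u. NINT x. NINT y. ?G (- (norm x)\<^sup>2 + t) x (- (norm y)\<^sup>2 + u) y)"
      by (rule nn_integral_cong, rule NINT_swap3) measurable
    also have "\<dots> \<le> (NINT t. NINT u. ?j t * ?j u * C)"
    proof (rule nn_integral_mono, rule nn_integral_mono)
      fix t u :: real
      let ?F = "\<lambda>x y. ennreal (\<langle>(\<tau> - t - u) + (norm x)\<^sup>2 + (norm y)\<^sup>2 + (norm (\<xi> - x - y))\<^sup>2\<rangle> powr (- (2 * \<beta>))
        * (\<langle>x\<rangle> powr (- ((DIM('b) - 1) * (1 + \<epsilon>))) * \<langle>y\<rangle> powr (- ((DIM('b) - 1) * (1 + \<epsilon>)))))"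
      have "?G (- (norm x)\<^sup>2 + t) x (- (norm y)\<^sup>2 + u) y = ?j t * ?j u * ?F x y" for x y
      proof -
        have e: "\<tau> - (- (norm x)\<^sup>2 + t) - (- (norm y)\<^sup>2 + u) + (norm (\<xi> - x - y))\<^sup>2 = (\<tau> - t - u) + (norm x)\<^sup>2 + (norm y)\<^sup>2 + (norm (\<xi> - x - y))\<^sup>2"
          by simp
        show ?thesis unfolding weight_def fst_conv snd_conv e 2 by (simp add: ennreal_mult[symmetric] ac_simps)
      qed
      then have "(NINT x. NINT y. ?G (- (norm x)\<^sup>2 + t) x (- (norm y)\<^sup>2 + u) y)
        = ?j t * ?j u * (NINT x. NINT y. ?F x y)"
        by (simp add: nn_integral_cmult)
      also have "\<dots> \<le> ?j t * ?j u * C" by (intro mult_left_mono C(2)) auto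
      finally show "(NINT x. NINT y. ?G (- (norm x)\<^sup>2 + t) x (- (norm y)\<^sup>2 + u) y) \<le> ?j t * ?j u * C" .
    qed
    also have "\<dots> = ?A * ?A * C" by (simp add: nn_integral_cmult nn_integral_multc)
    finally show "(NINT a. NINT b. (weight \<beta> \<kappa> a)\<^sup>2 * (weight \<beta> \<kappa> b)\<^sup>2 * (weight \<beta> 0 (s - a - b))\<^sup>2) \<le> ?A * ?A * C" .
  qed
qed

section \<open>Boundedness of weighted forms\<close>

definition L2_le :: "('z::euclidean_space \<Rightarrow> ennreal) \<Rightarrow> real \<Rightarrow> bool" where
  "L2_le f n \<longleftrightarrow> f \<in> borel_measurable borel \<and> 0 \<le> n \<and> energy f \<le> ennreal (n\<^sup>2)"

definition L2_bounded_by ::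
  "real \<Rightarrow> ('z::euclidean_space \<Rightarrow> ennreal) \<Rightarrow> ('z \<Rightarrow> ennreal) \<Rightarrow> ('z \<Rightarrow> ennreal) \<Rightarrow> ('z \<Rightarrow> ennreal) \<Rightarrow> bool" where
  "L2_bounded_by C w0 w1 w2 w3 \<longleftrightarrow> (\<forall>f0 f1 f2 f3 n0 n1 n2 n3.
     L2_le f0 n0 \<longrightarrow> L2_le f1 n1 \<longrightarrow> L2_le f2 n2 \<longrightarrow> L2_le f3 n3 \<longrightarrow>
     weighted_form f0 w0 f1 w1 f2 w2 f3 w3
       \<le> ennreal (C * (n0 * n1 * n2 * n3)))"

definition L2_bounded ::
  "('z::euclidean_space \<Rightarrow> ennreal) \<Rightarrow> ('z \<Rightarrow> ennreal) \<Rightarrow> ('z \<Rightarrow> ennreal) \<Rightarrow> ('z \<Rightarrow> ennreal) \<Rightarrow> bool" where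
  "L2_bounded w0 w1 w2 w3 \<longleftrightarrow> (\<exists>C\<ge>0. L2_bounded_by C w0 w1 w2 w3)"

lemma L2_le_measurable: "L2_le f n \<Longrightarrow> f \<in> borel_measurable borel"
  by (simp add: L2_le_def)

lemma L2_le_nonneg: "L2_le f n \<Longrightarrow> 0 \<le> n"
  by (simp add: L2_le_def)

lemma ennreal_le_of_power2_le:
  fixes x :: ennreal
  assumes "x\<^sup>2 \<le> ennreal (r\<^sup>2)" "0 \<le> r"
  shows "x \<le> ennreal r"
proof (cases x)
  case (real u)
  then have "ennreal (u\<^sup>2) \<le> ennreal (r\<^sup>2)" using assms by (simp add: ennreal_power)
  then have "u\<^sup>2 \<le> r\<^sup>2" by (simp add: ennreal_le_iff)
  then show ?thesis using real assms by (auto intro: power2_le_imp_le ennreal_leI)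
next
  case top
  then show ?thesis using assms by (simp add: top_unique)
qed

lemma L2_boundedI_power2:
  assumes "C < \<infinity>"
    and "\<And>f0 f1 f2 f3. borel_fun f0 \<Longrightarrow> borel_fun f1 \<Longrightarrow>
     borel_fun f2 \<Longrightarrow> borel_fun f3 \<Longrightarrow>
     (weighted_form f0 w0 f1 w1 f2 w2 f3 w3)\<^sup>2
       \<le> C * (energy f0 * energy f1 * energy f2 * energy f3)"
  shows "L2_bounded w0 w1 w2 w3"
proof -
  obtain c where c: "C = ennreal c" "0 \<le> c" using assms(1) by (cases C) auto
  have "L2_bounded_by (sqrt c) w0 w1 w2 w3"
    unfolding L2_bounded_by_def
  proof (intro allI impI)
    fix f0 f1 f2 f3 :: "'a \<Rightarrow> ennreal" and n0 n1 n2 n3 :: real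
    assume f: "L2_le f0 n0" "L2_le f1 n1" "L2_le f2 n2" "L2_le f3 n3"
    have "(weighted_form f0 w0 f1 w1 f2 w2 f3 w3)\<^sup>2
      \<le> ennreal c * (ennreal (n0\<^sup>2) * ennreal (n1\<^sup>2) * ennreal (n2\<^sup>2) * ennreal (n3\<^sup>2))"
      unfolding c(1)[symmetric]
      by (rule order_trans[OF assms(2)]) (use f in \<open>auto simp: L2_le_def intro!: mult_mono\<close>)
    also have "\<dots> = ennreal ((sqrt c * (n0 * n1 * n2 * n3))\<^sup>2)"
      using c by (simp add: ennreal_mult[symmetric] power_mult_distrib)
    finally show "weighted_form f0 w0 f1 w1 f2 w2 f3 w3
       \<le> ennreal (sqrt c * (n0 * n1 * n2 * n3))"
      by (rule ennreal_le_of_power2_le) (use c f[THEN L2_le_nonneg] in auto)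
  qed
  then show ?thesis unfolding L2_bounded_def using c by (intro exI[of _ "sqrt c"]) auto
qed

text \<open>Besides moving frequency weights between the slots, this gives access to the pairing {1,
  2}, {0, 3} in addition to {0, 1}, {2, 3}.\<close>

lemma L2_bounded_swap_02:
  assumes [measurable]: "borel_fun w0" "borel_fun w1"
    "borel_fun w2" "borel_fun w3"
    and "L2_bounded w0 w1 w2 w3"
  shows "L2_bounded w2 w1 w0 w3"
proof -
  obtain C where C: "0 \<le> C" "L2_bounded_by C w0 w1 w2 w3" using assms(5) by (auto simp: L2_bounded_def)
  have "L2_bounded_by C w2 w1 w0 w3"
    unfolding L2_bounded_by_def
  proof (intro allI impI)
    fix f0 f1 f2 f3 :: "'a \<Rightarrow> ennreal" and n0 n1 n2 n3 :: real
    assume f: "L2_le f0 n0" "L2_le f1 n1" "L2_le f2 n2" "L2_le f3 n3"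
    note [measurable] = f[THEN L2_le_measurable]
    have "weighted_form f0 w2 f1 w1 f2 w0 f3 w3
      = weighted_form f2 w0 f1 w1 f0 w2 f3 w3"
      by (rule quad_form_swap_02) measurable
    also have "\<dots> \<le> ennreal (C * (n2 * n1 * n0 * n3))"
      using C(2) f unfolding L2_bounded_by_def by blast
    finally show "weighted_form f0 w2 f1 w1 f2 w0 f3 w3
       \<le> ennreal (C * (n0 * n1 * n2 * n3))" by (simp add: ac_simps)
  qed
  then show ?thesis unfolding L2_bounded_def using C(1) by blast
qed

lemma L2_bounded_swap_23:
  assumes [measurable]: "borel_fun w0" "borel_fun w1"
    "borel_fun w2" "borel_fun w3"
    and "L2_bounded w0 w1 w2 w3"
  shows "L2_bounded w0 w1 w3 w2"
proof -
  obtain C where C: "0 \<le> C" "L2_bounded_by C w0 w1 w2 w3" using assms(5) by (auto simp: L2_bounded_def)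
  have "L2_bounded_by C w0 w1 w3 w2"
    unfolding L2_bounded_by_def
  proof (intro allI impI)
    fix f0 f1 f2 f3 :: "'a \<Rightarrow> ennreal" and n0 n1 n2 n3 :: real
    assume f: "L2_le f0 n0" "L2_le f1 n1" "L2_le f2 n2" "L2_le f3 n3"
    note [measurable] = f[THEN L2_le_measurable]
    have "weighted_form f0 w0 f1 w1 f2 w3 f3 w2
      = weighted_form f0 w0 f1 w1 f3 w2 f2 w3"
      by (rule quad_form_swap_23) measurable
    also have "\<dots> \<le> ennreal (C * (n0 * n1 * n3 * n2))"
      using C(2) f unfolding L2_bounded_by_def by blast
    finally show "weighted_form f0 w0 f1 w1 f2 w3 f3 w2
       \<le> ennreal (C * (n0 * n1 * n2 * n3))" by (simp add: ac_simps)
  qed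
  then show ?thesis unfolding L2_bounded_def using C(1) by blast
qed

text \<open>The weights are compared only at points whose fourth argument is a + b + c, so that the
  linear relation between the four frequencies can be exploited in \<open>dom\<close>.\<close>

lemma L2_bounded_dominated:
  fixes v0 v1 v2 v3 :: "'j \<Rightarrow> 'a::euclidean_space \<Rightarrow> ennreal"
  assumes J: "finite J" "0 \<le> K"
    and v[measurable]: "\<And>j. j \<in> J \<Longrightarrow> v0 j \<in> borel_measurable borel" "\<And>j. j \<in> J \<Longrightarrow> v1 j \<in> borel_measurable borel"
      "\<And>j. j \<in> J \<Longrightarrow> v2 j \<in> borel_measurable borel" "\<And>j. j \<in> J \<Longrightarrow> v3 j \<in> borel_measurable borel"
    and bdd: "\<And>j. j \<in> J \<Longrightarrow> L2_bounded (v0 j) (v1 j) (v2 j) (v3 j)"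
    and dom: "\<And>a b c. w0 a * w2 b * w3 c * w1 (a + b + c)
      \<le> ennreal K * (\<Sum>j\<in>J. v0 j a * v2 j b * v3 j c * v1 j (a + b + c))"
  shows "L2_bounded w0 w1 w2 w3"
proof -
  have "\<exists>C. \<forall>j\<in>J. 0 \<le> C j \<and> L2_bounded_by (C j) (v0 j) (v1 j) (v2 j) (v3 j)"
    using bdd unfolding L2_bounded_def by (intro bchoice) blast
  then obtain C where C: "\<And>j. j \<in> J \<Longrightarrow> 0 \<le> C j"
    "\<And>j. j \<in> J \<Longrightarrow> L2_bounded_by (C j) (v0 j) (v1 j) (v2 j) (v3 j)" by blast
  have "L2_bounded_by (K * (\<Sum>j\<in>J. C j)) w0 w1 w2 w3"
    unfolding L2_bounded_by_def
  proof (intro allI impI)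
    fix f0 f1 f2 f3 :: "'a \<Rightarrow> ennreal" and n0 n1 n2 n3 :: real
    assume f: "L2_le f0 n0" "L2_le f1 n1" "L2_le f2 n2" "L2_le f3 n3"
    note [measurable] = f[THEN L2_le_measurable]
    note n = f[THEN L2_le_nonneg]
    let ?V = "\<lambda>j a b c. f0 a * v0 j a * (f2 b * v2 j b) * (f3 c * v3 j c) * (f1 (a + b + c) * v1 j (a + b + c))"
    have "weighted_form f0 w0 f1 w1 f2 w2 f3 w3
      \<le> (NINT a. NINT b. NINT c. ennreal K * (\<Sum>j\<in>J. ?V j a b c))"
      unfolding quad_form_def
    proof (rule nn_integral_mono, rule nn_integral_mono, rule nn_integral_mono)
      fix a b c :: 'a
      have "f0 a * w0 a * (f2 b * w2 b) * (f3 c * w3 c) * (f1 (a + b + c) * w1 (a + b + c))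
        = (f0 a * f2 b * f3 c * f1 (a + b + c)) * (w0 a * w2 b * w3 c * w1 (a + b + c))" by (simp only: ac_simps)
      also have "\<dots> \<le> (f0 a * f2 b * f3 c * f1 (a + b + c)) * (ennreal K * (\<Sum>j\<in>J. v0 j a * v2 j b * v3 j c * v1 j (a + b + c)))"
        by (rule mult_left_mono[OF dom]) simp
      also have "\<dots> = ennreal K * (\<Sum>j\<in>J. ?V j a b c)" unfolding sum_distrib_left by (simp only: ac_simps)
      finally show "f0 a * w0 a * (f2 b * w2 b) * (f3 c * w3 c) * (f1 (a + b + c) * w1 (a + b + c))
        \<le> ennreal K * (\<Sum>j\<in>J. ?V j a b c)" .
    qed
    also have "\<dots> = ennreal K * (\<Sum>j\<in>J. weighted_form f0 (v0 j) f1 (v1 j) f2 (v2 j) f3 (v3 j))"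
      unfolding quad_form_def by (simp add: nn_integral_cmult nn_integral_sum)
    also have "\<dots> \<le> ennreal K * (\<Sum>j\<in>J. ennreal (C j * (n0 * n1 * n2 * n3)))"
      by (intro mult_left_mono sum_mono) (use C(2) f in \<open>auto simp: L2_bounded_by_def\<close>)
    also have "\<dots> = ennreal (K * (\<Sum>j\<in>J. C j) * (n0 * n1 * n2 * n3))"
    proof -
      have "(\<Sum>j\<in>J. ennreal (C j * (n0 * n1 * n2 * n3))) = ennreal ((\<Sum>j\<in>J. C j) * (n0 * n1 * n2 * n3))"
        using C(1) n by (subst sum_ennreal) (auto simp: sum_distrib_right)
      then show ?thesis using C(1) J n by (simp add: ennreal_mult[symmetric] sum_nonneg mult.assoc)
    qed
    finally show "weighted_form f0 w0 f1 w1 f2 w2 f3 w3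
      \<le> ennreal (K * (\<Sum>j\<in>J. C j) * (n0 * n1 * n2 * n3))" .
  qed
  then show ?thesis unfolding L2_bounded_def using C(1) J
    by (intro exI[of _ "K * (\<Sum>j\<in>J. C j)"]) (auto intro!: mult_nonneg_nonneg sum_nonneg)
qed

text \<open>Slots 0 and 1 form one pair, 2 and 3 the other. The frequency weight sits once in each
  pair, and in each pair either member may carry the full exponent \<beta>.\<close>

lemma L2_bounded_pair_weights:
  fixes E \<beta> \<epsilon> :: real
  assumes E: "0 \<le> E" "E \<le> 2" "E \<le> DIM('b::euclidean_space)" and "0 < \<epsilon>" "1 / 2 < \<beta>"
    and \<kappa>: "\<kappa> = (DIM('b) - E) * (1 + \<epsilon>) / 2"
    and e: "(e0 = \<beta> \<and> e1 = E * \<beta> / 2) \<or> (e0 = E * \<beta> / 2 \<and> e1 = \<beta>)"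
      "(e2 = \<beta> \<and> e3 = E * \<beta> / 2) \<or> (e2 = E * \<beta> / 2 \<and> e3 = \<beta>)"
  shows "L2_bounded (weight e0 \<kappa> :: real \<times> 'b \<Rightarrow> ennreal) (weight e1 0) (weight e2 \<kappa>) (weight e3 0)"
proof -
  obtain C where C: "C < \<infinity>"
    "\<And>s :: real \<times> 'b. (NINT a. (weight \<beta> \<kappa> a)\<^sup>2 * (weight (E * \<beta> / 2) 0 (s - a))\<^sup>2) \<le> C"
    "\<And>s :: real \<times> 'b. (NINT a. (weight (E * \<beta> / 2) \<kappa> a)\<^sup>2 * (weight \<beta> 0 (s - a))\<^sup>2) \<le> C"
    using weight_pair_bound[OF assms(1-6)] by blast
  have c: "(NINT a. (weight e0 \<kappa> a)\<^sup>2 * (weight e1 0 (s - a))\<^sup>2) \<le> C"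
    "(NINT a. (weight e2 \<kappa> a)\<^sup>2 * (weight e3 0 (s - a))\<^sup>2) \<le> C" for s :: "real \<times> 'b"
    using e by (elim disjE conjE; simp only: C(2,3))+
  show ?thesis
    by (rule L2_boundedI_power2[of "C\<^sup>2"])
      (use C(1) in \<open>auto simp: power_less_top_ennreal intro!: quad_form_pair_bound c\<close>)
qed

lemma L2_bounded_triple_weights:
  fixes \<beta> \<epsilon> :: real
  assumes "0 < \<epsilon>" "1 / 2 < \<beta>"
    and \<kappa>: "\<kappa> = (DIM('b::euclidean_space) - 1) * (1 + \<epsilon>) / 2"
  shows "L2_bounded (weight \<beta> \<kappa> :: real \<times> 'b \<Rightarrow> ennreal) (\<lambda>_. 1) (weight \<beta> \<kappa>) (weight \<beta> 0)"
proof -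
  obtain C where C: "C < \<infinity>"
    "\<And>s :: real \<times> 'b. (NINT a. NINT b. (weight \<beta> \<kappa> a)\<^sup>2 * (weight \<beta> \<kappa> b)\<^sup>2 * (weight \<beta> 0 (s - a - b))\<^sup>2) \<le> C"
    using weight_triple_bound[OF assms] by blast
  show ?thesis
    by (rule L2_boundedI_power2[OF C(1)]) (auto intro!: quad_form_triple_bound C(2))
qed

section \<open>Comparison of exponents\<close>

lemma weight_0_0 [simp]: "weight 0 0 = (\<lambda>_. 1)"
  by (auto simp: weight_def)

lemma weight_eq_exp:
  "weight e \<kappa> z = ennreal (exp (- (e * ln \<langle>fst z + (norm (snd z))\<^sup>2\<rangle> + \<kappa> * ln \<langle>snd z\<rangle>)))"
  by (simp add: weight_def powr_def exp_add[symmetric])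

text \<open>\<open>L\<close> is a combination of the six pair sums: coefficient A1 / 3 for each pair
  containing x1 and (A - A1 / 3) / 2 for each of the others. The coefficients are nonnegative and
  add up to (A1 + 3 A) / 2, which is at least B, so L is at least B times the least pair sum
  \<mu>.\<close>

lemma min_pair_le:
  fixes x0 x1 x2 x3 A A1 B :: real
  assumes x: "0 \<le> x0" "0 \<le> x1" "0 \<le> x2" "0 \<le> x3"
    and A: "0 \<le> A1" "A1 \<le> B" "2 * B \<le> A1 + 3 * A"
  defines "L \<equiv> A1 * x1 + A * (x0 + x2 + x3)"
  shows "B * (x0 + x1) \<le> L \<or> B * (x0 + x2) \<le> L \<or> B * (x0 + x3) \<le> L \<or>
    B * (x1 + x2) \<le> L \<or> B * (x1 + x3) \<le> L \<or> B * (x2 + x3) \<le> L"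
proof -
  define \<mu> where "\<mu> = Min {x0 + x1, x0 + x2, x0 + x3, x1 + x2, x1 + x3, x2 + x3}"
  have mem: "\<mu> \<in> {x0 + x1, x0 + x2, x0 + x3, x1 + x2, x1 + x3, x2 + x3}"
    unfolding \<mu>_def by (rule Min_in) auto
  have le: "\<mu> \<le> x0 + x1" "\<mu> \<le> x0 + x2" "\<mu> \<le> x0 + x3" "\<mu> \<le> x1 + x2" "\<mu> \<le> x1 + x3" "\<mu> \<le> x2 + x3"
    unfolding \<mu>_def by (auto intro: Min_le)
  have \<mu>: "0 \<le> \<mu>" using mem x by auto
  have "B * \<mu> \<le> ((A1 + 3 * A) / 2) * \<mu>" using A \<mu> by (intro mult_right_mono) auto
  also have "\<dots> = A1 / 3 * (3 * \<mu>) + (A - A1 / 3) * (3 / 2 * \<mu>)" by (simp add: field_simps)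
  also have "\<dots> \<le> A1 / 3 * (3 * x1 + (x0 + x2 + x3)) + (A - A1 / 3) * (x0 + x2 + x3)"
    using A le by (intro add_mono mult_left_mono) auto
  also have "\<dots> = L" by (simp add: L_def field_simps)
  finally show ?thesis using mem by auto
qed

text \<open>The convex combination behind the exceptional case, in which the exponent \<open>\<alpha>1\<close> is too
  small for the pair weights: \<open>p\<close> is the share of the triple weight.\<close>

lemma min_pair_or_triple_le:
  fixes x0 x1 x2 x3 y \<alpha> \<alpha>1 p h k \<kappa> \<kappa>' :: real
  assumes p: "0 \<le> p" "p \<le> 1" and h: "(1 - p) * h = \<alpha>1"
    and \<alpha>: "2 + p + \<alpha>1 \<le> 3 * \<alpha>" and k: "(1 - p) * \<kappa> + p * \<kappa>' \<le> k"
    and x: "0 \<le> x0" "0 \<le> x1" "0 \<le> x2" "0 \<le> x3" "0 \<le> y"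
  defines "L \<equiv> \<alpha>1 * x1 + \<alpha> * (x0 + x2 + x3) + k * y"
  shows "x0 + x2 + h * (x1 + x3) + \<kappa> * y \<le> L \<or> x0 + x3 + h * (x1 + x2) + \<kappa> * y \<le> L \<or>
    x2 + x3 + h * (x0 + x1) + \<kappa> * y \<le> L \<or> x0 + x2 + x3 + \<kappa>' * y \<le> L"
proof (rule ccontr)
  assume "\<not> ?thesis"
  then have lt: "L < x0 + x2 + h * (x1 + x3) + \<kappa> * y" "L < x0 + x3 + h * (x1 + x2) + \<kappa> * y"
    "L < x2 + x3 + h * (x0 + x1) + \<kappa> * y" "L < x0 + x2 + x3 + \<kappa>' * y" by auto
  define S where "S = x0 + x2 + x3"
  \<comment> \<open>The sum of the three pair inequalities: each of x0, x2, x3 has coefficient 1 in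
    two of them and h in the third, while x1 always has h.\<close>
  have "3 * L < 2 * S + 3 * h * x1 + h * S + 3 * \<kappa> * y" using lt by (simp add: S_def algebra_simps)
  moreover have "L < S + \<kappa>' * y" using lt by (simp add: S_def)
  \<comment> \<open>The triple inequality enters with weight 3 p to match a sum of three. For p = 1
    the strictness comes from it alone, otherwise from the pairs.\<close>
  ultimately have "(1 - p) * (3 * L) + 3 * (p * L) < (1 - p) * (2 * S + 3 * h * x1 + h * S + 3 * \<kappa> * y) + 3 * (p * (S + \<kappa>' * y))"
    using p by (cases "p = 1") (auto intro!: add_less_le_mono mult_left_mono mult_strict_left_mono)
  also have "\<dots> = (2 + p) * S + 3 * ((1 - p) * h) * x1 + ((1 - p) * h) * S + 3 * (((1 - p) * \<kappa> + p * \<kappa>') * y)"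
    by (simp add: algebra_simps)
  also have "\<dots> = (2 + p + \<alpha>1) * S + 3 * \<alpha>1 * x1 + 3 * (((1 - p) * \<kappa> + p * \<kappa>') * y)"
    unfolding h by (simp add: algebra_simps)
  also have "\<dots> \<le> 3 * \<alpha> * S + 3 * \<alpha>1 * x1 + 3 * (k * y)"
    using \<alpha> k x by (intro add_mono mult_right_mono mult_left_mono) (auto simp: S_def)
  also have "\<dots> = (1 - p) * (3 * L) + 3 * (p * L)" by (simp add: L_def S_def algebra_simps)
  finally show False by simp
qed

text \<open>In the logarithms of the brackets a product of weights is the exponential of minus a
  linear form, so domination becomes linear programming: at every nonnegative point the given form
  must lie above one of finitely many forms. The variable y is the sum of the frequency logarithms
  of slots 0 and 2, which share their exponent.\<close>

lemma L2_bounded_weights_dominated: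
  fixes J :: "(real \<times> real \<times> real \<times> real \<times> real) set"
  assumes J: "finite J"
    and bdd: "\<And>e0 e1 e2 e3 \<kappa>. (e0, e1, e2, e3, \<kappa>) \<in> J \<Longrightarrow>
      L2_bounded (weight e0 \<kappa> :: real \<times> 'b::euclidean_space \<Rightarrow> ennreal) (weight e1 0) (weight e2 \<kappa>) (weight e3 0)"
    and dom: "\<And>x0 x1 x2 x3 y. 0 \<le> x0 \<Longrightarrow> 0 \<le> x1 \<Longrightarrow> 0 \<le> x2 \<Longrightarrow> 0 \<le> x3 \<Longrightarrow> 0 \<le> y \<Longrightarrow>
      \<exists>(e0, e1, e2, e3, \<kappa>)\<in>J. e0 * x0 + e1 * x1 + e2 * x2 + e3 * x3 + \<kappa> * y
        \<le> a0 * x0 + a1 * x1 + a2 * x2 + a3 * x3 + k * y"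
  shows "L2_bounded (weight a0 k :: real \<times> 'b \<Rightarrow> ennreal) (weight a1 0) (weight a2 k) (weight a3 0)"
proof (rule L2_bounded_dominated[where K=1 and J=J
      and ?v0.0="\<lambda>(e0, e1, e2, e3, \<kappa>). weight e0 \<kappa>" and ?v1.0="\<lambda>(e0, e1, e2, e3, \<kappa>). weight e1 0"
      and ?v2.0="\<lambda>(e0, e1, e2, e3, \<kappa>). weight e2 \<kappa>" and ?v3.0="\<lambda>(e0, e1, e2, e3, \<kappa>). weight e3 0"])
  fix a b c :: "real \<times> 'b"
  let ?v0 = "\<lambda>(e0, e1, e2, e3, \<kappa>). weight e0 \<kappa>" and ?v1 = "\<lambda>(e0, e1, e2, e3, \<kappa>). weight e1 0"
    and ?v2 = "\<lambda>(e0, e1, e2, e3, \<kappa>). weight e2 \<kappa>" and ?v3 = "\<lambda>(e0, e1, e2, e3, \<kappa>). weight e3 0"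
  define x where "x z = ln \<langle>fst z + (norm (snd z))\<^sup>2\<rangle>" for z :: "real \<times> 'b"
  define y where "y z = ln \<langle>snd z\<rangle>" for z :: "real \<times> 'b"
  have x: "0 \<le> x z" and y: "0 \<le> y z" for z by (auto simp: x_def y_def japanese_ge_1)
  have w: "weight e0 \<kappa> a * weight e2 \<kappa> b * weight e3 0 c * weight e1 0 (a + b + c)
    = ennreal (exp (- (e0 * x a + e1 * x (a + b + c) + e2 * x b + e3 * x c + \<kappa> * (y a + y b))))" for e0 e1 e2 e3 \<kappa>
    unfolding weight_eq_exp x_def[symmetric] y_def[symmetric]
    by (simp add: ennreal_mult[symmetric] exp_add[symmetric] algebra_simps)
  obtain e0 e1 e2 e3 \<kappa> where j: "(e0, e1, e2, e3, \<kappa>) \<in> J"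
    "e0 * x a + e1 * x (a + b + c) + e2 * x b + e3 * x c + \<kappa> * (y a + y b)
      \<le> a0 * x a + a1 * x (a + b + c) + a2 * x b + a3 * x c + k * (y a + y b)"
    using dom[of "x a" "x (a + b + c)" "x b" "x c" "y a + y b"] x y by (auto simp: add_nonneg_nonneg)
  have "weight a0 k a * weight a2 k b * weight a3 0 c * weight a1 0 (a + b + c)
      \<le> weight e0 \<kappa> a * weight e2 \<kappa> b * weight e3 0 c * weight e1 0 (a + b + c)"
    unfolding w using j(2) by (intro ennreal_leI) simp
  also have "\<dots> \<le> (\<Sum>j\<in>J. ?v0 j a * ?v2 j b
      * ?v3 j c * ?v1 j (a + b + c))"
    using member_le_sum[OF j(1), of "\<lambda>j. ?v0 j a * ?v2 j b
      * ?v3 j c * ?v1 j (a + b + c)"] J by simp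
  finally show "weight a0 k a * weight a2 k b * weight a3 0 c * weight a1 0 (a + b + c)
    \<le> ennreal 1 * (\<Sum>j\<in>J. ?v0 j a * ?v2 j b
      * ?v3 j c * ?v1 j (a + b + c))"
    by simp
qed (use J bdd in \<open>auto split: prod.splits\<close>)

text \<open>In units of \<beta>, an extremal pair weight has exponent 1 in two slots and E / 2 in
  the other two, in total 2 + E. If slot 1 can afford E / 2, subtracting this from all exponents
  leaves exactly the situation of \<open>min_pair_le\<close>. Otherwise a share p of the triple
  weight, with exponent 0 in slot 1, is mixed in.\<close>

lemma L2_bounded_weights:
  fixes \<alpha> \<alpha>1 \<beta> \<epsilon> E k :: real
  assumes \<beta>: "1 / 2 < \<beta>" and \<epsilon>: "0 < \<epsilon>"
    and \<alpha>: "0 < \<alpha>1" "\<alpha>1 < 1" "\<alpha> < 1" "2 + E \<le> \<alpha>1 + 3 * \<alpha>"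
    and E: "0 \<le> E" "E \<le> DIM('b::euclidean_space)" and k: "(DIM('b) - E) * (1 + \<epsilon>) / 2 \<le> k"
  shows "L2_bounded (weight (\<alpha> * \<beta>) k :: real \<times> 'b \<Rightarrow> ennreal) (weight (\<alpha>1 * \<beta>) 0) (weight (\<alpha> * \<beta>) k) (weight (\<alpha> * \<beta>) 0)"
proof (cases "E / 2 \<le> \<alpha>1")
  case True
  define h where "h = E * \<beta> / 2"
  define \<kappa> where "\<kappa> = (DIM('b) - E) * (1 + \<epsilon>) / 2"
  have E2: "E \<le> 2" using \<alpha> by linarith
  note P = L2_bounded_pair_weights[OF E(1) E2 E(2) \<epsilon> \<beta> \<kappa>_def, folded h_def]
  let ?J = "{(\<beta>, \<beta>, h, h, \<kappa>), (\<beta>, h, \<beta>, h, \<kappa>), (\<beta>, h, h, \<beta>, \<kappa>), (h, \<beta>, \<beta>, h, \<kappa>), (h, \<beta>, h, \<beta>, \<kappa>), (h, h, \<beta>, \<beta>, \<kappa>)}"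
  show ?thesis
  proof (rule L2_bounded_weights_dominated[where J="?J"])
    \<comment> \<open>If slots 0 and 1, or 2 and 3, both carry \<beta>, the pairing {0, 1}, {2, 3}
      does not apply. Exchanging 0 and 2 pairs 1 with 2 and 0 with 3.\<close>
    have "L2_bounded (weight \<beta> \<kappa> :: real \<times> 'b \<Rightarrow> ennreal) (weight \<beta> 0) (weight h \<kappa>) (weight h 0)"
      by (rule L2_bounded_swap_02) (auto intro!: P)
    moreover have "L2_bounded (weight h \<kappa> :: real \<times> 'b \<Rightarrow> ennreal) (weight h 0) (weight \<beta> \<kappa>) (weight \<beta> 0)"
      by (rule L2_bounded_swap_02) (auto intro!: P)
    ultimately show "L2_bounded (weight e0 \<kappa>' :: real \<times> 'b \<Rightarrow> ennreal) (weight e1 0) (weight e2 \<kappa>') (weight e3 0)"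
      if "(e0, e1, e2, e3, \<kappa>') \<in> ?J" for e0 e1 e2 e3 \<kappa>'
      using that P by auto
    fix x0 x1 x2 x3 y :: real
    assume x: "0 \<le> x0" "0 \<le> x1" "0 \<le> x2" "0 \<le> x3" and y: "0 \<le> y"
    let ?L = "(\<alpha>1 - E / 2) * x1 + (\<alpha> - E / 2) * (x0 + x2 + x3)"
    have "\<kappa> * y \<le> k * y" using k y by (intro mult_right_mono) (auto simp: \<kappa>_def)
    then have pw: "\<beta> * (u + v) + h * (x0 + x1 + x2 + x3 - (u + v)) + \<kappa> * y \<le> \<alpha> * \<beta> * (x0 + x2 + x3) + \<alpha>1 * \<beta> * x1 + k * y"
      if "(1 - E / 2) * (u + v) \<le> ?L" for u v
    proof -
      have "\<beta> * ((1 - E / 2) * (u + v)) \<le> \<beta> * ?L"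
        using that \<beta> by (intro mult_left_mono) auto
      then have "\<beta> * (u + v) + h * (x0 + x1 + x2 + x3 - (u + v)) \<le> \<alpha> * \<beta> * (x0 + x2 + x3) + \<alpha>1 * \<beta> * x1"
        by (simp add: h_def algebra_simps add_divide_distrib)
      with \<open>\<kappa> * y \<le> k * y\<close> show ?thesis by (rule add_mono[rotated])
    qed
    have "(1 - E / 2) * (x0 + x1) \<le> ?L \<or> (1 - E / 2) * (x0 + x2) \<le> ?L \<or> (1 - E / 2) * (x0 + x3) \<le> ?L \<or>
      (1 - E / 2) * (x1 + x2) \<le> ?L \<or> (1 - E / 2) * (x1 + x3) \<le> ?L \<or> (1 - E / 2) * (x2 + x3) \<le> ?L"
      by (rule min_pair_le) (use x True \<alpha> in auto)
    then show "\<exists>(e0, e1, e2, e3, \<kappa>)\<in>?J. e0 * x0 + e1 * x1 + e2 * x2 + e3 * x3 + \<kappa> * y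
      \<le> \<alpha> * \<beta> * x0 + \<alpha>1 * \<beta> * x1 + \<alpha> * \<beta> * x2 + \<alpha> * \<beta> * x3 + k * y"
      by - (elim disjE; drule pw; simp add: algebra_simps)
  qed simp
next
  case False
  \<comment> \<open>p and \<open>E'\<close> solve two equations. First (1 - p) E' / 2 = \<alpha>1:
    the mixture uses exactly the exponent available in slot 1. Second (1 - p) E' + p = E: its
    frequency exponent is the one belonging to E, the triple weight counting as E = 1. Together they
    give p = E - 2 \<alpha>1.\<close>
  define p where "p = E - 2 * \<alpha>1"
  have p: "0 \<le> p" "p < 1" using False \<alpha> by (auto simp: p_def)
  define E' where "E' = 2 * \<alpha>1 / (1 - p)"
  have pE': "(1 - p) * E' = 2 * \<alpha>1" using p by (simp add: E'_def)
  define h where "h = E' * \<beta> / 2"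
  define \<kappa> \<kappa>X where "\<kappa> = (DIM('b) - E') * (1 + \<epsilon>) / 2" and "\<kappa>X = (DIM('b) - 1) * (1 + \<epsilon>) / 2"
  \<comment> \<open>E' <= 2 amounts to E <= 1 + \<alpha>1, which follows from 2 + E <= \<alpha>1 + 3
    \<alpha> and \<alpha> < 1.\<close>
  have E': "0 \<le> E'" "E' \<le> 2" using \<alpha> p by (auto simp: E'_def field_simps) (auto simp: p_def)
  have E'd: "E' \<le> DIM('b)"
  proof (cases "DIM('b) = 1")
    case True
    then have "2 * \<alpha>1 \<le> 1 - p" using E by (simp add: p_def)
    then show ?thesis using p True by (simp add: E'_def field_simps)
  next
    case False
    then have "2 \<le> DIM('b)" using DIM_positive[where 'a='b] by linarith
    then show ?thesis using E' by linarith
  qed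
  note P = L2_bounded_pair_weights[OF E' E'd \<epsilon> \<beta> \<kappa>_def, folded h_def]
  let ?J = "{(\<beta>, h, \<beta>, h, \<kappa>), (\<beta>, h, h, \<beta>, \<kappa>), (h, h, \<beta>, \<beta>, \<kappa>), (\<beta>, 0, \<beta>, \<beta>, \<kappa>X)}"
  show ?thesis
  proof (rule L2_bounded_weights_dominated[where J="?J"])
    have "L2_bounded (weight h \<kappa> :: real \<times> 'b \<Rightarrow> ennreal) (weight h 0) (weight \<beta> \<kappa>) (weight \<beta> 0)"
      by (rule L2_bounded_swap_02) (auto intro!: P)
    moreover have "L2_bounded (weight \<beta> \<kappa>X :: real \<times> 'b \<Rightarrow> ennreal) (weight 0 0) (weight \<beta> \<kappa>X) (weight \<beta> 0)"
      using L2_bounded_triple_weights[OF \<epsilon> \<beta> \<kappa>X_def] by simp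
    ultimately show "L2_bounded (weight e0 \<kappa>' :: real \<times> 'b \<Rightarrow> ennreal) (weight e1 0) (weight e2 \<kappa>') (weight e3 0)"
      if "(e0, e1, e2, e3, \<kappa>') \<in> ?J" for e0 e1 e2 e3 \<kappa>'
      using that P by auto
    fix x0 x1 x2 x3 y :: real
    assume x: "0 \<le> x0" "0 \<le> x1" "0 \<le> x2" "0 \<le> x3" and y: "0 \<le> y"
    have k': "(1 - p) * \<kappa> + p * \<kappa>X \<le> k"
    proof -
      have "(1 - p) * (DIM('b) - E') + p * (DIM('b) - 1) = DIM('b) - E"
        using pE' by (simp add: algebra_simps p_def)
      moreover have "(1 - p) * \<kappa> + p * \<kappa>X = ((1 - p) * (DIM('b) - E') + p * (DIM('b) - 1)) * (1 + \<epsilon>) / 2"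
        by (simp add: \<kappa>_def \<kappa>X_def field_simps)
      ultimately show ?thesis using k by simp
    qed
    have hE: "E' / 2 * \<beta> = h" by (simp add: h_def)
    have bx: "0 \<le> \<beta> * x0" "0 \<le> \<beta> * x1" "0 \<le> \<beta> * x2" "0 \<le> \<beta> * x3" using x \<beta> by auto
    have 1: "(1 - p) * (E' / 2) = \<alpha>1" using pE' by simp
    have 2: "2 + p + \<alpha>1 \<le> 3 * \<alpha>" using \<alpha> by (simp add: p_def)
    let ?L = "\<alpha>1 * (\<beta> * x1) + \<alpha> * (\<beta> * x0 + \<beta> * x2 + \<beta> * x3) + k * y"
    have "\<beta> * x0 + \<beta> * x2 + E' / 2 * (\<beta> * x1 + \<beta> * x3) + \<kappa> * y \<le> ?L \<or>
      \<beta> * x0 + \<beta> * x3 + E' / 2 * (\<beta> * x1 + \<beta> * x2) + \<kappa> * y \<le> ?L \<or>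
      \<beta> * x2 + \<beta> * x3 + E' / 2 * (\<beta> * x0 + \<beta> * x1) + \<kappa> * y \<le> ?L \<or>
      \<beta> * x0 + \<beta> * x2 + \<beta> * x3 + \<kappa>X * y \<le> ?L"
      by (rule min_pair_or_triple_le[OF _ _ 1 2 k' bx y]) (use p in auto)
    then show "\<exists>(e0, e1, e2, e3, \<kappa>)\<in>?J. e0 * x0 + e1 * x1 + e2 * x2 + e3 * x3 + \<kappa> * y
      \<le> \<alpha> * \<beta> * x0 + \<alpha>1 * \<beta> * x1 + \<alpha> * \<beta> * x2 + \<alpha> * \<beta> * x3 + k * y"
      unfolding hE[symmetric] by (elim disjE) (simp_all add: algebra_simps)
  qed simp
qed

text \<open>Since \<langle>\<xi>1\<rangle> is at most three times the largest of the other brackets,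
  its k-th power cancels one of the three frequency weights. The resulting forms differ by a
  permutation of slots, so it suffices to bound the one without frequency weight in slot 3.\<close>

lemma L2_bounded_full_weights:
  fixes A A1 k :: real
  assumes k: "0 \<le> k"
    and core: "L2_bounded (weight A k :: real \<times> 'b::euclidean_space \<Rightarrow> ennreal) (weight A1 0) (weight A k) (weight A 0)"
  shows "L2_bounded (weight A k :: real \<times> 'b \<Rightarrow> ennreal) (weight A1 (- k)) (weight A k) (weight A k)"
proof (rule L2_bounded_dominated[where K="3 powr k" and J="{0, 1, 2 :: nat}"
      and ?v0.0="\<lambda>j. weight A (if j = 0 then 0 else k)" and ?v1.0="\<lambda>j. weight A1 0"
      and ?v2.0="\<lambda>j. weight A (if j = 1 then 0 else k)" and ?v3.0="\<lambda>j. weight A (if j = 2 then 0 else k)"])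
  have 1: "L2_bounded (weight A k :: real \<times> 'b \<Rightarrow> ennreal) (weight A1 0) (weight A 0) (weight A k)"
    by (rule L2_bounded_swap_23) (auto intro: core)
  have 0: "L2_bounded (weight A 0 :: real \<times> 'b \<Rightarrow> ennreal) (weight A1 0) (weight A k) (weight A k)"
    by (rule L2_bounded_swap_02) (auto intro: 1)
  show "L2_bounded (weight A (if j = 0 then 0 else k) :: real \<times> 'b \<Rightarrow> ennreal) (weight A1 0)
      (weight A (if j = 1 then 0 else k)) (weight A (if j = 2 then 0 else k))" if "j \<in> {0, 1, 2 :: nat}" for j
    using that 0 1 core by auto
  fix a b c :: "real \<times> 'b"
  let ?m = "\<lambda>z. \<langle>fst z + (norm (snd z))\<^sup>2\<rangle>"
  define M where "M = ?m a powr (- A) * ?m b powr (- A) * ?m c powr (- A) * ?m (a + b + c) powr (- A1)"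
  define x y z w where "x = \<langle>snd a\<rangle> powr k" and "y = \<langle>snd b\<rangle> powr k" and "z = \<langle>snd c\<rangle> powr k" and "w = \<langle>snd (a + b + c)\<rangle> powr k"
  have pos: "0 < x" "0 < y" "0 < z" "0 \<le> M" by (auto simp: x_def y_def z_def M_def)
  have w: "w \<le> 3 powr k * (x + y + z)"
  proof -
    define m where "m = max \<langle>snd a\<rangle> (max \<langle>snd b\<rangle> \<langle>snd c\<rangle>)"
    have "\<langle>snd (a + b + c)\<rangle> \<le> \<langle>snd a\<rangle> + \<langle>snd b\<rangle> + \<langle>snd c\<rangle>"
      using japanese_triangle[of "snd a + snd b" "snd c"] japanese_triangle[of "snd a" "snd b"] by simp
    also have "\<dots> \<le> 3 * m" by (auto simp: m_def)
    finally have "w \<le> (3 * m) powr k" unfolding w_def using k by (intro powr_mono2) auto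
    also have "\<dots> = 3 powr k * m powr k" by (rule powr_mult)
    also have "m powr k \<le> x + y + z"
      using pos by (auto simp: m_def x_def y_def z_def max_def)
    finally show ?thesis by simp
  qed
  have "weight A k a * weight A k b * weight A k c * weight A1 (- k) (a + b + c) = ennreal (M * (w / (x * y * z)))"
    by (simp add: weight_def M_def x_def y_def z_def w_def ennreal_mult[symmetric] powr_minus field_simps)
  also have "\<dots> \<le> ennreal (M * ((3 powr k * (x + y + z)) / (x * y * z)))"
    using pos w by (intro ennreal_leI mult_left_mono divide_right_mono) auto
  also have "M * ((3 powr k * (x + y + z)) / (x * y * z)) = 3 powr k * (M / (y * z) + M / (x * z) + M / (x * y))"
    using pos by (simp add: field_simps)
  also have "ennreal \<dots> = ennreal (3 powr k) * (ennreal (M / (y * z)) + ennreal (M / (x * z)) + ennreal (M / (x * y)))"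
    using pos by (simp add: ennreal_mult[symmetric] ennreal_plus[symmetric] del: ennreal_plus)
  also have "ennreal (M / (y * z)) = weight A 0 a * weight A k b * weight A k c * weight A1 0 (a + b + c)"
    by (simp add: weight_def M_def y_def z_def ennreal_mult[symmetric] powr_minus field_simps)
  also have "ennreal (M / (x * z)) = weight A k a * weight A 0 b * weight A k c * weight A1 0 (a + b + c)"
    by (simp add: weight_def M_def x_def z_def ennreal_mult[symmetric] powr_minus field_simps)
  also have "ennreal (M / (x * y)) = weight A k a * weight A k b * weight A 0 c * weight A1 0 (a + b + c)"
    by (simp add: weight_def M_def x_def y_def ennreal_mult[symmetric] powr_minus field_simps)
  finally show "weight A k a * weight A k b * weight A k c * weight A1 (- k) (a + b + c)
    \<le> ennreal (3 powr k) * (\<Sum>j\<in>{0, 1, 2 :: nat}. weight A (if j = 0 then 0 else k) a * weight A (if j = 1 then 0 else k) b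
       * weight A (if j = 2 then 0 else k) c * weight A1 0 (a + b + c))"
    by (simp add: add.assoc)
qed auto

text \<open>A \<beta> strictly between max(1 / 2, B, C) and b0 makes the normalized exponents B /
  \<beta> and C / \<beta> less than 1 and leaves strict room in the lower bounds on 3 B + C. That
  room becomes the \<epsilon> of the frequency weights.\<close>

lemma L2_bounded_weights_critical:
  fixes b0 B C k :: real
  assumes b0: "1 / 2 < b0" and B: "B < b0" and C: "0 < C" "C < b0"
    and S: "2 * b0 \<le> 3 * B + C" "(2 + real DIM('b::euclidean_space) - 2 * k) * b0 \<le> 3 * B + C" and k: "0 \<le> k"
  shows "L2_bounded (weight B k :: real \<times> 'b \<Rightarrow> ennreal) (weight C (- k)) (weight B k) (weight B k)"
proof (rule L2_bounded_full_weights[OF k])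
  define \<beta> where "\<beta> = (max (1 / 2) (max B C) + b0) / 2"
  have \<beta>: "1 / 2 < \<beta>" "B < \<beta>" "C < \<beta>" "\<beta> < b0" using b0 B C by (auto simp: \<beta>_def field_simps)
  let ?d = "real DIM('b)"
  \<comment> \<open>The largest E that the exponents can afford: C / \<beta> + 3 B / \<beta> = 2 +
    X.\<close>
  define X where "X = (3 * B + C) / \<beta> - 2"
  have X: "0 < X" "?d - 2 * k < X"
  proof -
    have "2 * \<beta> < 3 * B + C" using S(1) \<beta> by linarith
    then show "0 < X" using \<beta> by (simp add: X_def field_simps)
    show "?d - 2 * k < X"
    proof (cases "?d - 2 * k \<le> 0")
      case True
      then show ?thesis using \<open>0 < X\<close> by linarith
    next
      case False
      then have "(2 + ?d - 2 * k) * \<beta> < (2 + ?d - 2 * k) * b0" using \<beta> by (intro mult_strict_left_mono) auto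
      then have "(2 + ?d - 2 * k) * \<beta> < 3 * B + C" using S(2) by linarith
      then show ?thesis using \<beta> by (simp add: X_def field_simps)
    qed
  qed
  define E where "E = min ?d X"
  have E: "0 \<le> E" "E \<le> ?d" "E \<le> X" using X by (auto simp: E_def)
  \<comment> \<open>If E = d, the condition on \<epsilon> reads 0 <= k. Otherwise \<epsilon> is
    defined by (d - E) (1 + \<epsilon>) = 2 k and is positive because d - 2 k < X = E.\<close>
  obtain \<epsilon> where \<epsilon>: "0 < \<epsilon>" "(?d - E) * (1 + \<epsilon>) / 2 \<le> k"
  proof (cases "E = ?d")
    case True
    then show ?thesis using that[of 1] k by simp
  next
    case False
    then have "E = X" "0 < ?d - E" by (auto simp: E_def min_def split: if_splits)
    then show ?thesis using that[of "2 * k / (?d - E) - 1"] X by (simp add: field_simps)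
  qed
  have "L2_bounded (weight (B / \<beta> * \<beta>) k :: real \<times> 'b \<Rightarrow> ennreal) (weight (C / \<beta> * \<beta>) 0) (weight (B / \<beta> * \<beta>) k) (weight (B / \<beta> * \<beta>) 0)"
  proof (rule L2_bounded_weights[OF \<beta>(1) \<epsilon>(1) _ _ _ _ E(1,2) \<epsilon>(2)])
    have "C / \<beta> + 3 * (B / \<beta>) = X + 2" by (simp add: X_def add_divide_distrib)
    then show "2 + E \<le> C / \<beta> + 3 * (B / \<beta>)" using E by simp
  qed (use \<beta> C in auto)
  then show "L2_bounded (weight B k :: real \<times> 'b \<Rightarrow> ennreal) (weight C 0) (weight B k) (weight B 0)"
    using \<beta> by simp
qed

section \<open>Time localization and the Plancherel inequality\<close>

text \<open>Exponentials are merely bounded, so integrability on the product space has to come from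
  \<open>A\<close> and \<open>B\<close>. All exchanges of Fourier integrals below have this
  form.\<close>

lemma Fubini_bounded_kernel:
  fixes A :: "'a::euclidean_space \<Rightarrow> complex" and B :: "'b::euclidean_space \<Rightarrow> complex" and u :: "'a \<Rightarrow> 'b \<Rightarrow> complex"
  assumes A: "integrable lborel A" and B: "integrable lborel B"
    and u[measurable]: "borel_fun (\<lambda>(x, y). u x y)" and bound: "\<And>x y. norm (u x y) \<le> 1"
  shows "(LBINT x. A x * (LBINT y. u x y * B y)) = (LBINT y. B y * (LBINT x. u x y * A x))"
proof -
  have [measurable]: "borel_fun A" "borel_fun B"
    using A B by (auto dest: borel_measurable_integrable)
  have [measurable]: "borel_fun (\<lambda>z. u (fst z) (snd z))"
    using u by (simp add: case_prod_unfold)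
  have "integrable (lborel \<Otimes>\<^sub>M lborel) (\<lambda>z. A (fst z) * u (fst z) (snd z) * B (snd z))"
  proof (rule Bochner_Integration.integrable_bound)
    show "integrable (lborel \<Otimes>\<^sub>M lborel) (\<lambda>z. A (fst z) * B (snd z))"
    proof (rule lborel_pair.Fubini_integrable)
      show "(\<lambda>z. A (fst z) * B (snd z)) \<in> borel_measurable (lborel \<Otimes>\<^sub>M lborel)" by (simp add: lborel_prod)
    qed (use A B in \<open>auto simp: norm_mult\<close>)
    show "(\<lambda>z. A (fst z) * u (fst z) (snd z) * B (snd z)) \<in> borel_measurable (lborel \<Otimes>\<^sub>M lborel)" by (simp add: lborel_prod)
    show "AE z in lborel \<Otimes>\<^sub>M lborel. norm (A (fst z) * u (fst z) (snd z) * B (snd z)) \<le> norm (A (fst z) * B (snd z))"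
    proof (rule AE_I2)
      fix z :: "'a \<times> 'b"
      have "norm (A (fst z)) * norm (u (fst z) (snd z)) * norm (B (snd z)) \<le> norm (A (fst z)) * 1 * norm (B (snd z))"
        by (intro mult_right_mono mult_left_mono bound) auto
      then show "norm (A (fst z) * u (fst z) (snd z) * B (snd z)) \<le> norm (A (fst z) * B (snd z))" by (simp add: norm_mult)
    qed
  qed
  then have "integrable (lborel \<Otimes>\<^sub>M lborel) (\<lambda>(x, y). A x * u x y * B y)" by (simp add: case_prod_unfold)
  from lborel_pair.Fubini_integral[OF this]
  have F: "(LBINT y. (LBINT x. A x * u x y * B y)) = (LBINT x. (LBINT y. A x * u x y * B y))" .
  have l: "(LBINT y. A x * u x y * B y) = A x * (LBINT y. u x y * B y)" for x
    unfolding mult.assoc by (rule integral_mult_right_zero)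
  have r: "(LBINT x. A x * u x y * B y) = B y * (LBINT x. u x y * A x)" for y
  proof -
    have "A x * u x y * B y = B y * (u x y * A x)" for x by (simp only: ac_simps)
    then show ?thesis by (simp only: integral_mult_right_zero)
  qed
  show ?thesis using F unfolding l r by (rule sym)
qed

section \<open>The Fejer and de la Vallee-Poussin kernels\<close>

text \<open>The value at \<open>0\<close> is \<open>0\<close> (division by zero), not the limit \<open>1 / 2\<close>.\<close>

definition fejer :: "real \<Rightarrow> real" where
  "fejer s = (1 - cos s) / s\<^sup>2"

lemma fejer_nonneg: "0 \<le> fejer s"
  by (simp add: fejer_def)

lemma fejer_minus [simp]: "fejer (- s) = fejer s"
  by (simp add: fejer_def)

lemma fejer_measurable [measurable]: "borel_fun fejer"
  unfolding fejer_def[abs_def] by measurable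

lemma one_minus_cos_le: "1 - cos s \<le> s\<^sup>2 / 2" for s :: real
proof -
  have "(sin (s / 2))\<^sup>2 \<le> (s / 2)\<^sup>2" using abs_sin_x_le_abs_x[of "s / 2"] by (simp only: abs_le_square_iff)
  moreover have "cos s = 1 - 2 * (sin (s / 2))\<^sup>2" using cos_double_sin[of "s / 2"] by simp
  ultimately show ?thesis by (simp add: power_divide)
qed

lemma fejer_le_japanese: "fejer s \<le> 4 * \<langle>s\<rangle> powr (- 2)"
proof (cases "s = 0")
  case False
  have j: "\<langle>s\<rangle> powr (- 2) = 1 / (1 + s\<^sup>2)" by (simp add: japanese_def powr_minus divide_inverse)
  have "(1 - cos s) * (1 + s\<^sup>2) \<le> 4 * s\<^sup>2"
  proof -
    have "(1 - cos s) * (1 + s\<^sup>2) = (1 - cos s) + (1 - cos s) * s\<^sup>2" by (simp add: algebra_simps)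
    also have "\<dots> \<le> s\<^sup>2 / 2 + 2 * s\<^sup>2"
      using one_minus_cos_le[of s] cos_ge_minus_one[of s] by (intro add_mono mult_right_mono) auto
    finally show ?thesis using zero_le_power2[of s] by linarith
  qed
  moreover have "0 < 1 + s\<^sup>2" by (simp add: add_pos_nonneg)
  ultimately show ?thesis using False unfolding j fejer_def by (simp add: divide_simps)
qed (simp add: fejer_def)

lemma fejer_le_half: "fejer s \<le> 1 / 2"
  using one_minus_cos_le[of s] by (cases "s = 0") (auto simp: fejer_def divide_simps)

lemma fejer_integrable: "integrable lborel fejer"
proof (rule integrableI_bounded)
  have "(NINT s. ennreal (norm (fejer s))) \<le> (NINT s. 4 * ennreal (\<langle>s::real\<rangle> powr (- 2)))"
    using fejer_le_japanese fejer_nonneg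
    by (intro nn_integral_mono) (simp add: ennreal_leI ennreal_mult[symmetric] flip: ennreal_numeral)
  also have "\<dots> < \<infinity>"
    using japanese_powr_integrable[of 2] by (simp add: nn_integral_cmult ennreal_mult_less_top)
  finally show "(NINT s. ennreal (norm (fejer s))) < \<infinity>" .
qed simp

text \<open>This is \<open>pi\<close>, but only its positivity and the scaling of the integral are needed.\<close>

definition fejer_const :: real where
  "fejer_const = (LBINT s. fejer s)"

lemma fejer_const_pos: "0 < fejer_const"
proof -
  have c: "cos 1 < (1 :: real)" using cos_monotone_0_pi[of 0 1] pi_gt3 by simp
  have "0 < (1 - cos (1::real)) / 4 * (1 :: real)" using c by simp
  also have "\<dots> = (LBINT s. (1 - cos (1::real)) / 4 * indicator {1..2::real} s)" by simp
  also have "\<dots> \<le> fejer_const" unfolding fejer_const_def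
  proof (rule integral_mono)
    show "integrable lborel (\<lambda>s. (1 - cos (1::real)) / 4 * indicator {1..2::real} s)" by simp
    show "(1 - cos (1::real)) / 4 * indicator {1..2} s \<le> fejer s" for s :: real
    proof (cases "s \<in> {1..2}")
      case True
      then have "cos s \<le> cos 1" using pi_gt3 by (intro cos_monotone_0_pi_le) auto
      moreover have "s\<^sup>2 \<le> 4" using True power_mono[of s 2 2] by simp
      ultimately have "(1 - cos (1::real)) / 4 \<le> (1 - cos s) / s\<^sup>2" using True c by (intro frac_le) auto
      then show ?thesis using True by (simp add: fejer_def)
    qed (simp add: fejer_nonneg)
  qed (rule fejer_integrable)
  finally show ?thesis .
qed

text \<open>The substitution a * s reduces this to \<open>fejer\<close>. The resulting |a| is the
  source of the absolute values in \<open>tent\<close>.\<close>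

lemma has_integral_one_minus_cos:
  shows "integrable lborel (\<lambda>s. (1 - cos (a * s)) / s\<^sup>2)"
    and "(LBINT s. (1 - cos (a * s)) / s\<^sup>2) = \<bar>a\<bar> * fejer_const"
proof -
  have e: "(1 - cos (a * s)) / s\<^sup>2 = a\<^sup>2 * fejer (0 + a * s)" if "a \<noteq> 0" for s
    using that by (cases "s = 0") (auto simp: fejer_def power_mult_distrib)
  show "integrable lborel (\<lambda>s. (1 - cos (a * s)) / s\<^sup>2)"
  proof (cases "a = 0")
    case False
    then show ?thesis unfolding e[OF False]
      by (intro integrable_mult_right lborel_integrable_real_affine fejer_integrable)
  qed simp
  show "(LBINT s. (1 - cos (a * s)) / s\<^sup>2) = \<bar>a\<bar> * fejer_const"
  proof (cases "a = 0")
    case False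
    have J: "fejer_const = \<bar>a\<bar> * (LBINT s. fejer (0 + a * s))"
      unfolding fejer_const_def using lborel_integral_real_affine[OF False, of fejer 0] by simp
    have "(LBINT s. (1 - cos (a * s)) / s\<^sup>2) = a\<^sup>2 * (LBINT s. fejer (0 + a * s))"
      unfolding e[OF False] by simp
    also have "\<dots> = \<bar>a\<bar> * (\<bar>a\<bar> * (LBINT s. fejer (0 + a * s)))"
      by (simp add: power2_eq_square flip: mult.assoc)
    finally show ?thesis unfolding J[symmetric] .
  qed simp
qed

text \<open>The function max 0 (1 - |x|), written as the combination of absolute values that the
  product formula for cosines produces.\<close>

definition tent :: "real \<Rightarrow> real" where
  "tent x = (\<bar>1 + x\<bar> + \<bar>1 - x\<bar>) / 2 - \<bar>x\<bar>"

text \<open>By cos s cos (x s) = (cos ((1 + x) s) + cos ((1 - x) s)) / 2, the integrand combines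
  three rescaled copies of (1 - cos s) / s^2; their integrals are proportional to |1 + x|, |1 - x|
  and |x|.\<close>

lemma fejer_cos_integral:
  shows "integrable lborel (\<lambda>s. fejer s * cos (x * s))"
    and "(LBINT s. fejer s * cos (x * s)) = tent x * fejer_const"
proof -
  let ?g = "\<lambda>a s. (1 - cos (a * s)) / s\<^sup>2"
  have c: "cos s * cos (x * s) = (cos ((1 + x) * s) + cos ((1 - x) * s)) / 2" for s
    using cos_times_cos[of s "x * s"] by (simp add: algebra_simps)
  have e: "fejer s * cos (x * s) = (?g (1 + x) s + ?g (1 - x) s) / 2 - ?g x s" for s
  proof -
    have "fejer s * cos (x * s) = (cos (x * s) - cos s * cos (x * s)) / s\<^sup>2"
      by (simp add: fejer_def left_diff_distrib)
    then show ?thesis unfolding c by (simp add: add_divide_distrib diff_divide_distrib)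
  qed
  note I = has_integral_one_minus_cos
  show "integrable lborel (\<lambda>s. fejer s * cos (x * s))"
    unfolding e by (intro Bochner_Integration.integrable_diff Bochner_Integration.integrable_add integrable_divide I)
  show "(LBINT s. fejer s * cos (x * s)) = tent x * fejer_const"
  proof -
    have "(LBINT s. fejer s * cos (x * s))
      = ((LBINT s. ?g (1 + x) s) + (LBINT s. ?g (1 - x) s)) / 2 - (LBINT s. ?g x s)"
      unfolding e using I(1) by simp
    then show ?thesis unfolding I(2) by (simp add: tent_def field_simps)
  qed
qed

lemma integral_even_cis:
  fixes h :: "real \<Rightarrow> real"
  assumes h: "integrable lborel h" and even: "\<And>s. h (- s) = h s"
  shows "(LBINT s. cis (x * s) * complex_of_real (h s)) = complex_of_real (LBINT s. h s * cos (x * s))"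
proof -
  have [measurable]: "borel_fun h" using h by auto
  have ic: "integrable lborel (\<lambda>s. h s * cos (x * s))"
    by (rule Bochner_Integration.integrable_bound[OF h]) (auto simp: abs_mult mult_left_le)
  have isin: "integrable lborel (\<lambda>s. h s * sin (x * s))"
    by (rule Bochner_Integration.integrable_bound[OF h]) (auto simp: abs_mult mult_left_le)
  have "(LBINT s. h s * sin (x * s)) = (LBINT s. h (0 + (-1) * s) * sin (x * (0 + (-1) * s)))"
    using lborel_integral_real_affine[of "-1" "\<lambda>s. h s * sin (x * s)" 0] by simp
  then have z: "(LBINT s. h s * sin (x * s)) = 0" by (simp add: even)
  have "cis (x * s) * complex_of_real (h s) = complex_of_real (h s * cos (x * s)) + \<i> * complex_of_real (h s * sin (x * s))" for s
    by (simp add: complex_eq_iff)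
  then have "(LBINT s. cis (x * s) * complex_of_real (h s))
     = (LBINT s. complex_of_real (h s * cos (x * s)) + \<i> * complex_of_real (h s * sin (x * s)))" by simp
  also have "\<dots> = complex_of_real (LBINT s. h s * cos (x * s)) + \<i> * complex_of_real (LBINT s. h s * sin (x * s))"
    using ic isin by (subst Bochner_Integration.integral_add) (auto simp del: of_real_mult)
  finally show ?thesis using z by simp
qed

text \<open>De la Vallee-Poussin kernel: its Fourier transform
  \<open>2 * tent (x / 2) - tent x\<close> is the trapezoid equal to 1 on [-1, 1] and 0 outside
  [-2, 2]. The factor 4 is the 2 of this formula times the 2 lost by rescaling the argument.\<close>

definition vallee_poussin :: "real \<Rightarrow> real" where
  "vallee_poussin s = (4 * fejer (2 * s) - fejer s) / fejer_const"

lemma vallee_poussin_measurable [measurable]: "borel_fun vallee_poussin"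
  unfolding vallee_poussin_def[abs_def] by measurable

lemma vallee_poussin_integrable: "integrable lborel vallee_poussin"
proof -
  have "integrable lborel (\<lambda>s. fejer (0 + 2 * s))"
    by (rule lborel_integrable_real_affine[OF fejer_integrable]) simp
  then show ?thesis unfolding vallee_poussin_def[abs_def]
    by (intro integrable_divide Bochner_Integration.integrable_diff integrable_mult_right) (auto intro: fejer_integrable)
qed

lemma vallee_poussin_cis:
  assumes "\<bar>x\<bar> \<le> 1"
  shows "(LBINT s. cis (x * s) * complex_of_real (vallee_poussin s)) = 1"
proof -
  have "(LBINT s. fejer s * cos (x / 2 * s)) = 2 * (LBINT s. fejer (2 * s) * cos (x * s))"
    using lborel_integral_real_affine[of 2 "\<lambda>s. fejer s * cos (x / 2 * s)" 0] by simp
  then have 2: "(LBINT s. fejer (2 * s) * cos (x * s)) = tent (x / 2) * fejer_const / 2"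
    unfolding fejer_cos_integral by linarith
  have i2: "integrable lborel (\<lambda>s. fejer (2 * s) * cos (x * s))"
    using lborel_integrable_real_affine[OF fejer_cos_integral(1)[of "x / 2"], of 2 0] by simp
  have "(LBINT s. vallee_poussin s * cos (x * s))
     = (LBINT s. (4 * (fejer (2 * s) * cos (x * s)) - fejer s * cos (x * s)) / fejer_const)"
    by (simp add: vallee_poussin_def algebra_simps)
  also have "\<dots> = (4 * (LBINT s. fejer (2 * s) * cos (x * s)) - (LBINT s. fejer s * cos (x * s))) / fejer_const"
    using i2 fejer_cos_integral(1)[of x] by simp
  also have "\<dots> = (4 * (tent (x / 2) * fejer_const / 2) - tent x * fejer_const) / fejer_const"
    unfolding 2 fejer_cos_integral(2) ..
  also have "\<dots> = 2 * tent (x / 2) - tent x" using fejer_const_pos by (simp add: field_simps)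
  also have "\<dots> = 1" using assms by (auto simp: tent_def abs_if field_simps)
  finally show ?thesis
    by (subst integral_even_cis) (auto intro: vallee_poussin_integrable simp: vallee_poussin_def)
qed

lemma vallee_poussin_square_integrable:
  "(NINT s. (ennreal \<bar>vallee_poussin s\<bar>)\<^sup>2) < \<infinity>"
proof -
  define M where "M = (4 * (1 / 2) + 1 / 2) / fejer_const"
  have M: "\<bar>vallee_poussin s\<bar> \<le> M" for s
  proof -
    have "\<bar>4 * fejer (2 * s) - fejer s\<bar> \<le> 4 * (1 / 2) + 1 / 2"
      using fejer_le_half[of s] fejer_le_half[of "2 * s"] fejer_nonneg[of s] fejer_nonneg[of "2 * s"] by linarith
    from divide_right_mono[OF this, of fejer_const] show ?thesis
      using fejer_const_pos by (simp add: vallee_poussin_def M_def)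
  qed
  have "(NINT s. (ennreal \<bar>vallee_poussin s\<bar>)\<^sup>2) \<le> (NINT s. ennreal M * ennreal (norm (vallee_poussin s)))"
    using M by (intro nn_integral_mono) (simp add: power2_eq_square ennreal_leI mult_right_mono)
  also have "\<dots> = ennreal M * (NINT s. ennreal (norm (vallee_poussin s)))" by (rule nn_integral_cmult) simp
  also have "\<dots> < \<infinity>" using vallee_poussin_integrable by (simp add: integrable_iff_bounded ennreal_mult_less_top)
  finally show ?thesis .
qed

lemma measurable_cis [measurable]: "borel_fun cis"
  by (intro borel_measurable_continuous_onI continuous_intros)

lemma fourier_integral_measurable [measurable]:
  assumes [measurable]: "borel_fun h"
  shows "borel_fun (fourier_integral h)"
  unfolding fourier_integral_def[abs_def] by measurable

text \<open>The kernel with value R V(R s) at s, where V is \<open>vallee_poussin\<close>, has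
  transform 1 at every t with |t| <= R. Inserting it as a factor therefore changes nothing on the
  support of \<open>h\<close>, and by Fubini the insertion is a convolution in \<tau>.\<close>

lemma fourier_integral_reproducing:
  fixes h :: "real \<times> 'b::euclidean_space \<Rightarrow> complex"
  assumes h: "integrable lborel h" and R: "0 < R" and supp: "AE y in lborel. R < \<bar>fst y\<bar> \<longrightarrow> h y = 0"
  shows "fourier_integral h (\<tau>, \<xi>)
    = (LBINT s. complex_of_real (R * vallee_poussin (R * s)) * fourier_integral h (\<tau> - s, \<xi>))"
proof -
  have [measurable]: "borel_fun h" using h by auto
  let ?A = "\<lambda>s. complex_of_real (R * vallee_poussin (R * s))"
  let ?u = "\<lambda>s y. cis (- (y \<bullet> (\<tau> - s, \<xi>)))"
  have A: "integrable lborel ?A"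
    using lborel_integrable_real_affine[OF vallee_poussin_integrable, of R 0] R
    by (intro integrable_of_real integrable_mult_right) auto
  have "(LBINT s. ?A s * fourier_integral h (\<tau> - s, \<xi>)) = (LBINT y. h y * (LBINT s. ?u s y * ?A s))"
    unfolding fourier_integral_def
    by (rule Fubini_bounded_kernel[OF A h]) (simp_all add: case_prod_unfold)
  also have "\<dots> = (LBINT y. cis (- (y \<bullet> (\<tau>, \<xi>))) * h y)"
  proof (rule integral_cong_AE)
    show "AE y in lborel. h y * (LBINT s. ?u s y * ?A s) = cis (- (y \<bullet> (\<tau>, \<xi>))) * h y"
      using supp
    proof eventually_elim
      case (elim y)
      show ?case
      proof (cases "\<bar>fst y\<bar> \<le> R")
        case True
        have "?u s y * ?A s = cis (- (y \<bullet> (\<tau>, \<xi>))) * (complex_of_real R * (cis (fst y / R * (0 + R * s)) * complex_of_real (vallee_poussin (0 + R * s))))" for s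
        proof -
          have "- (y \<bullet> (\<tau> - s, \<xi>)) = - (y \<bullet> (\<tau>, \<xi>)) + fst y / R * (R * s)"
            using R by (simp add: inner_prod_def algebra_simps)
          then have "?u s y = cis (- (y \<bullet> (\<tau>, \<xi>))) * cis (fst y / R * (R * s))" by (simp only: cis_mult)
          then show ?thesis by (simp add: mult_ac)
        qed
        then have "(LBINT s. ?u s y * ?A s)
          = cis (- (y \<bullet> (\<tau>, \<xi>))) * (R * (LBINT s. cis (fst y / R * (0 + R * s)) * complex_of_real (vallee_poussin (0 + R * s))))"
          by (simp only: integral_mult_right_zero)
        also have "R * (LBINT s. cis (fst y / R * (0 + R * s)) * complex_of_real (vallee_poussin (0 + R * s)))
          = (LBINT s. cis (fst y / R * s) * complex_of_real (vallee_poussin s))"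
          using lborel_integral_real_affine[of R "\<lambda>s. cis (fst y / R * s) * complex_of_real (vallee_poussin s)" 0] R
          by (simp add: scaleR_conv_of_real)
        also have "\<dots> = 1" using True R by (intro vallee_poussin_cis) (simp add: field_simps)
        finally show ?thesis by simp
      next
        case False
        then show ?thesis using elim by simp
      qed
    qed
  qed measurable
  finally show ?thesis by (simp add: fourier_integral_def)
qed

section \<open>Modulation of time-localized functions\<close>

lemma ennreal_norm_integral_le:
  fixes f :: "'a \<Rightarrow> complex"
  shows "ennreal (norm (\<integral>x. f x \<partial>M)) \<le> (\<integral>\<^sup>+x. ennreal (norm (f x)) \<partial>M)"
  by (cases "integrable M f") (auto simp: integral_norm_bound_ennreal not_integrable_integral_eq)

definition sq :: "complex \<Rightarrow> ennreal" where
  "sq z = (ennreal (norm z))\<^sup>2"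

lemma sq_measurable [measurable]: "borel_fun sq"
  unfolding sq_def[abs_def] by measurable

lemma sq_le: "sq a \<le> 2 * sq (a - b) + 2 * sq b"
proof -
  have "(norm a)\<^sup>2 \<le> (norm (a - b) + norm b)\<^sup>2"
    using norm_triangle_ineq[of "a - b" b] by (intro power_mono) auto
  also have "\<dots> \<le> 2 * (norm (a - b))\<^sup>2 + 2 * (norm b)\<^sup>2"
    using sum_squares_bound[of "norm (a - b)" "norm b"] by (simp add: power2_sum)
  finally have "ennreal ((norm a)\<^sup>2) \<le> ennreal (2 * (norm (a - b))\<^sup>2 + 2 * (norm b)\<^sup>2)" by (rule ennreal_leI)
  then show ?thesis by (simp add: sq_def ennreal_power ennreal_mult)
qed

lemma time_localized_pointwise:
  fixes h :: "real \<times> 'b::euclidean_space \<Rightarrow> complex"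
  assumes h: "integrable lborel h" and R: "0 < R" and supp: "AE y in lborel. R < \<bar>fst y\<bar> \<longrightarrow> h y = 0"
  shows "sq (fourier_integral h (\<tau>, \<xi>))
    \<le> ennreal R * (NINT s. (ennreal \<bar>vallee_poussin s\<bar>)\<^sup>2) * (NINT s. sq (fourier_integral h (s, \<xi>)))"
proof -
  have [measurable]: "borel_fun h" using h by auto
  let ?P = "NINT s. (ennreal \<bar>vallee_poussin s\<bar>)\<^sup>2"
  have "ennreal (norm (fourier_integral h (\<tau>, \<xi>)))
    \<le> (NINT s. ennreal (R * \<bar>vallee_poussin (R * s)\<bar>) * ennreal (norm (fourier_integral h (\<tau> - s, \<xi>))))"
    using ennreal_norm_integral_le[of lborel "\<lambda>s. complex_of_real (R * vallee_poussin (R * s)) * fourier_integral h (\<tau> - s, \<xi>)"] R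
    unfolding fourier_integral_reproducing[OF h R supp, of \<tau> \<xi>]
    by (simp add: norm_mult abs_mult ennreal_mult[symmetric])
  then have "sq (fourier_integral h (\<tau>, \<xi>))
    \<le> (NINT s. ennreal (R * \<bar>vallee_poussin (R * s)\<bar>) * ennreal (norm (fourier_integral h (\<tau> - s, \<xi>))))\<^sup>2"
    unfolding sq_def by (rule power_mono) simp
  also have "\<dots> \<le> (NINT s. (ennreal (R * \<bar>vallee_poussin (R * s)\<bar>))\<^sup>2) * (NINT s. (ennreal (norm (fourier_integral h (\<tau> - s, \<xi>))))\<^sup>2)"
    by (rule Cauchy_Schwarz_nn_integral) measurable
  also have "(NINT s. (ennreal (norm (fourier_integral h (\<tau> - s, \<xi>))))\<^sup>2) = (NINT s. sq (fourier_integral h (s, \<xi>)))"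
    unfolding sq_def by (rule NINT_reflect[of "\<lambda>s. (ennreal (norm (fourier_integral h (s, \<xi>))))\<^sup>2"]) measurable
  \<comment> \<open>The substitution R * s consumes one of the two factors R; the other is the one
    on which the time gain rests.\<close>
  also have "(NINT s. (ennreal (R * \<bar>vallee_poussin (R * s)\<bar>))\<^sup>2)
     = ennreal R * (ennreal R * (NINT s. (ennreal \<bar>vallee_poussin (0 + R * s)\<bar>)\<^sup>2))"
  proof -
    have "(ennreal (R * \<bar>vallee_poussin (R * s)\<bar>))\<^sup>2 = ennreal R * (ennreal R * (ennreal \<bar>vallee_poussin (0 + R * s)\<bar>)\<^sup>2)" for s
      using R by (simp add: ennreal_mult power2_eq_square ac_simps)
    then show ?thesis by (simp add: nn_integral_cmult)
  qed
  also have "ennreal R * (NINT s. (ennreal \<bar>vallee_poussin (0 + R * s)\<bar>)\<^sup>2) = ?P"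
    using nn_integral_real_affine[of "\<lambda>s. (ennreal \<bar>vallee_poussin s\<bar>)\<^sup>2" R 0] R by simp
  finally show ?thesis .
qed

abbreviation (input) modulation :: "real \<times> 'b::euclidean_space \<Rightarrow> real" where
  "modulation z \<equiv> fst z + (norm (snd z))\<^sup>2"

text \<open>At fixed \<xi> the condition on the modulation confines \<tau> to an interval of length
  2 M, and the bound of \<open>time_localized_pointwise\<close> is uniform in \<tau>.\<close>

lemma time_localized_low_modulation:
  fixes h :: "real \<times> 'b::euclidean_space \<Rightarrow> complex"
  assumes h: "integrable lborel h" and R: "0 < R" and supp: "AE y in lborel. R < \<bar>fst y\<bar> \<longrightarrow> h y = 0"
    and M: "0 < M"
  shows "(NINT z. indicator {z. \<bar>modulation z\<bar> < M} z * sq (fourier_integral h z))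
    \<le> ennreal (2 * M) * (ennreal R * (NINT s. (ennreal \<bar>vallee_poussin s\<bar>)\<^sup>2)) * (NINT z. sq (fourier_integral h z))"
proof -
  have [measurable]: "borel_fun h" using h by auto
  let ?RP = "ennreal R * (NINT s. (ennreal \<bar>vallee_poussin s\<bar>)\<^sup>2)"
  have [measurable]: "{z :: real \<times> 'b. \<bar>modulation z\<bar> < M} \<in> sets borel"
    by measurable
  have TX: "(NINT z. f z) = (NINT \<xi>. NINT \<tau>. f (\<tau>, \<xi>))"
    if [measurable]: "borel_fun f" for f :: "real \<times> 'b \<Rightarrow> ennreal"
    by (subst NINT_pair, simp, subst NINT_swap) auto
  have "(NINT z. indicator {z. \<bar>modulation z\<bar> < M} z * sq (fourier_integral h z))
    = (NINT \<xi>. NINT \<tau>. indicator {z. \<bar>modulation z\<bar> < M} (\<tau>, \<xi>) * sq (fourier_integral h (\<tau>, \<xi>)))"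
    by (rule TX) measurable
  also have "\<dots> \<le> (NINT \<xi>. ennreal (2 * M) * ?RP * (NINT s. sq (fourier_integral h (s, \<xi>))))"
  proof (rule nn_integral_mono)
    fix \<xi> :: 'b
    let ?N = "NINT s. sq (fourier_integral h (s, \<xi>))"
    have ind: "indicator {z. \<bar>modulation z\<bar> < M} (\<tau>, \<xi>) = (indicator {- M - (norm \<xi>)\<^sup>2<..<M - (norm \<xi>)\<^sup>2} \<tau> :: ennreal)" for \<tau>
    proof -
      have "\<bar>\<tau> + (norm \<xi>)\<^sup>2\<bar> < M \<longleftrightarrow> \<tau> \<in> {- M - (norm \<xi>)\<^sup>2<..<M - (norm \<xi>)\<^sup>2}"
        unfolding greaterThanLessThan_iff abs_less_iff by linarith
      then show ?thesis by (simp add: indicator_def)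
    qed
    have "(NINT \<tau>. indicator {z. \<bar>modulation z\<bar> < M} (\<tau>, \<xi>) * sq (fourier_integral h (\<tau>, \<xi>)))
      \<le> (NINT \<tau>. indicator {- M - (norm \<xi>)\<^sup>2<..<M - (norm \<xi>)\<^sup>2} \<tau> * (?RP * ?N))"
      unfolding ind by (intro nn_integral_mono mult_left_mono time_localized_pointwise[OF h R supp]) auto
    also have "\<dots> = ennreal (2 * M) * (?RP * ?N)"
      using M by (subst nn_integral_multc) (auto simp: algebra_simps)
    finally show "(NINT \<tau>. indicator {z. \<bar>modulation z\<bar> < M} (\<tau>, \<xi>) * sq (fourier_integral h (\<tau>, \<xi>)))
      \<le> ennreal (2 * M) * ?RP * ?N" by (simp add: mult.assoc)
  qed
  also have "\<dots> = ennreal (2 * M) * ?RP * (NINT z. sq (fourier_integral h z))"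
    by (subst TX, simp, subst nn_integral_cmult) auto
  finally show ?thesis .
qed

lemma truncation_integrable:
  fixes w :: "'a::euclidean_space \<Rightarrow> complex"
  assumes w: "w \<in> L2"
  shows "integrable lborel (\<lambda>y. if y \<in> ball 0 r then w y else 0)"
proof (rule Bochner_Integration.integrable_bound)
  have [measurable]: "borel_fun w" using w by (simp add: L2_def)
  have [measurable]: "Measurable.pred borel (\<lambda>x :: 'a. x \<in> ball 0 r)" by (simp add: Measurable.pred_def)
  show "integrable lborel (\<lambda>y. indicator (ball 0 r) y + (norm (w y))\<^sup>2)"
    using w emeasure_lborel_ball_finite[of "0 :: 'a" r]
    by (intro Bochner_Integration.integrable_add integrable_real_indicator) (auto simp: L2_def)
  show "(\<lambda>y. if y \<in> ball 0 r then w y else 0) \<in> borel_measurable lborel" by measurable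
  show "AE y in lborel. norm (if y \<in> ball 0 r then w y else 0) \<le> norm (indicator (ball 0 r) y + (norm (w y))\<^sup>2)"
  proof (rule AE_I2)
    fix y
    have "2 * norm (w y) \<le> (norm (w y))\<^sup>2 + 1" using sum_squares_bound[of "norm (w y)" 1] by simp
    then have "norm (w y) \<le> 1 + (norm (w y))\<^sup>2" using norm_ge_zero[of "w y"] by linarith
    then show "norm (if y \<in> ball 0 r then w y else 0) \<le> norm (indicator (ball 0 r) y + (norm (w y))\<^sup>2)"
      by (auto simp: indicator_def)
  qed
qed

text \<open>The inequality |a|^2 <= 2 |a - b|^2 + 2 |b|^2, used once for \<open>g\<close> and once
  for \<open>G n\<close>, costs the factors 4 and 2, so a smallness condition on \<open>K\<close>
  has to allow for them. With K = 0 and S = UNIV a plain bound is passed to the limit.\<close>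

lemma L2_limit_bound:
  fixes g :: "'a::euclidean_space \<Rightarrow> complex" and G :: "nat \<Rightarrow> 'a \<Rightarrow> complex"
  assumes [measurable]: "borel_fun g" "\<And>n. G n \<in> borel_measurable borel" "S \<in> sets borel"
    and lim: "(\<lambda>n. \<integral>\<^sup>+z. sq (g z - G n z) \<partial>lborel) \<longlonglongrightarrow> 0"
    and bound: "\<And>n. (NINT z. indicator S z * sq (G n z)) \<le> K * (NINT z. sq (G n z)) + L"
    and K: "K < \<infinity>"
  shows "(NINT z. indicator S z * sq (g z)) \<le> 4 * K * (NINT z. sq (g z)) + 2 * L"
proof -
  let ?e = "\<lambda>n. \<integral>\<^sup>+z. sq (g z - G n z) \<partial>lborel"
  let ?N = "NINT z. sq (g z)"
  have sw: "sq (a - b) = sq (b - a)" for a b by (simp add: sq_def norm_minus_commute)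
  have "(NINT z. indicator S z * sq (g z)) \<le> (2 + 4 * K) * ?e n + (4 * K * ?N + 2 * L)" for n
  proof -
    have "(NINT z. indicator S z * sq (g z)) \<le> (NINT z. 2 * sq (g z - G n z) + 2 * (indicator S z * sq (G n z)))"
      using sq_le[of "g _" "G n _"] by (intro nn_integral_mono) (auto simp: indicator_def)
    also have "\<dots> = 2 * ?e n + 2 * (NINT z. indicator S z * sq (G n z))"
      by (simp add: nn_integral_add nn_integral_cmult)
    also have "\<dots> \<le> 2 * ?e n + 2 * (K * (NINT z. sq (G n z)) + L)"
      by (intro add_left_mono mult_left_mono bound) auto
    also have "(NINT z. sq (G n z)) \<le> (NINT z. 2 * sq (g z - G n z) + 2 * sq (g z))"
      using sq_le[of "G n _" "g _"] by (intro nn_integral_mono) (simp add: sw)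
    also have "\<dots> = 2 * ?e n + 2 * ?N" by (simp add: nn_integral_add nn_integral_cmult)
    finally have "(NINT z. indicator S z * sq (g z)) \<le> 2 * ?e n + 2 * (K * (2 * ?e n + 2 * ?N) + L)"
      by (simp add: mult_left_mono add_left_mono)
    also have "\<dots> = (2 + 4 * K) * ?e n + (4 * K * ?N + 2 * L)"
      by (simp add: algebra_simps)
    finally show ?thesis .
  qed
  moreover have "(\<lambda>n. (2 + 4 * K) * ?e n + (4 * K * ?N + 2 * L)) \<longlonglongrightarrow> (2 + 4 * K) * 0 + (4 * K * ?N + 2 * L)"
    using K by (intro tendsto_add tendsto_const ennreal_tendsto_cmult lim) (auto simp: ennreal_mult_less_top)
  ultimately show ?thesis by (intro LIMSEQ_le_const[where X="\<lambda>n. (2 + 4 * K) * ?e n + (4 * K * ?N + 2 * L)"]) auto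
qed

lemma is_fourier_transform_limit:
  assumes "is_fourier_transform w g"
  shows "(\<lambda>n. \<integral>\<^sup>+\<zeta>. sq (g \<zeta> - fourier_integral (\<lambda>y. if y \<in> ball 0 (real n) then w y else 0) \<zeta>) \<partial>lborel) \<longlonglongrightarrow> 0"
  using assms by (simp add: is_fourier_transform_def sq_def ennreal_power)

lemma L2_sq_finite:
  assumes "g \<in> L2"
  shows "(NINT z. sq (g z)) < \<infinity>" "(NINT z. sq (g z)) = ennreal ((L2_norm g)\<^sup>2)"
proof -
  have i: "integrable lborel (\<lambda>x. (norm (g x))\<^sup>2)" using assms by (simp add: L2_def)
  have "(NINT z. sq (g z)) = (NINT z. ennreal ((norm (g z))\<^sup>2))"
    by (simp add: sq_def ennreal_power)
  also have "\<dots> = ennreal (LBINT z. (norm (g z))\<^sup>2)"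
    using i by (intro nn_integral_eq_integral) auto
  also have "\<dots> = ennreal ((L2_norm g)\<^sup>2)" by (simp add: L2_norm_def)
  finally show "(NINT z. sq (g z)) = ennreal ((L2_norm g)\<^sup>2)" .
  then show "(NINT z. sq (g z)) < \<infinity>" by simp
qed

lemma L2_measurable: "g \<in> L2 \<Longrightarrow> g \<in> borel_measurable borel"
  by (simp add: L2_def)

lemma time_localized_high_modulation:
  fixes b :: real
  assumes b: "0 \<le> b"
  obtains C where "0 \<le> C"
    "\<And>R (g :: real \<times> 'b::euclidean_space \<Rightarrow> complex). 0 < R \<Longrightarrow> inverse_fourier_supported R g \<Longrightarrow>
      (NINT z. sq (g z)) \<le> ennreal (C * R powr (2 * b))
        * (NINT z. ennreal (\<langle>modulation z\<rangle> powr (2 * b)) * sq (g z))"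
proof -
  let ?P = "NINT s. (ennreal \<bar>vallee_poussin s\<bar>)\<^sup>2"
  \<comment> \<open>A strictly positive bound, so that one can divide by it in the threshold
    \<open>M\<close>.\<close>
  obtain p where p: "?P \<le> ennreal p" "0 < p"
  proof -
    obtain q where "?P = ennreal q" "0 \<le> q" using vallee_poussin_square_integrable by (cases ?P) auto
    then show ?thesis using that[of "q + 1"] by (simp add: ennreal_leI)
  qed
  \<comment> \<open>Anticipates \<open>2 * M powr (- (2 * b)) = C * R powr (2 * b)\<close> for the
    threshold M = 1 / (16 R p).\<close>
  define C where "C = 2 * (16 * p) powr (2 * b)"
  show ?thesis
  proof
    show "0 \<le> C" by (simp add: C_def)
    fix R and g :: "real \<times> 'b \<Rightarrow> complex"
    assume R: "0 < R" and "inverse_fourier_supported R g"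
    then obtain w where w: "is_fourier_transform w g" "AE y in lborel. R < \<bar>fst y\<bar> \<longrightarrow> w y = 0"
      unfolding inverse_fourier_supported_def by blast
    have L: "w \<in> L2" "g \<in> L2" using w by (auto simp: is_fourier_transform_def)
    note [measurable] = L2_measurable[OF L(1)] L2_measurable[OF L(2)]
    \<comment> \<open>Chosen so that 2 M R p = 1 / 8. The passage to the limit multiplies this by 4,
      and at most half of the energy of \<open>g\<close> remains below modulation M.\<close>
    define M where "M = 1 / (16 * R * p)"
    have M: "0 < M" using R p by (simp add: M_def)
    define h where "h n = (\<lambda>y. if y \<in> ball 0 (real n) then w y else 0)" for n :: nat
    have h: "integrable lborel (h n)" for n unfolding h_def by (rule truncation_integrable[OF L(1)])
    have hs: "AE y in lborel. R < \<bar>fst y\<bar> \<longrightarrow> h n y = 0" for n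
      using w(2) by eventually_elim (auto simp: h_def)
    have [measurable]: "borel_fun (h n)" for n using h[of n] by auto
    define S where "S = {z :: real \<times> 'b. \<bar>modulation z\<bar> < M}"
    have [measurable]: "S \<in> sets borel" unfolding S_def by measurable
    let ?G = "NINT z. sq (g z)"
    let ?X = "NINT z. ennreal (\<langle>modulation z\<rangle> powr (2 * b)) * sq (g z)"
    have K: "ennreal (2 * M) * (ennreal R * ?P) \<le> ennreal (1 / 8)"
    proof -
      have "ennreal (2 * M) * (ennreal R * ?P) \<le> ennreal (2 * M) * (ennreal R * ennreal p)"
        using p by (intro mult_left_mono) auto
      also have "\<dots> = ennreal (1 / 8)" using R p M by (simp add: ennreal_mult[symmetric] M_def)
      finally show ?thesis .
    qed
    have "(NINT z. indicator S z * sq (g z)) \<le> 4 * ennreal (1 / 8) * ?G + 2 * 0"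
    proof (rule L2_limit_bound[where G="\<lambda>n. fourier_integral (h n)"])
      show "(\<lambda>n. \<integral>\<^sup>+z. sq (g z - fourier_integral (h n) z) \<partial>lborel) \<longlonglongrightarrow> 0"
        unfolding h_def by (rule is_fourier_transform_limit[OF w(1)])
      show "(NINT z. indicator S z * sq (fourier_integral (h n) z))
        \<le> ennreal (1 / 8) * (NINT z. sq (fourier_integral (h n) z)) + 0" for n
        using order_trans[OF time_localized_low_modulation[OF h R hs M] mult_right_mono[OF K]]
        unfolding S_def by simp
    qed auto
    also have "4 * ennreal (1 / 8) * ?G + 2 * 0 = ennreal (1 / 2) * ?G"
      by (simp add: ennreal_mult[symmetric] flip: ennreal_numeral)
    finally have low: "(NINT z. indicator S z * sq (g z)) \<le> ennreal (1 / 2) * ?G" .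
    have "?G \<le> (NINT z. indicator S z * sq (g z) + ennreal (M powr (- (2 * b))) * (ennreal (\<langle>modulation z\<rangle> powr (2 * b)) * sq (g z)))"
    proof (rule nn_integral_mono)
      fix z :: "real \<times> 'b"
      show "sq (g z) \<le> indicator S z * sq (g z) + ennreal (M powr (- (2 * b))) * (ennreal (\<langle>modulation z\<rangle> powr (2 * b)) * sq (g z))"
      proof (cases "z \<in> S")
        case False
        then have "M \<le> \<langle>modulation z\<rangle>" using japanese_ge_abs[of "modulation z"] by (simp add: S_def)
        then have "M powr (2 * b) \<le> \<langle>modulation z\<rangle> powr (2 * b)" using M b by (intro powr_mono2) auto
        then have "1 \<le> M powr (- (2 * b)) * \<langle>modulation z\<rangle> powr (2 * b)" using M by (simp add: powr_minus field_simps)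
        then have "1 \<le> ennreal (M powr (- (2 * b)) * \<langle>modulation z\<rangle> powr (2 * b))" by simp
        from mult_right_mono[OF this, of "sq (g z)"] show ?thesis using False by (simp add: ennreal_mult mult.assoc)
      qed (simp add: add_increasing2)
    qed
    also have "\<dots> = (NINT z. indicator S z * sq (g z)) + ennreal (M powr (- (2 * b))) * ?X"
      by (simp add: nn_integral_add nn_integral_cmult)
    also have "\<dots> \<le> ennreal (1 / 2) * ?G + ennreal (M powr (- (2 * b))) * ?X"
      by (rule add_right_mono[OF low])
    finally have G: "?G \<le> ennreal (1 / 2) * ?G + ennreal (M powr (- (2 * b))) * ?X" .
    have C: "2 * M powr (- (2 * b)) = C * R powr (2 * b)"
    proof -
      have "M powr (- (2 * b)) = (16 * p * R) powr (2 * b)"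
        using R p by (simp add: M_def powr_minus powr_divide mult_ac)
      also have "\<dots> = (16 * p) powr (2 * b) * R powr (2 * b)" by (rule powr_mult)
      finally show ?thesis by (simp add: C_def)
    qed
    show "?G \<le> ennreal (C * R powr (2 * b)) * ?X"
    proof (cases "ennreal (M powr (- (2 * b))) * ?X")
      case (real r)
      \<comment> \<open>Half of the energy is absorbed on the left, which is legitimate because it
        is finite for \<open>g\<close> in \<open>L2\<close>.\<close>
      obtain u where u: "?G = ennreal u" "0 \<le> u" using L2_sq_finite(1)[OF L(2)] by (cases ?G) auto
      have "ennreal u \<le> ennreal (1 / 2) * ennreal u + ennreal r" using G by (simp only: u(1) real)
      also have "\<dots> = ennreal (1 / 2 * u) + ennreal r" by (subst ennreal_mult) (use u in auto)
      also have "\<dots> = ennreal (1 / 2 * u + r)" by (rule ennreal_plus[symmetric]) (use u real in auto)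
      finally have "u \<le> 1 / 2 * u + r" by (subst (asm) ennreal_le_iff) (use u real in auto)
      then have "u \<le> 2 * r" by simp
      then have "?G \<le> ennreal (2 * r)" using u by (simp add: ennreal_leI)
      also have "\<dots> = ennreal 2 * (ennreal (M powr (- (2 * b))) * ?X)" using real by (simp add: ennreal_mult)
      also have "\<dots> = ennreal (2 * M powr (- (2 * b))) * ?X" by (simp add: ennreal_mult mult.assoc)
      finally show ?thesis unfolding C .
    next
      case top
      have "ennreal (C * R powr (2 * b)) * ?X = ennreal 2 * (ennreal (M powr (- (2 * b))) * ?X)"
        unfolding C[symmetric] by (simp add: ennreal_mult mult.assoc)
      then show ?thesis using top by (simp add: ennreal_mult_top)
    qed
  qed
qed

section \<open>The Plancherel inequality\<close>

lemma fejer_lower_bound: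
  obtains \<delta> where "0 < \<delta>" "\<And>x. 0 < \<bar>x\<bar> \<Longrightarrow> \<bar>x\<bar> \<le> \<delta> \<Longrightarrow> 1 / 8 \<le> fejer x"
proof -
  \<comment> \<open>\<open>fejer x\<close> is half the square of sin (x / 2) / (x / 2), and this
    quotient tends to 1. The point x = 0 is excluded since \<open>fejer 0 = 0\<close>.\<close>
  have "((\<lambda>h. (sin (0 + h) - sin 0) / h) \<longlongrightarrow> cos (0 :: real)) (at 0)"
    using DERIV_sin[of "0 :: real"] unfolding DERIV_def .
  then have "((\<lambda>h :: real. sin h / h) \<longlongrightarrow> 1) (at 0)" by simp
  from order_tendstoD(1)[OF this, of "1 / 2"] obtain d where d: "0 < d"
    "\<And>x :: real. x \<noteq> 0 \<Longrightarrow> dist x 0 < d \<Longrightarrow> 1 / 2 < sin x / x"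
    unfolding eventually_at by auto
  show ?thesis
  proof
    show "0 < d" by fact
    fix x :: real assume x: "0 < \<bar>x\<bar>" "\<bar>x\<bar> \<le> d"
    then have "1 / 2 < sin (x / 2) / (x / 2)" using d by (intro d(2)) auto
    then have "(1 / 2)\<^sup>2 \<le> (sin (x / 2) / (x / 2))\<^sup>2" by (intro power_mono) auto
    also have "\<dots> = 2 * fejer x"
    proof -
      have "cos x = 1 - 2 * (sin (x / 2))\<^sup>2" using cos_double_sin[of "x / 2"] by simp
      then show ?thesis by (simp add: fejer_def power_divide)
    qed
    finally show "1 / 8 \<le> fejer x" by (simp add: power2_eq_square)
  qed
qed

lemma measurable_cnj [measurable]: "borel_fun cnj"
  by (intro borel_measurable_continuous_onI continuous_intros)

lemma cis_sum: "cis (\<Sum>i\<in>A. f i) = (\<Prod>i\<in>A. cis (f i))"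
  by (induction A rule: infinite_finite_induct) (auto simp: cis_mult[symmetric])

text \<open>A summability factor: off the coordinate hyperplanes it tends to 2^-d as e tends to 0,
  while its Fourier transform is nonnegative with mass bounded independently of e.\<close>

definition fejer_kernel :: "real \<Rightarrow> 'a::euclidean_space \<Rightarrow> real" where
  "fejer_kernel e \<zeta> = (\<Prod>b\<in>Basis. fejer (e * (\<zeta> \<bullet> b)))"

lemma fejer_kernel_measurable [measurable]: "borel_fun (fejer_kernel e)"
  unfolding fejer_kernel_def[abs_def] by measurable

lemma fejer_kernel_nonneg: "0 \<le> fejer_kernel e \<zeta>"
  unfolding fejer_kernel_def by (intro prod_nonneg ballI fejer_nonneg)

text \<open>The product structure reduces the transform to one variable, where it is a tent of
  half-width e and height of order 1 / e.\<close>

lemma fejer_kernel_fourier: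
  fixes x :: "'a::euclidean_space"
  assumes e: "0 < e"
  shows "integrable lborel (\<lambda>\<zeta>. cis (x \<bullet> \<zeta>) * complex_of_real (fejer_kernel e \<zeta>))" (is "integrable _ ?f")
    and "(LBINT \<zeta>. cis (x \<bullet> \<zeta>) * complex_of_real (fejer_kernel e \<zeta>))
      = complex_of_real (\<Prod>b\<in>Basis. tent (x \<bullet> b / e) * fejer_const / e)"
proof -
  interpret product_sigma_finite "\<lambda>_::'a. lborel :: real measure" ..
  have 1: "integrable lborel (\<lambda>t. cis (c * t) * complex_of_real (fejer (e * t)))" for c
  proof (rule Bochner_Integration.integrable_bound)
    show "integrable lborel (\<lambda>t. fejer (0 + e * t))"
      using e by (intro lborel_integrable_real_affine fejer_integrable) auto
    show "AE t in lborel. norm (cis (c * t) * complex_of_real (fejer (e * t))) \<le> norm (fejer (0 + e * t))"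
      by (rule AE_I2) (simp add: norm_mult)
  qed simp
  have 2: "(LBINT t. cis (c * t) * complex_of_real (fejer (e * t))) = complex_of_real (tent (c / e) * fejer_const / e)" for c
  proof -
    have "(LBINT s. cis (c / e * s) * complex_of_real (fejer s)) = complex_of_real (tent (c / e) * fejer_const)"
      by (subst integral_even_cis[OF fejer_integrable]) (simp_all only: fejer_minus fejer_cos_integral)
    moreover have "(LBINT s. cis (c / e * s) * complex_of_real (fejer s))
      = e *\<^sub>R (LBINT t. cis (c * t) * complex_of_real (fejer (e * t)))"
      using lborel_integral_real_affine[of e "\<lambda>s. cis (c / e * s) * complex_of_real (fejer s)" 0] e by simp
    ultimately show ?thesis using e by (simp add: scaleR_conv_of_real field_simps)
  qed
  have f: "?f (\<Sum>b\<in>Basis. g b *\<^sub>R b) = (\<Prod>b\<in>Basis. cis ((x \<bullet> b) * g b) * complex_of_real (fejer (e * g b)))" for g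
  proof -
    have "x \<bullet> (\<Sum>b\<in>Basis. g b *\<^sub>R b) = (\<Sum>b\<in>Basis. (x \<bullet> b) * g b)"
      by (simp add: inner_sum_right mult.commute)
    moreover have "fejer_kernel e (\<Sum>b\<in>Basis. g b *\<^sub>R b) = (\<Prod>b\<in>Basis. fejer (e * g b))"
      unfolding fejer_kernel_def by (intro prod.cong) (simp_all add: inner_sum_left_Basis)
    ultimately show ?thesis by (simp add: cis_sum prod.distrib)
  qed
  have m: "(\<lambda>g :: 'a \<Rightarrow> real. \<Sum>b\<in>Basis. g b *\<^sub>R b) \<in> (\<Pi>\<^sub>M b\<in>Basis. lborel) \<rightarrow>\<^sub>M borel" by measurable
  have fm: "borel_fun (?f)" by measurable
  show "integrable lborel ?f"
  proof (subst lborel_eq, subst integrable_distr_eq[OF m fm])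
    show "integrable (\<Pi>\<^sub>M b\<in>Basis. lborel) (\<lambda>g. ?f (\<Sum>b\<in>Basis. g b *\<^sub>R b))"
      unfolding f by (intro product_integrable_prod 1) auto
  qed
  have "(LBINT \<zeta>. ?f \<zeta>) = (\<integral>\<zeta>. ?f \<zeta> \<partial>distr (\<Pi>\<^sub>M b\<in>Basis. lborel) borel (\<lambda>f. \<Sum>b\<in>Basis. f b *\<^sub>R b))"
    by (subst lborel_eq) (rule refl)
  also have "\<dots> = (\<integral>g. ?f (\<Sum>b\<in>Basis. g b *\<^sub>R b) \<partial>(\<Pi>\<^sub>M b\<in>Basis. lborel))"
    by (rule integral_distr[OF m fm])
  also have "\<dots> = (\<Prod>b\<in>Basis. complex_of_real (tent (x \<bullet> b / e) * fejer_const / e))"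
    unfolding f by (subst product_integral_prod) (auto intro: 1 simp only: 2 finite_Basis)
  finally show "(LBINT \<zeta>. ?f \<zeta>) = complex_of_real (\<Prod>b\<in>Basis. tent (x \<bullet> b / e) * fejer_const / e)"
    by simp
qed

lemma tent_bounds: "0 \<le> tent x" "tent x \<le> indicator {-1..1} x"
  by (auto simp: tent_def indicator_def abs_if)

lemma tent_measurable [measurable]: "borel_fun tent"
  unfolding tent_def[abs_def] by measurable

text \<open>In each coordinate the width of the tent cancels its height, so the bound does not
  depend on e. This is what later allows e to shrink as the balls grow.\<close>

lemma tent_product_integral_le:
  assumes e: "0 < e"
  shows "(\<integral>\<^sup>+x. ennreal (\<Prod>b\<in>Basis. tent (x \<bullet> b / e) * fejer_const / e) \<partial>(lborel :: 'a::euclidean_space measure))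
    \<le> ennreal (2 * fejer_const) ^ DIM('a)"
proof -
  have J: "0 \<le> fejer_const" using fejer_const_pos by simp
  have "(NINT t. ennreal (tent (t / e) * fejer_const / e)) \<le> ennreal (2 * fejer_const)"
  proof -
    have "(NINT t. ennreal (tent (t / e) * fejer_const / e)) = ennreal e * (NINT t. ennreal (tent t * fejer_const / e))"
      using nn_integral_real_affine[of "\<lambda>t. ennreal (tent (t / e) * fejer_const / e)" e 0] e by simp
    also have "\<dots> \<le> ennreal e * (NINT t. ennreal (fejer_const / e) * indicator {-1..1::real} t)"
    proof (rule mult_left_mono, rule nn_integral_mono)
      fix t :: real
      have "tent t * fejer_const / e \<le> indicator {-1..1} t * fejer_const / e"
        using J e tent_bounds by (intro divide_right_mono mult_right_mono) auto
      then show "ennreal (tent t * fejer_const / e) \<le> ennreal (fejer_const / e) * indicator {-1..1} t"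
        by (cases "t \<in> {-1..1}") (auto simp: indicator_def ennreal_neg intro: ennreal_leI)
    qed simp
    also have "\<dots> = ennreal e * (ennreal (fejer_const / e) * ennreal 2)" by (subst nn_integral_cmult_indicator) auto
    also have "\<dots> = ennreal (2 * fejer_const)" using e J by (simp add: ennreal_mult[symmetric] mult.commute del: ennreal_numeral)
    finally show ?thesis .
  qed
  note 1 = this
  have "(\<integral>\<^sup>+x. ennreal (\<Prod>b\<in>Basis. tent (x \<bullet> b / e) * fejer_const / e) \<partial>(lborel :: 'a measure))
    = (\<integral>\<^sup>+x. (\<Prod>b\<in>Basis. ennreal (tent (x \<bullet> b / e) * fejer_const / e)) \<partial>(lborel :: 'a measure))"
    using e J tent_bounds by (subst prod_ennreal) auto
  also have "\<dots> = (\<Prod>b\<in>(Basis :: 'a set). (NINT t. ennreal (tent (t / e) * fejer_const / e)))"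
    by (rule nn_integral_lborel_prod) (use e J tent_bounds in auto)
  also have "\<dots> \<le> (\<Prod>b\<in>(Basis :: 'a set). ennreal (2 * fejer_const))"
    by (intro prod_mono_ennreal 1)
  finally show ?thesis by simp
qed

lemma fourier_integral_norm_le:
  assumes "integrable lborel f"
  shows "norm (fourier_integral f \<zeta>) \<le> (LBINT y. norm (f y))"
proof -
  have "norm (fourier_integral f \<zeta>) \<le> (LBINT y. norm (cis (- (y \<bullet> \<zeta>)) * f y))"
    unfolding fourier_integral_def by (rule integral_norm_bound)
  then show ?thesis by (simp add: norm_mult)
qed

lemma cnj_fourier_integral:
  "cnj (fourier_integral f \<zeta>) = (LBINT y. cis (y \<bullet> \<zeta>) * cnj (f y))"
  using Bochner_Integration.integral_cnj[of lborel "\<lambda>y. cis (- (y \<bullet> \<zeta>)) * f y"] by (simp add: fourier_integral_def cis_cnj)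

text \<open>Writing |F|^2 as F times its conjugate, two applications of Fubini turn the left side
  into the double integral of f(x) conj(f(y)) k(y - x), where k >= 0 is the transform of the kernel.
  Schur's test, based on |f(x) f(y)| <= |f(x)|^2 + |f(y)|^2, then leaves only the mass of k.\<close>

lemma Plancherel_fejer_le:
  fixes f :: "'a::euclidean_space \<Rightarrow> complex"
  assumes f: "integrable lborel f" and e: "0 < e"
  shows "(NINT \<zeta>. ennreal (fejer_kernel e \<zeta>) * sq (fourier_integral f \<zeta>))
    \<le> 2 * ennreal (2 * fejer_const) ^ DIM('a) * (NINT x. sq (f x))"
proof -
  have [measurable]: "borel_fun f" using f by auto
  let ?K = "\<lambda>\<zeta> :: 'a. complex_of_real (fejer_kernel e \<zeta>)"
  let ?F = "fourier_integral f"
  define k where "k x = (\<Prod>b\<in>Basis. tent (x \<bullet> b / e) * fejer_const / e)" for x :: 'a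
  have [measurable]: "borel_fun k" unfolding k_def[abs_def] by measurable
  have k0: "0 \<le> k x" for x
    unfolding k_def using tent_bounds fejer_const_pos e by (intro prod_nonneg) auto
  have iK: "integrable lborel (\<lambda>\<zeta>. cis (- (x \<bullet> \<zeta>)) * ?K \<zeta>)" for x :: 'a
    using fejer_kernel_fourier(1)[OF e, of "- x"] by simp
  \<comment> \<open>A uniform bound for the transform of \<open>f\<close>; it makes the kernel times
    the transform integrable, as the exchange of integrals with \<open>f\<close> requires.\<close>
  define B where "B = (LBINT y. norm (f y))"
  have FB: "norm (?F \<zeta>) \<le> B" for \<zeta> unfolding B_def by (rule fourier_integral_norm_le[OF f])
  have B0: "0 \<le> B" using FB[of 0] norm_ge_zero order_trans by blast
  have iG: "integrable lborel (\<lambda>\<zeta>. ?K \<zeta> * cnj (?F \<zeta>))"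
  proof (rule Bochner_Integration.integrable_bound)
    show "integrable lborel (\<lambda>\<zeta>. B * norm (?K \<zeta>))"
      using iK[of 0] by (intro integrable_mult_right integrable_norm) simp
    show "AE \<zeta> in lborel. norm (?K \<zeta> * cnj (?F \<zeta>)) \<le> norm (B * norm (?K \<zeta>))"
    proof (rule AE_I2)
      fix \<zeta> :: 'a
      show "norm (?K \<zeta> * cnj (?F \<zeta>)) \<le> norm (B * norm (?K \<zeta>))"
        using mult_right_mono[OF FB abs_ge_zero, of \<zeta> "fejer_kernel e \<zeta>"] B0
        by (simp add: norm_mult abs_mult mult.commute)
    qed
  qed measurable
  have inner: "(LBINT \<zeta>. cis (- (x \<bullet> \<zeta>)) * (?K \<zeta> * cnj (?F \<zeta>))) = (LBINT y. cnj (f y) * complex_of_real (k (y - x)))" for x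
  proof -
    have "(LBINT \<zeta>. cis (- (x \<bullet> \<zeta>)) * (?K \<zeta> * cnj (?F \<zeta>)))
      = (LBINT \<zeta>. (cis (- (x \<bullet> \<zeta>)) * ?K \<zeta>) * (LBINT y. cis (y \<bullet> \<zeta>) * cnj (f y)))"
      unfolding cnj_fourier_integral by (simp only: mult.assoc)
    also have "\<dots> = (LBINT y. cnj (f y) * (LBINT \<zeta>. cis (y \<bullet> \<zeta>) * (cis (- (x \<bullet> \<zeta>)) * ?K \<zeta>)))"
      by (rule Fubini_bounded_kernel[OF iK]) (use f in \<open>simp_all add: case_prod_unfold\<close>)
    also have "\<dots> = (LBINT y. cnj (f y) * complex_of_real (k (y - x)))"
    proof -
      have "cis (y \<bullet> \<zeta>) * (cis (- (x \<bullet> \<zeta>)) * ?K \<zeta>) = cis ((y - x) \<bullet> \<zeta>) * ?K \<zeta>" for y \<zeta>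
        by (simp add: mult.assoc[symmetric] cis_mult inner_diff_left del: mult.assoc)
      then show ?thesis by (simp only: fejer_kernel_fourier(2)[OF e] k_def)
    qed
    finally show ?thesis .
  qed
  have "(LBINT \<zeta>. (?K \<zeta> * cnj (?F \<zeta>)) * ?F \<zeta>)
    = (LBINT x. f x * (LBINT \<zeta>. cis (- (x \<bullet> \<zeta>)) * (?K \<zeta> * cnj (?F \<zeta>))))"
    using Fubini_bounded_kernel[OF iG f, of "\<lambda>\<zeta> x. cis (- (x \<bullet> \<zeta>))"]
    by (simp add: case_prod_unfold fourier_integral_def[of f, symmetric])
  then have I: "(LBINT \<zeta>. (?K \<zeta> * cnj (?F \<zeta>)) * ?F \<zeta>)
    = (LBINT x. f x * (LBINT y. cnj (f y) * complex_of_real (k (y - x))))"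
    unfolding inner .
  let ?N = "NINT x. ennreal (k x)"
  have KF: "?K \<zeta> * cnj (?F \<zeta>) * ?F \<zeta> = complex_of_real (fejer_kernel e \<zeta> * (norm (?F \<zeta>))\<^sup>2)" for \<zeta>
    using complex_norm_square[of "?F \<zeta>"] by (simp add: mult_ac)
  have iKF: "integrable lborel (\<lambda>\<zeta>. fejer_kernel e \<zeta> * (norm (?F \<zeta>))\<^sup>2)"
  proof (rule Bochner_Integration.integrable_bound)
    show "integrable lborel (\<lambda>\<zeta>. B\<^sup>2 * norm (?K \<zeta>))"
      using iK[of 0] by (intro integrable_mult_right integrable_norm) simp
    show "AE \<zeta> in lborel. norm (fejer_kernel e \<zeta> * (norm (?F \<zeta>))\<^sup>2) \<le> norm (B\<^sup>2 * norm (?K \<zeta>))"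
    proof (rule AE_I2)
      fix \<zeta> :: 'a
      have "(norm (?F \<zeta>))\<^sup>2 \<le> B\<^sup>2" by (intro power_mono FB) simp
      then show "norm (fejer_kernel e \<zeta> * (norm (?F \<zeta>))\<^sup>2) \<le> norm (B\<^sup>2 * norm (?K \<zeta>))"
        by (simp add: abs_mult mult.commute mult_left_mono)
    qed
  qed measurable
  have "(NINT \<zeta>. ennreal (fejer_kernel e \<zeta>) * sq (?F \<zeta>))
    = (NINT \<zeta>. ennreal (fejer_kernel e \<zeta> * (norm (?F \<zeta>))\<^sup>2))"
    by (simp add: sq_def ennreal_power ennreal_mult fejer_kernel_nonneg)
  also have "\<dots> = ennreal (LBINT \<zeta>. fejer_kernel e \<zeta> * (norm (?F \<zeta>))\<^sup>2)"
    using iKF by (intro nn_integral_eq_integral) (auto simp: fejer_kernel_nonneg)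
  also have "\<dots> = ennreal (norm (LBINT \<zeta>. (?K \<zeta> * cnj (?F \<zeta>)) * ?F \<zeta>))"
  proof -
    have "0 \<le> (LBINT \<zeta>. fejer_kernel e \<zeta> * (norm (?F \<zeta>))\<^sup>2)"
      by (intro integral_nonneg_AE AE_I2 mult_nonneg_nonneg fejer_kernel_nonneg) simp
    then show ?thesis unfolding KF by (simp del: of_real_mult)
  qed
  also have "\<dots> \<le> (NINT x. ennreal (norm (f x * (LBINT y. cnj (f y) * complex_of_real (k (y - x))))))"
    unfolding I by (rule ennreal_norm_integral_le)
  also have "\<dots> \<le> (NINT x. NINT y. (sq (f x) + sq (f y)) * ennreal (k (y - x)))"
  proof (rule nn_integral_mono)
    fix x
    let ?I = "\<integral>y. cnj (f y) * complex_of_real (k (y - x)) \<partial>lborel"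
    have "ennreal (norm (f x * ?I)) = ennreal (norm (f x)) * ennreal (norm ?I)"
      by (simp add: norm_mult ennreal_mult)
    also have "\<dots> \<le> ennreal (norm (f x)) * (NINT y. ennreal (norm (cnj (f y) * complex_of_real (k (y - x)))))"
      by (rule mult_left_mono[OF ennreal_norm_integral_le]) simp
    also have "\<dots> = (NINT y. ennreal (norm (f x)) * ennreal (norm (cnj (f y) * complex_of_real (k (y - x)))))"
      by (rule nn_integral_cmult[symmetric]) measurable
    also have "\<dots> \<le> (NINT y. (sq (f x) + sq (f y)) * ennreal (k (y - x)))"
    proof (rule nn_integral_mono)
      fix y
      have "2 * (norm (f x) * norm (f y)) \<le> (norm (f x))\<^sup>2 + (norm (f y))\<^sup>2"
        using sum_squares_bound[of "norm (f x)" "norm (f y)"] by (simp add: mult.assoc)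
      moreover have "0 \<le> norm (f x) * norm (f y)" by simp
      ultimately have "norm (f x) * norm (f y) \<le> (norm (f x))\<^sup>2 + (norm (f y))\<^sup>2" by linarith
      then have "norm (f x) * norm (f y) * k (y - x) \<le> ((norm (f x))\<^sup>2 + (norm (f y))\<^sup>2) * k (y - x)"
        by (rule mult_right_mono) (rule k0)
      then have "ennreal (norm (f x) * norm (f y) * k (y - x)) \<le> ennreal (((norm (f x))\<^sup>2 + (norm (f y))\<^sup>2) * k (y - x))"
        by (rule ennreal_leI)
      then show "ennreal (norm (f x)) * ennreal (norm (cnj (f y) * complex_of_real (k (y - x)))) \<le> (sq (f x) + sq (f y)) * ennreal (k (y - x))"
        using k0[of "y - x"] by (simp add: sq_def norm_mult ennreal_power ennreal_mult mult.assoc)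
    qed
    finally show "ennreal (norm (f x * (LBINT y. cnj (f y) * complex_of_real (k (y - x)))))
      \<le> (NINT y. (sq (f x) + sq (f y)) * ennreal (k (y - x)))" .
  qed
  also have "\<dots> = (NINT x. NINT y. sq (f x) * ennreal (k (y - x))) + (NINT x. NINT y. sq (f y) * ennreal (k (y - x)))"
    by (simp add: distrib_right nn_integral_add)
  also have "(NINT x. NINT y. sq (f y) * ennreal (k (y - x)))
    = (NINT y. NINT x. sq (f y) * ennreal (k (y - x)))"
    by (rule NINT_swap) measurable
  also have "\<dots> = (NINT y. sq (f y)) * ?N"
    using NINT_reflect[of "\<lambda>x. ennreal (k x)"] by (simp add: nn_integral_cmult nn_integral_multc)
  also have "(NINT x. NINT y. sq (f x) * ennreal (k (y - x))) = (NINT x. sq (f x)) * ?N"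
    using NINT_shift[of "\<lambda>y. ennreal (k y)" "- _"] by (simp add: nn_integral_cmult nn_integral_multc)
  also have "(NINT x. sq (f x)) * ?N + (NINT x. sq (f x)) * ?N = 2 * ?N * (NINT x. sq (f x))"
    by (simp add: mult_2 distrib_right distrib_left mult.commute)
  also have "\<dots> \<le> 2 * ennreal (2 * fejer_const) ^ DIM('a) * (NINT x. sq (f x))"
    unfolding k_def by (intro mult_right_mono mult_left_mono tent_product_integral_le e) auto
  finally show ?thesis .
qed

text \<open>As \<open>fejer 0 = 0\<close>, the kernel vanishes on the coordinate hyperplanes, and
  lower bounds for it can hold only almost everywhere.\<close>

lemma AE_inner_Basis_nonzero:
  "AE \<zeta> in (lborel :: 'a::euclidean_space measure). \<forall>b\<in>Basis. \<zeta> \<bullet> b \<noteq> 0"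
proof (rule AE_finite_allI[OF finite_Basis])
  fix b :: 'a assume b: "b \<in> Basis"
  have "negligible {x. b \<bullet> x = 0}" using b by (intro negligible_hyperplane) (auto simp: nonzero_Basis)
  moreover have "{x. b \<bullet> x = 0} \<in> sets borel" by measurable
  ultimately have "{x. b \<bullet> x = 0} \<in> null_sets lborel"
    by (simp add: negligible_iff_null_sets null_sets_completion_iff)
  then show "AE \<zeta> in lborel. \<zeta> \<bullet> b \<noteq> 0"
    by (rule AE_I') (auto simp: inner_commute)
qed

text \<open>On the ball of radius n + 1, the choice e = \<delta> / (n + 1) keeps each e * (\<zeta>
  \<bullet> b) in the range of \<open>fejer_lower_bound\<close>, so the kernel is at least 8^-d
  almost everywhere there. The resulting bound is free of n, and monotone convergence exhausts the
  space.\<close>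

lemma Plancherel_integrable_le:
  obtains C where "0 \<le> C"
    "\<And>f :: 'a::euclidean_space \<Rightarrow> complex. integrable lborel f \<Longrightarrow>
      (NINT \<zeta>. sq (fourier_integral f \<zeta>)) \<le> ennreal C * (NINT x. sq (f x))"
proof -
  let ?d = "DIM('a)"
  obtain \<delta> where \<delta>: "0 < \<delta>" "\<And>x. 0 < \<bar>x\<bar> \<Longrightarrow> \<bar>x\<bar> \<le> \<delta> \<Longrightarrow> 1 / 8 \<le> fejer x"
    using fejer_lower_bound by blast
  define C where "C = 8 ^ ?d * (2 * (2 * fejer_const) ^ ?d)"
  show ?thesis
  proof
    show "0 \<le> C" using fejer_const_pos by (simp add: C_def)
    fix f :: "'a \<Rightarrow> complex" assume f: "integrable lborel f"
    then have [measurable]: "borel_fun f" by auto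
    let ?g = "\<lambda>\<zeta>. sq (fourier_integral f \<zeta>)"
    let ?B = "\<lambda>n \<zeta>. indicator (ball 0 (real (Suc n))) \<zeta> :: ennreal"
    have bound: "(NINT \<zeta>. ?B n \<zeta> * ?g \<zeta>) \<le> ennreal C * (NINT x. sq (f x))" for n
    proof -
      define e where "e = \<delta> / real (Suc n)"
      have e: "0 < e" using \<delta> by (simp add: e_def)
      have "AE \<zeta> in lborel. ?B n \<zeta> * ?g \<zeta> \<le> ennreal (8 ^ ?d) * (ennreal (fejer_kernel e \<zeta>) * ?g \<zeta>)"
        using AE_inner_Basis_nonzero
      proof eventually_elim
        case (elim \<zeta>)
        show ?case
        proof (cases "\<zeta> \<in> ball 0 (real (Suc n))")
          case True
          have "(1 / 8) ^ ?d \<le> fejer_kernel e \<zeta>"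
          proof -
            have "(1 / 8) ^ ?d = (\<Prod>b\<in>(Basis :: 'a set). 1 / 8 :: real)" by simp
            also have "\<dots> \<le> fejer_kernel e \<zeta>"
              unfolding fejer_kernel_def
            proof (rule prod_mono, intro conjI)
              fix b :: 'a assume b: "b \<in> Basis"
              have "\<bar>\<zeta> \<bullet> b\<bar> \<le> real (Suc n)" using True Basis_le_norm[OF b, of \<zeta>] by simp
              then have "e * \<bar>\<zeta> \<bullet> b\<bar> \<le> e * real (Suc n)" using e by (intro mult_left_mono) auto
              then have "\<bar>e * (\<zeta> \<bullet> b)\<bar> \<le> \<delta>" using e \<delta>(1) by (simp add: abs_mult e_def)
              moreover have "0 < \<bar>e * (\<zeta> \<bullet> b)\<bar>" using e elim b by simp
              ultimately show "1 / 8 \<le> fejer (e * (\<zeta> \<bullet> b))" by (intro \<delta>(2))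
            qed simp
            finally show ?thesis .
          qed
          then have "1 \<le> 8 ^ ?d * fejer_kernel e \<zeta>" by (simp add: power_divide field_simps)
          then have "1 \<le> ennreal (8 ^ ?d * fejer_kernel e \<zeta>)" by simp
          from mult_right_mono[OF this, of "?g \<zeta>"] show ?thesis
            using True by (simp add: ennreal_mult fejer_kernel_nonneg mult.assoc)
        qed simp
      qed
      then have "(NINT \<zeta>. ?B n \<zeta> * ?g \<zeta>) \<le> (NINT \<zeta>. ennreal (8 ^ ?d) * (ennreal (fejer_kernel e \<zeta>) * ?g \<zeta>))"
        by (rule nn_integral_mono_AE)
      also have "\<dots> = ennreal (8 ^ ?d) * (NINT \<zeta>. ennreal (fejer_kernel e \<zeta>) * ?g \<zeta>)"
        by (rule nn_integral_cmult) measurable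
      also have "\<dots> \<le> ennreal (8 ^ ?d) * (2 * ennreal (2 * fejer_const) ^ ?d * (NINT x. sq (f x)))"
        by (intro mult_left_mono Plancherel_fejer_le[OF f e]) simp
      also have "\<dots> = ennreal C * (NINT x. sq (f x))"
      proof -
        have "ennreal C = ennreal (8 ^ ?d) * (ennreal 2 * ennreal (2 * fejer_const) ^ ?d)"
          unfolding C_def using fejer_const_pos by (subst ennreal_mult, simp, simp, subst ennreal_mult) (auto simp: ennreal_power)
        then show ?thesis by (simp add: mult.assoc)
      qed
      finally show ?thesis .
    qed
    have "(NINT \<zeta>. ?g \<zeta>) \<le> (NINT \<zeta>. (SUP n. ?B n \<zeta> * ?g \<zeta>))"
    proof (rule nn_integral_mono)
      fix \<zeta> :: 'a
      obtain n where "norm \<zeta> < real n" using reals_Archimedean2 by blast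
      then have "?g \<zeta> = ?B n \<zeta> * ?g \<zeta>" by simp
      also have "\<dots> \<le> (SUP n. ?B n \<zeta> * ?g \<zeta>)" by (rule SUP_upper) simp
      finally show "?g \<zeta> \<le> (SUP n. ?B n \<zeta> * ?g \<zeta>)" .
    qed
    also have "\<dots> = (SUP n. \<integral>\<^sup>+\<zeta>. ?B n \<zeta> * ?g \<zeta> \<partial>lborel)"
    proof (rule nn_integral_monotone_convergence_SUP)
      show "incseq (\<lambda>n \<zeta>. ?B n \<zeta> * ?g \<zeta>)"
        by (intro incseq_SucI le_funI mult_right_mono) (auto simp: indicator_def)
      show "(\<lambda>\<zeta>. ?B n \<zeta> * ?g \<zeta>) \<in> borel_measurable lborel" for n
        by (intro borel_measurable_times_ennreal borel_measurable_indicator) auto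
    qed
    also have "\<dots> \<le> ennreal C * (NINT x. sq (f x))" by (rule SUP_least) (rule bound)
    finally show "(NINT \<zeta>. ?g \<zeta>) \<le> ennreal C * (NINT x. sq (f x))" .
  qed
qed

text \<open>Truncation does not increase the energy of \<open>v\<close>, so the bound for integrable
  functions is uniform along the truncations and passes to the limit that defines the
  transform.\<close>

lemma Plancherel_le:
  obtains C where "0 \<le> C"
    "\<And>v vh :: 'a::euclidean_space \<Rightarrow> complex. is_fourier_transform v vh \<Longrightarrow>
      (NINT \<zeta>. sq (vh \<zeta>)) \<le> ennreal C * (NINT x. sq (v x))"
proof -
  obtain C where C: "0 \<le> C" "\<And>f :: 'a \<Rightarrow> complex. integrable lborel f \<Longrightarrow>
      (NINT \<zeta>. sq (fourier_integral f \<zeta>)) \<le> ennreal C * (NINT x. sq (f x))"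
    using Plancherel_integrable_le by blast
  show ?thesis
  proof
    show "0 \<le> 2 * C" using C by simp
    fix v vh :: "'a \<Rightarrow> complex" assume ft: "is_fourier_transform v vh"
    then have L: "v \<in> L2" "vh \<in> L2" by (auto simp: is_fourier_transform_def)
    note [measurable] = L2_measurable[OF L(1)] L2_measurable[OF L(2)]
    define h where "h n = (\<lambda>y. if y \<in> ball 0 (real n) then v y else 0)" for n :: nat
    have h: "integrable lborel (h n)" for n unfolding h_def by (rule truncation_integrable[OF L(1)])
    have [measurable]: "borel_fun (h n)" for n using h[of n] by auto
    let ?V = "NINT x. sq (v x)"
    have "(NINT \<zeta>. indicator UNIV \<zeta> * sq (vh \<zeta>)) \<le> 4 * 0 * (NINT \<zeta>. sq (vh \<zeta>)) + 2 * (ennreal C * ?V)"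
    proof (rule L2_limit_bound[where G="\<lambda>n. fourier_integral (h n)"])
      show "(\<lambda>n. \<integral>\<^sup>+z. sq (vh z - fourier_integral (h n) z) \<partial>lborel) \<longlonglongrightarrow> 0"
        unfolding h_def by (rule is_fourier_transform_limit[OF ft])
      fix n
      have "(NINT x. sq (h n x)) \<le> ?V"
        by (intro nn_integral_mono) (auto simp: h_def sq_def)
      from order_trans[OF C(2)[OF h] mult_left_mono[OF this]]
      show "(NINT z. indicator UNIV z * sq (fourier_integral (h n) z))
        \<le> 0 * (NINT z. sq (fourier_integral (h n) z)) + ennreal C * ?V" by simp
    qed auto
    then show "(NINT \<zeta>. sq (vh \<zeta>)) \<le> ennreal (2 * C) * ?V"
      using C(1) by (simp add: ennreal_mult mult.assoc)
  qed
qed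

section \<open>The time gain\<close>

lemma sq_modulation_weight:
  "sq (modulation_weight a g z) = ennreal (\<langle>modulation z\<rangle> powr (- (2 * a))) * sq (g z)"
proof -
  have "(\<langle>modulation z\<rangle> powr (- a))\<^sup>2 = \<langle>modulation z\<rangle> powr (- (2 * a))"
    by (simp add: powr_power mult.commute)
  then show ?thesis
    by (cases z) (simp add: modulation_weight_def sq_def norm_mult ennreal_power power_mult_distrib ennreal_mult)
qed

text \<open>Interpolation by a pointwise inequality: with X = \<langle>\<sigma>\<rangle>^(-2a),
  X^\<gamma> <= T^(2 \<gamma> a) (1 + T^(-2a) X). The term 1 is controlled by Plancherel; in the
  other, time localization supplies the factor T^(2a) that cancels T^(-2a).\<close>

lemma time_gain:
  fixes a \<gamma> C0 :: real
  assumes a: "0 \<le> a" and \<gamma>: "0 \<le> \<gamma>" "\<gamma> \<le> 1" and C0: "0 < C0"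
  obtains D where "0 \<le> D"
    "\<And>T (v :: real \<times> 'b::euclidean_space \<Rightarrow> complex) vh. 0 < T \<Longrightarrow> is_fourier_transform v vh \<Longrightarrow>
      inverse_fourier_supported (C0 * T) (modulation_weight a vh) \<Longrightarrow>
      L2_le (\<lambda>z. ennreal (\<langle>modulation z\<rangle> powr (- (\<gamma> * a)) * norm (vh z))) (D * T powr (\<gamma> * a) * L2_norm v)"
proof -
  obtain C where C: "0 \<le> C"
    "\<And>R (g :: real \<times> 'b \<Rightarrow> complex). 0 < R \<Longrightarrow> inverse_fourier_supported R g \<Longrightarrow>
      (NINT z. sq (g z)) \<le> ennreal (C * R powr (2 * a))
        * (NINT z. ennreal (\<langle>modulation z\<rangle> powr (2 * a)) * sq (g z))"
    using time_localized_high_modulation[OF a] by blast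
  obtain P where P: "0 \<le> P" "\<And>v vh :: real \<times> 'b \<Rightarrow> complex. is_fourier_transform v vh \<Longrightarrow>
      (NINT \<zeta>. sq (vh \<zeta>)) \<le> ennreal P * (NINT x. sq (v x))"
    using Plancherel_le by blast
  define D where "D = sqrt ((1 + C * C0 powr (2 * a)) * P)"
  have D: "0 \<le> D" "D\<^sup>2 = (1 + C * C0 powr (2 * a)) * P" using C P by (auto simp: D_def)
  show ?thesis
  proof (rule that[OF D(1)])
    fix T and v vh :: "real \<times> 'b \<Rightarrow> complex"
    assume T: "0 < T" and ft: "is_fourier_transform v vh" and supp: "inverse_fourier_supported (C0 * T) (modulation_weight a vh)"
    have L: "v \<in> L2" "vh \<in> L2" using ft by (auto simp: is_fourier_transform_def)
    note [measurable] = L2_measurable[OF L(1)] L2_measurable[OF L(2)]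
    let ?V = "NINT z. sq (vh z)"
    let ?f = "\<lambda>z. ennreal (\<langle>modulation z\<rangle> powr (- (\<gamma> * a)) * norm (vh z))"
    \<comment> \<open>The localization estimate for g = \<langle>\<sigma>\<rangle>^(-a) vh: the
      factor \<langle>\<sigma>\<rangle>^(2a) on its right side undoes the weight and leaves the
      energy of \<open>vh\<close>.\<close>
    have X: "(NINT z. ennreal (\<langle>modulation z\<rangle> powr (- (2 * a))) * sq (vh z)) \<le> ennreal (C * (C0 * T) powr (2 * a)) * ?V"
    proof -
      have "ennreal (\<langle>modulation z\<rangle> powr (2 * a)) * sq (modulation_weight a vh z) = sq (vh z)" for z
        by (simp add: sq_modulation_weight mult.assoc[symmetric] ennreal_mult[symmetric] powr_add[symmetric])
      then show ?thesis
        using C(2)[OF _ supp] T C0 by (simp add: sq_modulation_weight)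
    qed
    have "(NINT z. (?f z)\<^sup>2)
      \<le> (NINT z. ennreal (T powr (2 * \<gamma> * a)) * (sq (vh z) + ennreal (T powr (- (2 * a))) * (ennreal (\<langle>modulation z\<rangle> powr (- (2 * a))) * sq (vh z))))"
    proof (rule nn_integral_mono)
      fix z :: "real \<times> 'b"
      define X where "X = \<langle>modulation z\<rangle> powr (- (2 * a))"
      have X0: "0 < X" by (simp add: X_def)
      \<comment> \<open>The threshold T^(2a) is the size at which the two endpoint bounds balance;
        normalizing X by it makes both contribute the same power of T.\<close>
      have "X powr \<gamma> = T powr (2 * \<gamma> * a) * (1 powr (1 - \<gamma>) * (T powr (- (2 * a)) * X) powr \<gamma>)"
      proof -
        have "(T powr (- (2 * a)) * X) powr \<gamma> = T powr (- (2 * \<gamma> * a)) * X powr \<gamma>"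
          by (subst powr_mult, subst powr_powr) (simp add: mult_ac)
        then show ?thesis using T by (simp add: powr_minus)
      qed
      also have "\<dots> \<le> T powr (2 * \<gamma> * a) * (1 + T powr (- (2 * a)) * X)"
        using X0 T \<gamma> by (intro mult_left_mono powr_mult_powr_le_add) auto
      finally have "ennreal (X powr \<gamma>) \<le> ennreal (T powr (2 * \<gamma> * a) * (1 + T powr (- (2 * a)) * X))" by (rule ennreal_leI)
      also have "\<dots> = ennreal (T powr (2 * \<gamma> * a)) * (1 + ennreal (T powr (- (2 * a))) * ennreal X)"
        using X0 by (simp add: ennreal_mult ennreal_plus)
      finally have "ennreal (X powr \<gamma>) * sq (vh z) \<le> ennreal (T powr (2 * \<gamma> * a)) * (1 + ennreal (T powr (- (2 * a))) * ennreal X) * sq (vh z)"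
        by (rule mult_right_mono) simp
      moreover have "(?f z)\<^sup>2 = ennreal (X powr \<gamma>) * sq (vh z)"
      proof -
        have "(\<langle>modulation z\<rangle> powr (- (\<gamma> * a)))\<^sup>2 = X powr \<gamma>"
          by (simp add: X_def powr_power powr_powr mult_ac)
        then show ?thesis by (simp add: sq_def ennreal_power power_mult_distrib ennreal_mult)
      qed
      ultimately show "(?f z)\<^sup>2 \<le> ennreal (T powr (2 * \<gamma> * a)) * (sq (vh z) + ennreal (T powr (- (2 * a))) * (ennreal (\<langle>modulation z\<rangle> powr (- (2 * a))) * sq (vh z)))"
        by (simp add: X_def distrib_left distrib_right mult.assoc)
    qed
    also have "\<dots> = ennreal (T powr (2 * \<gamma> * a)) * (?V + ennreal (T powr (- (2 * a))) * (NINT z. ennreal (\<langle>modulation z\<rangle> powr (- (2 * a))) * sq (vh z)))"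
      by (simp add: nn_integral_cmult nn_integral_add)
    also have "\<dots> \<le> ennreal (T powr (2 * \<gamma> * a)) * (?V + ennreal (T powr (- (2 * a))) * (ennreal (C * (C0 * T) powr (2 * a)) * ?V))"
      by (intro mult_left_mono add_left_mono X) auto
    also have "\<dots> = ennreal (T powr (2 * \<gamma> * a) * (1 + C * C0 powr (2 * a))) * ?V"
    proof -
      have eq: "T powr (- (2 * a)) * (C * (C0 * T) powr (2 * a)) = C * C0 powr (2 * a)"
        using T by (simp add: powr_mult powr_minus field_simps)
      have "ennreal A * (ennreal B * ?V) = ennreal (A * B) * ?V" if "0 \<le> A" "0 \<le> B" for A B
        using that by (simp add: ennreal_mult mult.assoc)
      from this[of "T powr (- (2 * a))" "C * (C0 * T) powr (2 * a)"] C(1)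
      have "ennreal (T powr (- (2 * a))) * (ennreal (C * (C0 * T) powr (2 * a)) * ?V) = ennreal (C * C0 powr (2 * a)) * ?V"
        unfolding eq by simp
      then show ?thesis using C(1) by (simp add: ennreal_mult ennreal_plus distrib_right mult.assoc)
    qed
    also have "\<dots> \<le> ennreal (T powr (2 * \<gamma> * a) * (1 + C * C0 powr (2 * a))) * (ennreal P * ennreal ((L2_norm v)\<^sup>2))"
      using P(2)[OF ft] unfolding L2_sq_finite(2)[OF L(1)] by (rule mult_left_mono) simp
    also have "\<dots> = ennreal (T powr (2 * \<gamma> * a) * (1 + C * C0 powr (2 * a)) * (P * (L2_norm v)\<^sup>2))"
      using C(1) P(1) by (simp add: ennreal_mult[symmetric])
    also have "T powr (2 * \<gamma> * a) * (1 + C * C0 powr (2 * a)) * (P * (L2_norm v)\<^sup>2) = (D * T powr (\<gamma> * a) * L2_norm v)\<^sup>2"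
    proof -
      have "T powr (2 * \<gamma> * a) = (T powr (\<gamma> * a))\<^sup>2" using T by (simp add: powr_power mult_ac)
      then show ?thesis by (simp add: power_mult_distrib D(2) mult_ac)
    qed
    finally have "(NINT z. (?f z)\<^sup>2) \<le> ennreal ((D * T powr (\<gamma> * a) * L2_norm v)\<^sup>2)" .
    moreover have "0 \<le> L2_norm v" by (simp add: L2_norm_def)
    ultimately show "L2_le ?f (D * T powr (\<gamma> * a) * L2_norm v)"
      using D(1) by (simp add: L2_le_def)
  qed
qed

section \<open>The estimate\<close>

text \<open>The exponent is shared out: \<gamma> a is spent on the gain in T, and (1 - \<gamma>) a
  goes into the quadrilinear form. For r < 0 both sides are 0.\<close>

lemma weight_split:
  "ennreal (\<langle>modulation z\<rangle> powr (- (\<gamma> * a)) * r) * weight ((1 - \<gamma>) * a) \<kappa> z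
    = ennreal (r * (\<langle>modulation z\<rangle> powr (- a) * \<langle>snd z\<rangle> powr (- \<kappa>)))"
proof (cases "0 \<le> r")
  case True
  have "- (\<gamma> * a) + - ((1 - \<gamma>) * a) = - a" by (simp add: algebra_simps)
  then have "\<langle>modulation z\<rangle> powr (- a) = \<langle>modulation z\<rangle> powr (- (\<gamma> * a)) * \<langle>modulation z\<rangle> powr (- ((1 - \<gamma>) * a))"
    by (simp only: powr_add[symmetric])
  then show ?thesis using True by (simp add: weight_def ennreal_mult[symmetric] mult_ac)
next
  case False
  then show ?thesis by (simp add: ennreal_neg mult_nonneg_nonpos mult_nonpos_nonneg)
qed

lemma Q_integrand_measurable:
  fixes g g1 g2 g3 :: "real \<times> 'b::euclidean_space \<Rightarrow> complex"
  assumes [measurable]: "borel_fun g" "borel_fun g1"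
    "borel_fun g2" "borel_fun g3"
  shows "borel_fun (Q_integrand b1 c1 k g g1 g2 g3)"
  unfolding Q_integrand_def case_prod_unfold Let_def by measurable

lemma norm_Q_integrand:
  "ennreal (norm (Q_integrand b1 c1 k g g1 g2 g3 p)) = (case p of (\<xi>1, \<xi>2, \<xi>3, \<tau>1, \<tau>2, \<tau>3) \<Rightarrow>
    (ennreal (\<langle>modulation (\<tau>1 - \<tau>2, \<xi>1 - \<xi>2)\<rangle> powr (- (\<gamma> * b1)) * norm (g (\<tau>1 - \<tau>2, \<xi>1 - \<xi>2))) * weight ((1 - \<gamma>) * b1) k (\<tau>1 - \<tau>2, \<xi>1 - \<xi>2))
    * (ennreal (\<langle>modulation (\<tau>1, \<xi>1)\<rangle> powr (- (\<gamma> * c1)) * norm (g1 (\<tau>1, \<xi>1))) * weight ((1 - \<gamma>) * c1) (- k) (\<tau>1, \<xi>1))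
    * (ennreal (\<langle>modulation (\<tau>2 - \<tau>3, \<xi>2 - \<xi>3)\<rangle> powr (- (\<gamma> * b1)) * norm (g2 (\<tau>2 - \<tau>3, \<xi>2 - \<xi>3))) * weight ((1 - \<gamma>) * b1) k (\<tau>2 - \<tau>3, \<xi>2 - \<xi>3))
    * (ennreal (\<langle>modulation (\<tau>3, \<xi>3)\<rangle> powr (- (\<gamma> * b1)) * norm (g3 (\<tau>3, \<xi>3))) * weight ((1 - \<gamma>) * b1) k (\<tau>3, \<xi>3)))"
  unfolding weight_split
  by (cases p) (simp add: Q_integrand_def Let_def norm_mult norm_divide ennreal_mult[symmetric] powr_minus field_simps)

theorem lemma3p2:
  fixes b0 \<gamma> \<eta> \<eta>1 \<eta>2 \<eta>3 b1 c1 k T0 C0 :: real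
  assumes "b0 > 1/2"
    and "0 \<le> \<gamma>" "\<gamma> \<le> 1"
    and "0 < \<eta>" "\<eta> \<le> 1" "0 < \<eta>1" "\<eta>1 \<le> 1" "0 < \<eta>2" "\<eta>2 \<le> 1" "0 < \<eta>3" "\<eta>3 \<le> 1"
    and "0 < b1" "b1 < b0" "0 < c1" "c1 < b0"
    and "(1 - \<gamma>) * ((\<eta> + \<eta>2 + \<eta>3) * b1 + \<eta>1 * c1) = 2 * b0"
    and "2 * k \<ge> real CARD('d::finite) - (1 - \<gamma>) * ((1 - \<eta>1) * c1 + (1 - \<eta>2) * b1) / b0"
        "real CARD('d) - (1 - \<gamma>) * ((1 - \<eta>1) * c1 + (1 - \<eta>2) * b1) / b0 \<ge> 0"
    and "2 * k \<ge> real CARD('d) - (1 - \<gamma>) * ((1 - \<eta>) * b1 + (1 - \<eta>1) * c1) / b0"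
        "real CARD('d) - (1 - \<gamma>) * ((1 - \<eta>) * b1 + (1 - \<eta>1) * c1) / b0 \<ge> 0"
    and "2 * k \<ge> real CARD('d) - (1 - \<gamma>) * ((1 - \<eta>1) * c1 + (1 - \<eta>3) * b1) / b0"
        "real CARD('d) - (1 - \<gamma>) * ((1 - \<eta>1) * c1 + (1 - \<eta>3) * b1) / b0 \<ge> 0"
    and "C0 > 0"
  shows "\<exists>C::real. \<forall>T. 0 < T \<and> T \<le> T0 \<longrightarrow>
    (\<forall>v \<in> L2. \<forall>v1 \<in> L2. \<forall>v2 \<in> L2. \<forall>v3 \<in> L2.
     \<forall>vh vh1 vh2 vh3 :: real \<times> (real^'d) \<Rightarrow> complex.
       is_fourier_transform v vh \<and> is_fourier_transform v1 vh1 \<and>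
       is_fourier_transform v2 vh2 \<and> is_fourier_transform v3 vh3 \<and>
       inverse_fourier_supported (C0 * T) (modulation_weight b1 vh) \<and>
       inverse_fourier_supported (C0 * T) (modulation_weight c1 vh1) \<and>
       inverse_fourier_supported (C0 * T) (modulation_weight b1 vh2) \<and>
       inverse_fourier_supported (C0 * T) (modulation_weight b1 vh3) \<longrightarrow>
       integrable lborel (Q_integrand b1 c1 k vh vh1 vh2 vh3) \<and>
       norm (Q_form b1 c1 k vh vh1 vh2 vh3)
         \<le> C * T powr (\<gamma> * (3 * b1 + c1)) * L2_norm v * L2_norm v1 * L2_norm v2 * L2_norm v3)"
proof -
  note A = assms
  define B C1 where "B = (1 - \<gamma>) * b1" and "C1 = (1 - \<gamma>) * c1"
  \<comment> \<open>For \<gamma> = 1 the balance condition would read 0 = 2 b0.\<close>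
  have \<gamma>: "\<gamma> < 1"
  proof (rule ccontr)
    assume "\<not> \<gamma> < 1"
    then have "\<gamma> = 1" using A(3) by simp
    then show False using A(1,16) by simp
  qed
  have B0: "0 < B" "0 < C1" using \<gamma> A by (auto simp: B_def C1_def)
  have "B \<le> b1" "C1 \<le> c1" using A by (auto simp: B_def C1_def mult_left_le_one_le)
  then have Bb: "B < b0" "C1 < b0" using A by auto
  have S: "2 * b0 = (\<eta> + \<eta>2 + \<eta>3) * B + \<eta>1 * C1" using A(16) by (simp add: B_def C1_def algebra_simps)
  have nn: "0 \<le> (1 - \<eta>) * B" "0 \<le> (1 - \<eta>2) * B" "0 \<le> (1 - \<eta>3) * B" "0 \<le> (1 - \<eta>1) * C1"
    using A B0 by auto
  \<comment> \<open>The total exponent exceeds 2 b0 by the parts of b1 and c1 that the factors 1 -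
    \<eta>, ..., 1 - \<eta>3 set aside; all four are nonnegative.\<close>
  have S2: "3 * B + C1 = 2 * b0 + (1 - \<eta>) * B + (1 - \<eta>2) * B + (1 - \<eta>3) * B + (1 - \<eta>1) * C1"
    unfolding S by (simp add: algebra_simps)
  have k0: "0 \<le> k" using A(17,18) by linarith
  have bdd: "L2_bounded (weight B k :: real \<times> (real^'d) \<Rightarrow> ennreal) (weight C1 (- k)) (weight B k) (weight B k)"
  proof (rule L2_bounded_weights_critical[OF A(1) Bb(1) B0(2) Bb(2) _ _ k0])
    show "2 * b0 \<le> 3 * B + C1" using S2 nn by linarith
    \<comment> \<open>After multiplication by b0, two of the four surplus terms cover d - 2 k; hence
      so does the whole surplus, which is the form required by
      \<open>L2_bounded_weights_critical\<close>.\<close>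
    have "real CARD('d) - 2 * k \<le> ((1 - \<eta>1) * C1 + (1 - \<eta>2) * B) / b0"
      using A(17) by (simp add: B_def C1_def algebra_simps)
    then have "(real CARD('d) - 2 * k) * b0 \<le> (1 - \<eta>1) * C1 + (1 - \<eta>2) * B"
      using A(1) by (simp add: pos_le_divide_eq)
    then have "2 * b0 + (real CARD('d) - 2 * k) * b0 \<le> 3 * B + C1" using S2 nn by linarith
    then show "(2 + real DIM(real^'d) - 2 * k) * b0 \<le> 3 * B + C1" by (simp add: algebra_simps)
  qed
  obtain C where C: "0 \<le> C" "L2_bounded_by C (weight B k :: real \<times> (real^'d) \<Rightarrow> ennreal) (weight C1 (- k)) (weight B k) (weight B k)"
    using bdd unfolding L2_bounded_def by blast
  obtain Db where Db: "0 \<le> Db"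
    "\<And>T (v :: real \<times> (real^'d) \<Rightarrow> complex) vh. 0 < T \<Longrightarrow> is_fourier_transform v vh \<Longrightarrow>
      inverse_fourier_supported (C0 * T) (modulation_weight b1 vh) \<Longrightarrow>
      L2_le (\<lambda>z. ennreal (\<langle>modulation z\<rangle> powr (- (\<gamma> * b1)) * norm (vh z))) (Db * T powr (\<gamma> * b1) * L2_norm v)"
    using time_gain[OF less_imp_le[OF A(12)] A(2,3,23), where 'b="real^'d"] by blast
  obtain Dc where Dc: "0 \<le> Dc"
    "\<And>T (v :: real \<times> (real^'d) \<Rightarrow> complex) vh. 0 < T \<Longrightarrow> is_fourier_transform v vh \<Longrightarrow>
      inverse_fourier_supported (C0 * T) (modulation_weight c1 vh) \<Longrightarrow>
      L2_le (\<lambda>z. ennreal (\<langle>modulation z\<rangle> powr (- (\<gamma> * c1)) * norm (vh z))) (Dc * T powr (\<gamma> * c1) * L2_norm v)"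
    using time_gain[OF less_imp_le[OF A(14)] A(2,3,23), where 'b="real^'d"] by blast
  show ?thesis
  proof (intro exI[of _ "C * (Db * Dc * Db * Db)"] allI impI ballI)
    fix T and v v1 v2 v3 vh vh1 vh2 vh3 :: "real \<times> (real^'d) \<Rightarrow> complex"
    assume T: "0 < T \<and> T \<le> T0" and "is_fourier_transform v vh \<and> is_fourier_transform v1 vh1 \<and>
       is_fourier_transform v2 vh2 \<and> is_fourier_transform v3 vh3 \<and>
       inverse_fourier_supported (C0 * T) (modulation_weight b1 vh) \<and>
       inverse_fourier_supported (C0 * T) (modulation_weight c1 vh1) \<and>
       inverse_fourier_supported (C0 * T) (modulation_weight b1 vh2) \<and>
       inverse_fourier_supported (C0 * T) (modulation_weight b1 vh3)"
    then have ft: "is_fourier_transform v vh" "is_fourier_transform v1 vh1"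
       "is_fourier_transform v2 vh2" "is_fourier_transform v3 vh3"
      and supp: "inverse_fourier_supported (C0 * T) (modulation_weight b1 vh)"
       "inverse_fourier_supported (C0 * T) (modulation_weight c1 vh1)"
       "inverse_fourier_supported (C0 * T) (modulation_weight b1 vh2)"
       "inverse_fourier_supported (C0 * T) (modulation_weight b1 vh3)" by auto
    have [measurable]: "borel_fun vh" "borel_fun vh1"
      "borel_fun vh2" "borel_fun vh3"
      using ft by (auto simp: is_fourier_transform_def intro: L2_measurable)
    define f where "f a g z = ennreal (\<langle>modulation z\<rangle> powr (- (\<gamma> * a)) * norm (g z))"
      for a and g :: "real \<times> (real^'d) \<Rightarrow> complex" and z
    have [measurable]: "borel_fun (f a g)" if [measurable]: "borel_fun g" for a g
      unfolding f_def[abs_def] by measurable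
    have le: "L2_le (f b1 vh) (Db * T powr (\<gamma> * b1) * L2_norm v)" "L2_le (f c1 vh1) (Dc * T powr (\<gamma> * c1) * L2_norm v1)"
      "L2_le (f b1 vh2) (Db * T powr (\<gamma> * b1) * L2_norm v2)" "L2_le (f b1 vh3) (Db * T powr (\<gamma> * b1) * L2_norm v3)"
      unfolding f_def[abs_def] using Db(2) Dc(2) ft supp T by blast+
    let ?q = "Q_integrand b1 c1 k vh vh1 vh2 vh3"
    let ?N = "C * (Db * Dc * Db * Db) * T powr (\<gamma> * (3 * b1 + c1)) * L2_norm v * L2_norm v1 * L2_norm v2 * L2_norm v3"
    have "(NINT p. ennreal (norm (?q p)))
      = quad_form (\<lambda>z. f b1 vh z * weight B k z) (\<lambda>z. f c1 vh1 z * weight C1 (- k) z)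
          (\<lambda>z. f b1 vh2 z * weight B k z) (\<lambda>z. f b1 vh3 z * weight B k z)"
      unfolding norm_Q_integrand[where \<gamma>=\<gamma>] B_def[symmetric] C1_def[symmetric] f_def[symmetric]
      by (rule nn_integral_space_time_eq_quad_form) measurable
    also have "\<dots> \<le> ennreal (C * ((Db * T powr (\<gamma> * b1) * L2_norm v) * (Dc * T powr (\<gamma> * c1) * L2_norm v1)
        * (Db * T powr (\<gamma> * b1) * L2_norm v2) * (Db * T powr (\<gamma> * b1) * L2_norm v3)))"
      using C(2) le unfolding L2_bounded_by_def by blast
    also have "C * ((Db * T powr (\<gamma> * b1) * L2_norm v) * (Dc * T powr (\<gamma> * c1) * L2_norm v1)
        * (Db * T powr (\<gamma> * b1) * L2_norm v2) * (Db * T powr (\<gamma> * b1) * L2_norm v3)) = ?N"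
    proof -
      have "\<gamma> * (3 * b1 + c1) = \<gamma> * b1 + \<gamma> * b1 + \<gamma> * b1 + \<gamma> * c1" by (simp add: algebra_simps)
      then have "T powr (\<gamma> * (3 * b1 + c1)) = T powr (\<gamma> * b1) * T powr (\<gamma> * b1) * T powr (\<gamma> * b1) * T powr (\<gamma> * c1)"
        by (simp only: powr_add)
      then show ?thesis by (simp only: mult_ac)
    qed
    finally have bound: "(NINT p. ennreal (norm (?q p))) \<le> ennreal ?N" .
    have int: "integrable lborel ?q"
    proof (rule integrableI_bounded)
      show "?q \<in> borel_measurable lborel" using Q_integrand_measurable[of vh vh1 vh2 vh3] by simp
      show "(NINT p. ennreal (norm (?q p))) < \<infinity>"
        using bound by (rule order_le_less_trans) simp
    qed
    have "0 \<le> ?N" using C(1) Db(1) Dc(1) by (simp add: L2_norm_def)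
    moreover have "ennreal (norm (Q_form b1 c1 k vh vh1 vh2 vh3)) \<le> ennreal ?N"
      unfolding Q_form_def by (rule order_trans[OF ennreal_norm_integral_le bound])
    ultimately have "norm (Q_form b1 c1 k vh vh1 vh2 vh3) \<le> ?N" by (simp add: ennreal_le_iff)
    with int show "integrable lborel ?q \<and> norm (Q_form b1 c1 k vh vh1 vh2 vh3) \<le> ?N" by blast
  qed
qed

end
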